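(* Let $m\geq 1$ be an integer. Writing $$T_{1,0}^{(m)}T_{0,1}^{(m)}=\prod^{\leftarrow}_{b/a\text{ decreasing}}(T_{a,b}^{(m)})^{d(a,b,m)}$$ in the group of Poisson automorphisms of $B_m$, where the ordered product runs over all pairs of integers $a,b\geq 0$ with $a+b\geq 1$, we have $d(a,b,m)\in\mathbf{Z}$ for all $a,b,m$.
   Context: $B_m=\mathbf{Q}[[x,y]]$ is the formal power series ring with the (continuous) Poisson bracket determined by $\{x,y\}=mxy$. For integers $a,b\geq 0$ with $a+b\geq 1$, the Poisson automorphism $T_{a,b}^{(m)}$ of $B_m$ is defined by $$x\mapsto x\,(1-(-1)^{mab}x^ay^b)^{-mb},\qquad y\mapsto y\,(1-(-1)^{mab}x^ay^b)^{ma}.$$ For a rational exponent $c$, the power $(T_{a,b}^{(m)})^c$ is the automorphism $x\mapsto x(1-(-1)^{mab}x^ay^b)^{-mbc}$, $y\mapsto y(1-(-1)^{mab}x^ay^b)^{mac}$. Products of automorphisms are compositions ($ST=S\circ T$). In the ordered product, factors are written from left to right with the slope $b/a\in[0,\infty]$ decreasing (so the factor $T_{0,1}^{(m)}$ with $b/a=\infty$ and its multiples $T^{(m)}_{0,k}$ are leftmost); automorphisms $T_{a,b}^{(m)}$ with equal ratio $b/a$ commute, so their relative order is irrelevant. The infinite ordered product is understood as a limit in the $(x,y)$-adic topology. The exponents $d(a,b,m)$, a priori rational, are uniquely determined by this factorization. *)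

theory Defs
  imports
    "HOL-Computational_Algebra.Formal_Power_Series"
    "HOL-Library.Extended_Real"
    "HOL-Algebra.Group"
begin

text \<open>
  The ring \<open>\<rat>[[x,y]]\<close> is rendered as \<open>\<rat>[[x]][[y]]\<close>: the outer index is the power of \<open>y\<close>.
  The topology that the library puts on this type is not the \<open>(x,y)\<close>-adic one, which is
  therefore spelled out below through the powers of the ideal \<open>(x,y)\<close>.
\<close>

type_synonym bps = "rat fps fps"

definition bX :: bps where "bX = fps_const fps_X"

definition bY :: bps where "bY = fps_X"

definition bcoeff :: "bps \<Rightarrow> nat \<Rightarrow> nat \<Rightarrow> rat" where
  "bcoeff f i j = fps_nth (fps_nth f j) i"

definition bps_of :: "(nat \<Rightarrow> nat \<Rightarrow> rat) \<Rightarrow> bps" where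
  "bps_of c = Abs_fps (\<lambda>j. Abs_fps (\<lambda>i. c i j))"

text \<open>The ideal \<open>(x,y)\<^sup>k\<close> consists of the series without terms of total degree below \<open>k\<close>.\<close>

definition xy_power :: "nat \<Rightarrow> bps set" where
  "xy_power k = {f. \<forall>i j. i + j < k \<longrightarrow> bcoeff f i j = 0}"

definition xy_adic_limit :: "('i \<Rightarrow> bps) \<Rightarrow> bps \<Rightarrow> 'i filter \<Rightarrow> bool" where
  "xy_adic_limit s l F \<longleftrightarrow> (\<forall>k. \<forall>\<^sub>F n in F. s n - l \<in> xy_power k)"

text \<open>
  The continuous biderivation with \<open>{x,y} = m x y\<close> is
  \<open>{f,g} = m x y (\<partial>f/\<partial>x \<partial>g/\<partial>y - \<partial>f/\<partial>y \<partial>g/\<partial>x)\<close>.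
\<close>

definition deriv_x :: "bps \<Rightarrow> bps" where
  "deriv_x f = Abs_fps (\<lambda>j. fps_deriv (fps_nth f j))"

definition deriv_y :: "bps \<Rightarrow> bps" where
  "deriv_y f = fps_deriv f"

definition poisson_bracket :: "nat \<Rightarrow> bps \<Rightarrow> bps \<Rightarrow> bps" where
  "poisson_bracket m f g =
     of_nat m * bX * bY * (deriv_x f * deriv_y g - deriv_y f * deriv_x g)"

text \<open>
  A ring automorphism is automatically \<open>\<rat>\<close>-linear and, since it preserves the maximal ideal
  \<open>(x,y)\<close>, continuous.
\<close>

definition Poisson_Aut :: "nat \<Rightarrow> (bps \<Rightarrow> bps) monoid" where
  "Poisson_Aut m =
     \<lparr>carrier = {\<phi>. bij \<phi> \<and> \<phi> 1 = 1 \<and>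
                    (\<forall>f g. \<phi> (f + g) = \<phi> f + \<phi> g) \<and>
                    (\<forall>f g. \<phi> (f * g) = \<phi> f * \<phi> g) \<and>
                    (\<forall>f g. \<phi> (poisson_bracket m f g) = poisson_bracket m (\<phi> f) (\<phi> g))},
      monoid.mult = (\<lambda>\<phi> \<psi>. \<phi> \<circ> \<psi>),
      one = id\<rparr>"

text \<open>
  The substitution \<open>f(u,v)\<close> is \<open>\<Sum>\<^sub>i\<^sub>,\<^sub>j f\<^sub>i\<^sub>j u\<^sup>i v\<^sup>j\<close>, for \<open>u\<close> and \<open>v\<close> without constant term.
  Only the summands with \<open>i + j \<le> p + q\<close> contribute to the coefficient of \<open>x\<^sup>p y\<^sup>q\<close>,
  because \<open>u\<^sup>i v\<^sup>j \<in> (x,y)\<^sup>i\<^sup>+\<^sup>j\<close>; the sum below covers all of these.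
  Likewise for the binomial series \<open>(1 + u)\<^sup>c = \<Sum>\<^sub>k (c choose k) u\<^sup>k\<close>.
\<close>

definition subst_xy :: "bps \<Rightarrow> bps \<Rightarrow> bps \<Rightarrow> bps" where
  "subst_xy u v f =
     bps_of (\<lambda>p q. \<Sum>i\<le>p + q. \<Sum>j\<le>p + q. bcoeff f i j * bcoeff (u ^ i * v ^ j) p q)"

definition one_plus_powr :: "bps \<Rightarrow> rat \<Rightarrow> bps" where
  "one_plus_powr u c = bps_of (\<lambda>p q. \<Sum>k\<le>p + q. (c gchoose k) * bcoeff (u ^ k) p q)"

text \<open>The power \<open>(T\<^sub>a\<^sub>,\<^sub>b)\<^sup>c\<close> of the automorphism \<open>T\<^sub>a\<^sub>,\<^sub>b\<close>, for \<open>(a,b) \<noteq> (0,0)\<close>.\<close>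

definition T_powr :: "nat \<Rightarrow> nat \<Rightarrow> nat \<Rightarrow> rat \<Rightarrow> bps \<Rightarrow> bps" where
  "T_powr m a b c =
     (let u = - ((-1) ^ (m * a * b) * bX ^ a * bY ^ b) in
      subst_xy (bX * one_plus_powr u (- (of_nat m * of_nat b * c)))
               (bY * one_plus_powr u (of_nat m * of_nat a * c)))"

definition T_aut :: "nat \<Rightarrow> nat \<Rightarrow> nat \<Rightarrow> bps \<Rightarrow> bps" where
  "T_aut m a b = T_powr m a b 1"

definition slope :: "nat \<times> nat \<Rightarrow> ereal" where
  "slope = (\<lambda>(a, b). if a = 0 then \<infinity> else ereal (real b / real a))"

text \<open>
  Factors of equal slope commute, so it does not matter which of the orderings is chosen.
\<close>

definition slope_decreasing_list :: "(nat \<times> nat) set \<Rightarrow> (nat \<times> nat) list" where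
  "slope_decreasing_list S =
     (SOME L. distinct L \<and> set L = S \<and> sorted_wrt (\<lambda>p q. slope p \<ge> slope q) L)"

definition finite_ordered_product ::
    "nat \<Rightarrow> (nat \<Rightarrow> nat \<Rightarrow> rat) \<Rightarrow> (nat \<times> nat) set \<Rightarrow> bps \<Rightarrow> bps" where
  "finite_ordered_product m d S =
     foldr (\<lambda>(a, b) \<phi>. T_powr m a b (d a b) \<otimes>\<^bsub>Poisson_Aut m\<^esub> \<phi>)
       (slope_decreasing_list S) \<one>\<^bsub>Poisson_Aut m\<^esub>"

text \<open>
  The infinite ordered product is the limit of the finite ordered subproducts along the
  directed set of all finite sets of pairs \<open>(a,b) \<noteq> (0,0)\<close>.
\<close>

definition is_ordered_product ::
    "nat \<Rightarrow> (nat \<Rightarrow> nat \<Rightarrow> rat) \<Rightarrow> (bps \<Rightarrow> bps) \<Rightarrow> bool" where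
  "is_ordered_product m d \<phi> \<longleftrightarrow>
     (\<forall>f. xy_adic_limit (\<lambda>S. finite_ordered_product m d S f) (\<phi> f)
            (finite_subsets_at_top {(a, b). a + b \<ge> 1}))"

end

theory Submission
  imports Defs "HOL-Computational_Algebra.Primes"
begin

text \<open>
  Write an automorphism in the group generated by the \<open>T\<^sub>a\<^sub>,\<^sub>b\<close> as \<open>x \<mapsto> x e\<^sup>m\<^sup>L\<close>, \<open>y \<mapsto> y e\<^sup>m\<^sup>M\<close>. It preserves
  \<open>dx/x \<and> dy/y\<close>, so there is a unique \<open>S\<close> without constant term with
  \<open>dS = L dy/y - M dx/x + m L dM\<close>; for \<open>T\<^sub>a\<^sub>,\<^sub>b\<^sup>d\<close> the leading term of \<open>S\<close> is \<open>d (-1)\<^sup>m\<^sup>a\<^sup>b x\<^sup>a y\<^sup>b\<close>, coming from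
  the dilogarithm. Fix a prime \<open>p\<close> and let \<open>F\<close> be the substitution \<open>x \<mapsto> x\<^sup>p\<close>, \<open>y \<mapsto> y\<^sup>p\<close>. By Dwork-type
  congruences for the logarithm and the dilogarithm, a product of integral powers of the \<open>T\<^sub>a\<^sub>,\<^sub>b\<close> has
  the property that
  \<open>S - F(S) / p\<^sup>2 - (m / p) F(L) (M - F(M) / p)\<close>
  has \<open>p\<close>-integral coefficients (for \<open>p = 2\<close> after a quadratic correction). Both the given product and the
  product of all factors of degree less than \<open>N\<close> have this property, by induction on \<open>N\<close>. They differ
  first in degree \<open>N\<close>, and there, up to sign, the difference of the above expressions has the
  exponents \<open>d(a,b,m)\<close> with \<open>a + b = N\<close> as its coefficients. Hence these exponents are \<open>p\<close>-integral for all \<open>p\<close>. The order of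
  the factors plays no role.
\<close>

section \<open>Bivariate power series and continuous substitutions\<close>

text \<open>A product of integral powers of the \<open>T_powr\<close> visibly preserves p-integral
  series, but the lowest coefficients of the images of x and y only show that m a d(a,b,m) and m b
  d(a,b,m) are integral. The obstacle is the factor m gcd(a,b). It disappears on passing from L and
  M to the potential S, at the price of the denominators n^2 of the dilogarithm, which are cleared
  by comparing with F(S) / p^2. The term (m / p) F(L) (M - F(M) / p) originates in m L dM. If D is x
  d/dx or y d/dy, then D F = p F D, and the only part of D(S - F(S) / p^2) that need not be
  p-integral is (m / p) F(L) D(M - F(M) / p). Subtracting the product removes it, and what arises
  instead, m F(D L) (M - F(M) / p), is p-integral. F multiplies degrees by p >= 2, and L and M have
  no constant term. Hence S alone is felt in the lowest degree where two products differ, and the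
  exponents can be read off there. At p = 2 the available bound on the powers of p in factorials
  just misses what the dilogarithm requires; a coefficient 1/2 is left over.\<close>

definition bc :: "rat \<Rightarrow> bps" where "bc c = fps_const (fps_const c)"

lemma bcoeff_bps_of [simp]: "bcoeff (bps_of c) i j = c i j"
  by (simp add: bcoeff_def bps_of_def)

lemma bps_eqI: "(\<And>i j. bcoeff f i j = bcoeff g i j) \<Longrightarrow> f = g"
  by (simp add: bcoeff_def fps_eq_iff)

lemma bcoeff_add [simp]: "bcoeff (f + g) i j = bcoeff f i j + bcoeff g i j"
  and bcoeff_diff [simp]: "bcoeff (f - g) i j = bcoeff f i j - bcoeff g i j"
  and bcoeff_uminus [simp]: "bcoeff (- f) i j = - bcoeff f i j"
  and bcoeff_0 [simp]: "bcoeff 0 i j = 0"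
  and bcoeff_1: "bcoeff 1 i j = (if i = 0 \<and> j = 0 then 1 else 0)"
  and bcoeff_bc: "bcoeff (bc c) i j = (if i = 0 \<and> j = 0 then c else 0)"
  and bcoeff_bc_mult [simp]: "bcoeff (bc c * f) i j = c * bcoeff f i j"
  and bcoeff_fps_const: "bcoeff (fps_const s) i j = (if j = 0 then fps_nth s i else 0)"
  by (auto simp: bcoeff_def bc_def)

lemma bcoeff_sum [simp]: "bcoeff (sum f A) i j = (\<Sum>a\<in>A. bcoeff (f a) i j)"
  by (induction A rule: infinite_finite_induct) auto

lemma bcoeff_mult:
  "bcoeff (f * g) i j = (\<Sum>k\<le>i. \<Sum>l\<le>j. bcoeff f k l * bcoeff g (i - k) (j - l))"
proof -
  have "bcoeff (f * g) i j = (\<Sum>l\<le>j. \<Sum>k\<le>i. bcoeff f k l * bcoeff g (i - k) (j - l))"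
    by (simp add: bcoeff_def fps_mult_nth fps_sum_nth atLeast0AtMost)
  then show ?thesis by (subst sum.swap)
qed

lemma bc_0 [simp]: "bc 0 = 0" and bc_1 [simp]: "bc 1 = 1"
  and bc_diff: "bc (a - b) = bc a - bc b"
  and bc_uminus: "bc (- a) = - bc a" and bc_mult: "bc (a * b) = bc a * bc b"
  and bc_of_nat: "bc (of_nat n) = of_nat n"
  and bc_of_int: "bc (of_int z) = of_int z"
  and bc_numeral: "bc (numeral w) = numeral w"
  by (simp_all add: bc_def fps_of_nat fps_of_int numeral_fps_const)

lemma bc_power: "bc (a ^ n) = bc a ^ n"
  by (induction n) (simp_all add: bc_mult)

lemma bX_power: "bX ^ a = fps_const (fps_X ^ a)"
  by (simp add: bX_def fps_const_power)

lemma bcoeff_monom: "bcoeff (bX ^ a * bY ^ b) i j = (if i = a \<and> j = b then 1 else 0)"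
  by (auto simp: bX_power bY_def bcoeff_def fps_X_power_iff)

section \<open>The (x,y)-adic filtration\<close>

lemma xy_power_0 [simp]: "f \<in> xy_power 0"
  by (simp add: xy_power_def)

lemma xy_power_mono: "f \<in> xy_power k \<Longrightarrow> l \<le> k \<Longrightarrow> f \<in> xy_power l"
  by (auto simp: xy_power_def)

lemma zero_in_xy_power [simp]: "0 \<in> xy_power k"
  by (simp add: xy_power_def)

lemma xy_power_add: "f \<in> xy_power k \<Longrightarrow> g \<in> xy_power k \<Longrightarrow> f + g \<in> xy_power k"
  and xy_power_diff: "f \<in> xy_power k \<Longrightarrow> g \<in> xy_power k \<Longrightarrow> f - g \<in> xy_power k"
  and xy_power_uminus: "f \<in> xy_power k \<Longrightarrow> - f \<in> xy_power k"
  by (simp_all add: xy_power_def)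

lemma xy_power_sum: "(\<And>a. a \<in> A \<Longrightarrow> f a \<in> xy_power k) \<Longrightarrow> sum f A \<in> xy_power k"
  by (induction A rule: infinite_finite_induct) (auto intro: xy_power_add)

lemma xy_power_mult:
  assumes "f \<in> xy_power k" "g \<in> xy_power l"
  shows "f * g \<in> xy_power (k + l)"
  unfolding xy_power_def
proof (clarify)
  fix i j assume ij: "i + j < k + l"
  have "bcoeff f a b * bcoeff g (i - a) (j - b) = 0" if "a \<le> i" "b \<le> j" for a b
  proof (cases "a + b < k")
    case False
    then have "(i - a) + (j - b) < l" using ij that by linarith
    then show ?thesis using assms by (simp add: xy_power_def)
  qed (use assms in \<open>simp add: xy_power_def\<close>)
  then show "bcoeff (f * g) i j = 0"
    unfolding bcoeff_mult by (intro sum.neutral ballI) auto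
qed

lemma xy_power_mult_left: "g \<in> xy_power k \<Longrightarrow> f * g \<in> xy_power k"
  and xy_power_mult_right: "g \<in> xy_power k \<Longrightarrow> g * f \<in> xy_power k"
  using xy_power_mult[of f 0 g k] xy_power_mult[of g k f 0] by simp_all

lemma xy_power_power: "f \<in> xy_power k \<Longrightarrow> f ^ n \<in> xy_power (k * n)"
  by (induction n) (auto intro: xy_power_mult)

lemma xy_power_power1: "f \<in> xy_power 1 \<Longrightarrow> f ^ n \<in> xy_power n"
  using xy_power_power[of f 1 n] by simp

lemma xy_power_all_0: "(\<And>k. f \<in> xy_power k) \<Longrightarrow> f = 0"
proof (rule bps_eqI)
  fix i j assume "\<And>k. f \<in> xy_power k"
  then have "f \<in> xy_power (Suc (i + j))" .
  then show "bcoeff f i j = bcoeff 0 i j" by (simp add: xy_power_def)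
qed

lemma monom_in_xy_power: "bX ^ a * bY ^ b \<in> xy_power (a + b)"
  by (auto simp: xy_power_def bcoeff_monom)

lemma bX_in_xy_power [simp]: "bX \<in> xy_power 1" "bX \<in> xy_power (Suc 0)"
  and bY_in_xy_power [simp]: "bY \<in> xy_power 1" "bY \<in> xy_power (Suc 0)"
  using monom_in_xy_power[of 1 0] monom_in_xy_power[of 0 1] by simp_all

definition truncate_xy :: "nat \<Rightarrow> bps \<Rightarrow> bps" where
  "truncate_xy K f = (\<Sum>i\<le>K. \<Sum>j\<le>K. bc (bcoeff f i j) * (bX ^ i * bY ^ j))"

lemma truncate_xy: "f - truncate_xy K f \<in> xy_power (Suc K)"
proof -
  have "bcoeff (truncate_xy K f) p q = bcoeff f p q" if "p + q < Suc K" for p q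
  proof -
    have "bcoeff (truncate_xy K f) p q =
      (\<Sum>i\<le>K. \<Sum>j\<le>K. if p = i then if q = j then bcoeff f i j else 0 else 0)"
      unfolding truncate_xy_def bcoeff_sum
      by (intro sum.cong refl) (auto simp: bcoeff_monom)
    also have "\<dots> = (\<Sum>i\<le>K. if p = i then \<Sum>j\<le>K. if q = j then bcoeff f i j else 0 else 0)"
      by (intro sum.cong refl) auto
    also have "\<dots> = bcoeff f p q" using that by simp
    finally show ?thesis .
  qed
  then show ?thesis by (simp add: xy_power_def)
qed

section \<open>Linear maps and homomorphisms that respect the filtration\<close>

definition cont_linear :: "(bps \<Rightarrow> bps) \<Rightarrow> bool" where
  "cont_linear A \<longleftrightarrow> (\<forall>f g. A (f + g) = A f + A g) \<and> (\<forall>c f. A (bc c * f) = bc c * A f) \<and>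
     (\<forall>k f. f \<in> xy_power k \<longrightarrow> A f \<in> xy_power k)"

lemma cont_linearD:
  assumes "cont_linear A"
  shows "A (f + g) = A f + A g" "A (bc c * f) = bc c * A f"
    "f \<in> xy_power k \<Longrightarrow> A f \<in> xy_power k"
    "A 0 = 0" "A (- f) = - A f" "A (f - g) = A f - A g"
    "A (sum h S) = (\<Sum>s\<in>S. A (h s))"
proof -
  note a = assms[unfolded cont_linear_def]
  show add: "A (f + g) = A f + A g" for f g using a by blast
  show scale: "A (bc c * f) = bc c * A f" for c f using a by blast
  show "f \<in> xy_power k \<Longrightarrow> A f \<in> xy_power k" using a by blast
  show zero: "A 0 = 0" using scale[of 0 0] by simp
  show neg: "A (- f) = - A f" for f using scale[of "-1" f] by (simp add: bc_uminus)
  show "A (f - g) = A f - A g" using add[of f "- g"] neg[of g] by simp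
  show "A (sum h S) = (\<Sum>s\<in>S. A (h s))"
    by (induction S rule: infinite_finite_induct) (simp_all add: add zero)
qed

text \<open>Polynomials are dense: \<open>truncate_xy\<close> approximates to any order, and both
  maps respect the filtration. Multiplicativity and the Leibniz rule, being linear in each argument,
  are thereby checked on monomials, one argument at a time.\<close>

lemma cont_linear_eqI:
  assumes A: "cont_linear A" and B: "cont_linear B"
    and eq: "\<And>i j. A (bX ^ i * bY ^ j) = B (bX ^ i * bY ^ j)"
  shows "A f = B f"
proof -
  have "A f - B f \<in> xy_power k" for k
  proof -
    let ?t = "truncate_xy k f"
    have "A ?t = B ?t"
      by (simp add: truncate_xy_def cont_linearD[OF A] cont_linearD[OF B] eq)
    then have "A f - B f = A (f - ?t) - B (f - ?t)"
      by (simp add: cont_linearD(6)[OF A] cont_linearD(6)[OF B])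
    also have "\<dots> \<in> xy_power k"
      using cont_linearD(3)[OF A] cont_linearD(3)[OF B] xy_power_mono[OF truncate_xy, of k k f]
      by (intro xy_power_diff[of "A (f - ?t)"]) auto
    finally show ?thesis .
  qed
  from xy_power_all_0[OF this] show ?thesis by simp
qed

definition cont_hom :: "(bps \<Rightarrow> bps) \<Rightarrow> bool" where
  "cont_hom \<phi> \<longleftrightarrow> cont_linear \<phi> \<and> (\<forall>f g. \<phi> (f * g) = \<phi> f * \<phi> g) \<and> \<phi> 1 = 1"

lemma cont_homD:
  assumes "cont_hom \<phi>"
  shows "cont_linear \<phi>" "\<phi> (f * g) = \<phi> f * \<phi> g" "\<phi> 1 = 1" "\<phi> (f ^ n) = \<phi> f ^ n" "\<phi> (bc c) = bc c"
proof -
  note a = assms[unfolded cont_hom_def]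
  show lin: "cont_linear \<phi>" using a by blast
  show mult: "\<phi> (f * g) = \<phi> f * \<phi> g" for f g using a by blast
  show one: "\<phi> 1 = 1" using a by blast
  show "\<phi> (f ^ n) = \<phi> f ^ n" by (induction n) (simp_all add: mult one)
  show "\<phi> (bc c) = bc c" using cont_linearD(2)[OF lin, of c 1] one by simp
qed

lemma cont_hom_eqI:
  assumes "cont_hom \<phi>" "cont_hom \<psi>" "\<phi> bX = \<psi> bX" "\<phi> bY = \<psi> bY"
  shows "\<phi> f = \<psi> f"
  by (rule cont_linear_eqI) (use assms in \<open>simp_all add: cont_homD\<close>)

lemma cont_hom_comp: "cont_hom \<phi> \<Longrightarrow> cont_hom \<psi> \<Longrightarrow> cont_hom (\<lambda>f. \<phi> (\<psi> f))"
  unfolding cont_hom_def cont_linear_def by auto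

lemma cont_hom_id: "cont_hom (\<lambda>f. f)" "cont_hom id"
  unfolding cont_hom_def cont_linear_def by auto

lemma cont_linear_subst:
  assumes u: "u \<in> xy_power 1" and v: "v \<in> xy_power 1"
  shows "cont_linear (subst_xy u v)"
proof -
  have add: "subst_xy u v (f + g) = subst_xy u v f + subst_xy u v g" for f g
    by (rule bps_eqI) (simp add: subst_xy_def ring_distribs sum.distrib)
  have scale: "subst_xy u v (bc c * f) = bc c * subst_xy u v f" for c f
    by (rule bps_eqI) (simp add: subst_xy_def sum_distrib_left mult.assoc)
  have "subst_xy u v f \<in> xy_power k" if f: "f \<in> xy_power k" for f k
  proof -
    have "bcoeff f i j * bcoeff (u ^ i * v ^ j) p q = 0" if "p + q < k" for p q i j
    proof (cases "i + j < k")
      case False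
      then show ?thesis
        using that xy_power_mult[OF xy_power_power1[OF u, of i] xy_power_power1[OF v, of j]]
        by (simp add: xy_power_def)
    qed (use f in \<open>simp add: xy_power_def\<close>)
    then show ?thesis
      unfolding xy_power_def subst_xy_def by (auto intro!: sum.neutral)
  qed
  with add scale show ?thesis by (simp add: cont_linear_def)
qed

lemma subst_xy_monom:
  assumes u: "u \<in> xy_power 1" and v: "v \<in> xy_power 1"
  shows "subst_xy u v (bX ^ a * bY ^ b) = u ^ a * v ^ b"
proof (rule bps_eqI)
  fix p q
  have "bcoeff (subst_xy u v (bX ^ a * bY ^ b)) p q =
    (\<Sum>i\<le>p + q. \<Sum>j\<le>p + q. if i = a then if j = b then bcoeff (u ^ i * v ^ j) p q else 0 else 0)"
    unfolding subst_xy_def bcoeff_bps_of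
    by (intro sum.cong refl) (auto simp: bcoeff_monom)
  also have "\<dots> = (\<Sum>i\<le>p + q. if i = a then
      \<Sum>j\<le>p + q. if j = b then bcoeff (u ^ i * v ^ j) p q else 0 else 0)"
    by (intro sum.cong refl) auto
  also have "\<dots> = (if a \<le> p + q \<and> b \<le> p + q then bcoeff (u ^ a * v ^ b) p q else 0)"
    by simp
  also have "\<dots> = bcoeff (u ^ a * v ^ b) p q"
    using xy_power_mult[OF xy_power_power1[OF u, of a] xy_power_power1[OF v, of b]]
    by (auto simp: xy_power_def)
  finally show "bcoeff (subst_xy u v (bX ^ a * bY ^ b)) p q = bcoeff (u ^ a * v ^ b) p q" .
qed

lemma cont_hom_subst:
  assumes u: "u \<in> xy_power 1" and v: "v \<in> xy_power 1"
  shows "cont_hom (subst_xy u v)"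
proof -
  note lin = cont_linear_subst[OF u v] and mon = subst_xy_monom[OF u v]
  note linD = cont_linearD[OF lin]
  have lin1: "cont_linear (\<lambda>f. subst_xy u v (h * f))"
    and lin2: "cont_linear (\<lambda>f. subst_xy u v h * subst_xy u v f)" for h
    by (auto simp: cont_linear_def linD ring_distribs mult.left_commute[of _ "bc _"]
        intro!: linD(3) xy_power_mult_left)
  have lin1': "cont_linear (\<lambda>f. subst_xy u v (f * h))"
    and lin2': "cont_linear (\<lambda>f. subst_xy u v f * subst_xy u v h)" for h
    using lin1[of h] lin2[of h] by (simp_all add: mult.commute)
  \<comment> \<open>The first argument is a monomial, the second arbitrary; the same density
    argument then frees the first.\<close>
  have "subst_xy u v (bX ^ i * bY ^ j * g) = subst_xy u v (bX ^ i * bY ^ j) * subst_xy u v g" for i j g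
    by (rule cont_linear_eqI[OF lin1 lin2])
      (use mon[of "i + _" "j + _"] in \<open>simp add: mon power_add mult_ac\<close>)
  then have "subst_xy u v (f * g) = subst_xy u v f * subst_xy u v g" for f g
    by (rule cont_linear_eqI[OF lin1' lin2'])
  then show ?thesis using lin mon[of 0 0] by (simp add: cont_hom_def)
qed

lemma subst_xy_bX: "u \<in> xy_power 1 \<Longrightarrow> v \<in> xy_power 1 \<Longrightarrow> subst_xy u v bX = u"
  and subst_xy_bY: "u \<in> xy_power 1 \<Longrightarrow> v \<in> xy_power 1 \<Longrightarrow> subst_xy u v bY = v"
  using subst_xy_monom[of u v 1 0] subst_xy_monom[of u v 0 1] by simp_all

lemma cont_hom_subst_xy:
  assumes "cont_hom \<phi>" and u: "u \<in> xy_power 1" and v: "v \<in> xy_power 1"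
  shows "\<phi> (subst_xy u v f) = subst_xy (\<phi> u) (\<phi> v) f"
proof -
  have *: "\<phi> u \<in> xy_power 1" "\<phi> v \<in> xy_power 1"
    using assms by (simp_all add: cont_linearD(3)[OF cont_homD(1)])
  show ?thesis
    by (rule cont_hom_eqI[OF cont_hom_comp[OF assms(1) cont_hom_subst[OF u v]] cont_hom_subst[OF *]])
      (simp_all only: subst_xy_bX[OF u v] subst_xy_bY[OF u v] subst_xy_bX[OF *] subst_xy_bY[OF *])
qed

text \<open>Evaluation of a one-variable series at g, realised as a substitution for x in a series
  without y, so that the homomorphism laws are inherited from \<open>subst_xy\<close>.\<close>

definition ps :: "rat fps \<Rightarrow> bps \<Rightarrow> bps" where
  "ps s g = subst_xy g 0 (fps_const s)"

context
  fixes g :: bps assumes g: "g \<in> xy_power 1"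
begin

lemma hom_g: "cont_hom (subst_xy g 0)"
  by (rule cont_hom_subst) (use g in simp_all)

lemma ps_add: "ps (r + s) g = ps r g + ps s g"
  and ps_diff: "ps (r - s) g = ps r g - ps s g"
  and ps_uminus: "ps (- s) g = - ps s g"
  and ps_mult: "ps (r * s) g = ps r g * ps s g"
  and ps_1: "ps 1 g = 1"
  and ps_const: "ps (fps_const c) g = bc c"
  and ps_power: "ps (s ^ n) g = ps s g ^ n"
  and ps_X: "ps fps_X g = g"
  using subst_xy_bX[OF g zero_in_xy_power] cont_linearD[OF cont_homD(1)[OF hom_g]] cont_homD[OF hom_g]
  by (simp_all add: ps_def bX_def bc_def flip: fps_const_add fps_const_sub fps_const_neg fps_const_mult fps_const_power)

lemma ps_cmult: "ps (fps_const c * s) g = bc c * ps s g"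
  by (simp add: ps_mult ps_const)

lemma ps_partial_sum: "ps s g - (\<Sum>k\<le>K. bc (fps_nth s k) * g ^ k) \<in> xy_power (Suc K)"
proof -
  let ?t = "\<Sum>k\<le>K. bc (fps_nth s k) * (bX ^ k * bY ^ 0)"
  have "bcoeff (\<Sum>k\<le>K. bc (fps_nth s k) * (bX ^ k * bY ^ 0)) p q = bcoeff (fps_const s) p q"
    if "p + q < Suc K" for p q
  proof -
    have "bcoeff (\<Sum>k\<le>K. bc (fps_nth s k) * (bX ^ k * bY ^ 0)) p q
      = (\<Sum>k\<le>K. if p = k then if q = 0 then fps_nth s k else 0 else 0)"
      unfolding bcoeff_sum bcoeff_bc_mult bcoeff_monom by (intro sum.cong refl) auto
    also have "\<dots> = bcoeff (fps_const s) p q" using that by (simp add: bcoeff_fps_const)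
    finally show ?thesis .
  qed
  then have "fps_const s - ?t \<in> xy_power (Suc K)" by (simp add: xy_power_def del: bcoeff_sum)
  then have "subst_xy g 0 (fps_const s - ?t) \<in> xy_power (Suc K)"
    by (rule cont_linearD(3)[OF cont_homD(1)[OF hom_g]])
  also have "subst_xy g 0 (fps_const s - ?t) = ps s g - (\<Sum>k\<le>K. bc (fps_nth s k) * g ^ k)"
    using subst_xy_bX[OF g zero_in_xy_power]
    by (simp add: ps_def cont_linearD[OF cont_homD(1)[OF hom_g]] cont_homD[OF hom_g])
  finally show ?thesis .
qed

lemma hom_ps: "cont_hom \<phi> \<Longrightarrow> \<phi> (ps s g) = ps s (\<phi> g)"
  using cont_hom_subst_xy[of \<phi> g 0 "fps_const s"] g
  by (simp add: ps_def cont_linearD[OF cont_homD(1)])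

lemma one_plus_powr_eq: "one_plus_powr g c = ps (fps_binomial c) g"
proof (rule bps_eqI)
  fix p q
  have "ps (fps_binomial c) g - (\<Sum>k\<le>p + q. bc (c gchoose k) * g ^ k) \<in> xy_power (Suc (p + q))"
    using ps_partial_sum[of "fps_binomial c" "p + q"] by simp
  then show "bcoeff (one_plus_powr g c) p q = bcoeff (ps (fps_binomial c) g) p q"
    by (simp add: one_plus_powr_def xy_power_def)
qed

end

lemma ps_in_xy_power:
  assumes g: "g \<in> xy_power k" "k \<ge> 1" and s: "\<And>i. i < n \<Longrightarrow> fps_nth s i = 0"
  shows "ps s g \<in> xy_power (k * n)"
proof -
  have g1: "g \<in> xy_power 1" using g xy_power_mono by blast
  have "ps s g - (\<Sum>i\<le>k * n. bc (fps_nth s i) * g ^ i) \<in> xy_power (k * n)"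
    by (rule xy_power_mono[OF ps_partial_sum[OF g1]]) simp
  moreover have "(\<Sum>i\<le>k * n. bc (fps_nth s i) * g ^ i) \<in> xy_power (k * n)"
  proof (rule xy_power_sum)
    fix i show "bc (fps_nth s i) * g ^ i \<in> xy_power (k * n)"
    proof (cases "i < n")
      case False
      then have "g ^ i \<in> xy_power (k * n)"
        by (intro xy_power_mono[OF xy_power_power[OF g(1)]]) simp
      then show ?thesis by (rule xy_power_mult_left)
    qed (simp add: s)
  qed
  ultimately show ?thesis using xy_power_add by force
qed

text \<open>For g = x this is the coefficient formula of \<open>oo\<close>, with h viewed as a
  series in x alone; the general case follows by substituting g for x.\<close>

lemma ps_compose:
  assumes g: "g \<in> xy_power 1" and h: "fps_nth h 0 = 0"
  shows "ps (s oo h) g = ps s (ps h g)"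
proof -
  have h1: "fps_const h \<in> xy_power 1"
    using h by (simp add: xy_power_def bcoeff_fps_const)
  have "ps s (fps_const h) = fps_const (s oo h)"
  proof (rule bps_eqI)
    fix p q
    have "ps s (fps_const h) - (\<Sum>k\<le>p + q. bc (fps_nth s k) * fps_const h ^ k) \<in> xy_power (Suc (p + q))"
      by (rule ps_partial_sum[OF h1])
    then have "bcoeff (ps s (fps_const h)) p q = (\<Sum>k\<le>p + q. fps_nth s k * bcoeff (fps_const (h ^ k)) p q)"
      by (simp add: xy_power_def fps_const_power)
    also have "\<dots> = bcoeff (fps_const (s oo h)) p q"
      by (simp add: bcoeff_fps_const fps_compose_nth atLeast0AtMost)
    finally show "bcoeff (ps s (fps_const h)) p q = bcoeff (fps_const (s oo h)) p q" .
  qed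
  then have "ps (s oo h) g = subst_xy g 0 (ps s (fps_const h))" by (simp add: ps_def)
  also have "\<dots> = ps s (ps h g)"
    by (subst hom_ps[OF h1 hom_g[OF g]]) (simp add: ps_def)
  finally show ?thesis .
qed

section \<open>Exponential, logarithm and dilogarithm\<close>

definition derivation :: "(bps \<Rightarrow> bps) \<Rightarrow> bool" where
  "derivation D \<longleftrightarrow> cont_linear D \<and> (\<forall>f g. D (f * g) = D f * g + f * D g)"

text \<open>The Euler derivations x d/dx and y d/dy, with monomials as eigenvectors. Unlike the
  plain partial derivatives they do not lower degrees, as \<open>cont_linear\<close>
  requires.\<close>

definition theta_x :: "bps \<Rightarrow> bps" where "theta_x f = bps_of (\<lambda>i j. of_nat i * bcoeff f i j)"
definition theta_y :: "bps \<Rightarrow> bps" where "theta_y f = bps_of (\<lambda>i j. of_nat j * bcoeff f i j)"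

lemma cont_linear_theta: "cont_linear theta_x" "cont_linear theta_y"
  unfolding cont_linear_def theta_x_def theta_y_def
  by (auto intro!: bps_eqI simp: xy_power_def ring_distribs)

lemma theta_monom:
  "theta_x (bX ^ a * bY ^ b) = of_nat a * (bX ^ a * bY ^ b)"
  "theta_y (bX ^ a * bY ^ b) = of_nat b * (bX ^ a * bY ^ b)"
  unfolding bc_of_nat[symmetric]
  by (auto intro!: bps_eqI simp: theta_x_def theta_y_def bcoeff_monom)

lemma derivation_theta: "derivation theta_x" "derivation theta_y"
proof -
  have "derivation D" if D: "cont_linear D"
    and mon: "\<And>a b. D (bX ^ a * bY ^ b) = of_nat (h a b) * (bX ^ a * bY ^ b)"
    and h: "\<And>a b c d. h (a + c) (b + d) = h a b + h c d" for D h
  proof -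
    have lin: "cont_linear (\<lambda>g. D (f * g))" "cont_linear (\<lambda>g. D f * g + f * D g)"
      "cont_linear (\<lambda>g. D (g * f))" "cont_linear (\<lambda>g. D g * f + g * D f)" for f
      by (auto simp: cont_linear_def cont_linearD(1,2)[OF D] ring_distribs mult.left_commute[of _ "bc _"] mult.assoc
          intro!: cont_linearD(3)[OF D] xy_power_add intro: xy_power_mult_left xy_power_mult_right)
    have "D ((bX ^ i * bY ^ j) * g) = D (bX ^ i * bY ^ j) * g + bX ^ i * bY ^ j * D g" for i j g
    proof (rule cont_linear_eqI[OF lin(1,2)])
      fix k l
      have "bX ^ i * bY ^ j * (bX ^ k * bY ^ l) = bX ^ (i + k) * bY ^ (j + l)"
        by (simp add: power_add mult_ac)
      then have "D (bX ^ i * bY ^ j * (bX ^ k * bY ^ l)) =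
        of_nat (h i j + h k l) * (bX ^ i * bY ^ j * (bX ^ k * bY ^ l))"
        by (simp only: mon h)
      then show "D (bX ^ i * bY ^ j * (bX ^ k * bY ^ l)) =
        D (bX ^ i * bY ^ j) * (bX ^ k * bY ^ l) + bX ^ i * bY ^ j * D (bX ^ k * bY ^ l)"
        by (simp add: mon algebra_simps)
    qed
    then have "D (f * g) = D f * g + f * D g" for f g
      by (rule cont_linear_eqI[OF lin(3,4)])
    then show ?thesis using D by (simp add: derivation_def)
  qed
  from this[OF cont_linear_theta(1) theta_monom(1)] this[OF cont_linear_theta(2) theta_monom(2)]
  show "derivation theta_x" "derivation theta_y" by auto
qed

lemma derivationD:
  assumes "derivation D"
  shows "cont_linear D" "D (f * g) = D f * g + f * D g" "D 1 = 0" "D (bc c) = 0"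
    "D (f ^ Suc n) = of_nat (Suc n) * f ^ n * D f"
proof -
  note a = assms[unfolded derivation_def]
  show lin: "cont_linear D" using a by blast
  show mult: "D (f * g) = D f * g + f * D g" for f g using a by blast
  show one: "D 1 = 0" using mult[of 1 1] by simp
  show "D (bc c) = 0" using cont_linearD(2)[OF lin, of c 1] one by simp
  show "D (f ^ Suc n) = of_nat (Suc n) * f ^ n * D f"
    by (induction n) (simp_all add: mult one algebra_simps)
qed

lemma derivation_ps:
  assumes D: "derivation D" and g: "g \<in> xy_power 1"
  shows "D (ps s g) = ps (fps_deriv s) g * D g"
proof -
  note lin = cont_linearD[OF derivationD(1)[OF D]]
  have "D (ps s g) - ps (fps_deriv s) g * D g \<in> xy_power k" for k
  proof -
    \<comment> \<open>One term more than in \<open>?u\<close>, because differentiation shifts the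
      index.\<close>
    let ?t = "\<Sum>i\<le>Suc k. bc (fps_nth s i) * g ^ i"
    let ?u = "\<Sum>i\<le>k. bc (fps_nth (fps_deriv s) i) * g ^ i"
    have "D ?t = (\<Sum>i\<le>k. bc (fps_nth s (Suc i)) * D (g ^ Suc i))"
      by (subst sum.atMost_Suc_shift) (simp add: lin derivationD(3,4)[OF D] del: power_Suc)
    also have "\<dots> = ?u * D g"
      unfolding sum_distrib_right derivationD(5)[OF D]
      by (intro sum.cong refl) (simp add: bc_mult bc_of_nat mult_ac del: of_nat_Suc)
    finally have "D ?t = ?u * D g" .
    then have "D (ps s g) - ps (fps_deriv s) g * D g = D (ps s g - ?t) - (ps (fps_deriv s) g - ?u) * D g"
      by (simp add: lin algebra_simps del: sum.atMost_Suc)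
    also have "\<dots> \<in> xy_power k"
      by (rule xy_power_diff[OF lin(3) xy_power_mult_right])
        (rule xy_power_mono[OF ps_partial_sum[OF g]], simp)+
    finally show ?thesis .
  qed
  from xy_power_all_0[OF this] show ?thesis by simp
qed

section \<open>The exponential and its inverse\<close>

definition pexp :: "bps \<Rightarrow> bps" where "pexp A = ps (fps_exp 1) A"

lemma bcoeff_ps_0:
  assumes "g \<in> xy_power 1"
  shows "bcoeff (ps s g) 0 0 = fps_nth s 0"
  using ps_partial_sum[OF assms, of s 0] by (simp add: xy_power_def bcoeff_bc)

lemma theta_zero_imp_const:
  assumes "theta_x f = 0" "theta_y f = 0"
  shows "f = bc (bcoeff f 0 0)"
proof (rule bps_eqI)
  fix i j
  have "of_nat i * bcoeff f i j = 0" "of_nat j * bcoeff f i j = 0"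
    using arg_cong[OF assms(1), of "\<lambda>f. bcoeff f i j"] arg_cong[OF assms(2), of "\<lambda>f. bcoeff f i j"]
    by (simp_all add: theta_x_def theta_y_def)
  then show "bcoeff f i j = bcoeff (bc (bcoeff f 0 0)) i j" by (auto simp: bcoeff_bc)
qed

lemma xy_power_cmult: "A \<in> xy_power k \<Longrightarrow> bc c * A \<in> xy_power k"
  by (rule xy_power_mult_left)

lemma pexp_cmult:
  assumes "A \<in> xy_power 1"
  shows "pexp (bc c * A) = ps (fps_exp c) A"
proof -
  have "ps (fps_exp 1 oo (fps_const c * fps_X)) A = pexp (bc c * A)"
    by (subst ps_compose) (simp_all add: assms[simplified] pexp_def ps_cmult ps_X)
  then show ?thesis by simp
qed

lemma pexp_minus:
  assumes "A \<in> xy_power 1"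
  shows "pexp A * pexp (- A) = 1"
proof -
  have "pexp (- A) = ps (fps_exp (- 1)) A"
    using pexp_cmult[OF assms, of "- 1"] by (simp add: bc_uminus)
  then have "pexp A * pexp (- A) = ps (fps_exp 1 * fps_exp (- 1)) A"
    by (simp add: pexp_def ps_mult[OF assms])
  also have "\<dots> = 1" by (simp add: ps_1[OF assms] flip: fps_exp_add_mult)
  finally show ?thesis .
qed

lemma derivation_pexp: "derivation D \<Longrightarrow> A \<in> xy_power 1 \<Longrightarrow> D (pexp A) = pexp A * D A"
  by (simp add: pexp_def derivation_ps)

text \<open>The quotient of the two sides is killed by both Euler derivations, so it is constant,
  and its constant term is 1.\<close>

lemma pexp_add:
  assumes A: "A \<in> xy_power 1" and B: "B \<in> xy_power 1"
  shows "pexp (A + B) = pexp A * pexp B"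
proof -
  have AB: "A + B \<in> xy_power 1" "- A \<in> xy_power 1" "- B \<in> xy_power 1"
    using A B by (auto intro: xy_power_add xy_power_uminus)
  let ?E = "pexp (A + B) * pexp (- A) * pexp (- B)"
  have "D ?E = 0" if "derivation D" for D
    by (simp add: derivationD(2)[OF that] derivation_pexp[OF that] A B AB
        cont_linearD(1,5)[OF derivationD(1)[OF that]] algebra_simps del: One_nat_def)
  from theta_zero_imp_const[OF this this, OF derivation_theta]
  have "?E = bc (bcoeff ?E 0 0)" .
  also have "bcoeff ?E 0 0 = 1"
    by (simp add: bcoeff_mult pexp_def bcoeff_ps_0 A B AB del: One_nat_def)
  finally have E: "?E = 1" by simp
  have "pexp (A + B) = ?E * (pexp A * pexp B)"
  proof -
    have "?E * (pexp A * pexp B) = pexp (A + B) * (pexp A * pexp (- A)) * (pexp B * pexp (- B))" by (simp only: mult_ac)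
    then show ?thesis by (simp add: pexp_minus[OF A] pexp_minus[OF B])
  qed
  then show ?thesis by (simp add: E)
qed

lemma pexp_0 [simp]: "pexp 0 = 1"
  using pexp_minus[of 0] pexp_add[of 0 0] by simp

lemma pexp_of_nat: "A \<in> xy_power 1 \<Longrightarrow> pexp (of_nat n * A) = pexp A ^ n"
proof (induction n)
  case (Suc n)
  then show ?case
    by (simp add: ring_distribs pexp_add xy_power_mult_left del: One_nat_def)
qed simp

lemma pexp_diff_1:
  assumes "A \<in> xy_power k" "k \<ge> 1"
  shows "pexp A - 1 \<in> xy_power k"
proof -
  have A: "A \<in> xy_power 1" using assms xy_power_mono by blast
  have "ps (fps_exp 1 - 1) A \<in> xy_power (k * 1)"
    by (rule ps_in_xy_power[OF assms]) simp
  then show ?thesis by (simp add: pexp_def ps_diff[OF A] ps_1[OF A])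
qed

lemma pexp_diff:
  assumes A: "A \<in> xy_power 1" and B: "B \<in> xy_power 1" and AB: "A - B \<in> xy_power k"
  shows "pexp A - pexp B \<in> xy_power k"
proof (cases "k = 0")
  case False
  have "A - B \<in> xy_power 1" using A B by (rule xy_power_diff)
  then have "pexp A = pexp (A - B) * pexp B" using pexp_add[OF _ B, of "A - B"] by simp
  then have "pexp A - pexp B = (pexp (A - B) - 1) * pexp B" by (simp add: algebra_simps)
  then show ?thesis using pexp_diff_1[OF AB] False by (simp add: xy_power_mult_right)
qed simp

lemma fps_ln_compose_exp: "fps_ln 1 oo (fps_exp 1 - 1) = (fps_X :: rat fps)"
  by (simp add: fps_ln_fps_exp_inv fps_inv)

lemma ln_pexp:
  assumes C: "C \<in> xy_power 1"
  shows "ps (fps_ln 1) (pexp C - 1) = C"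
proof -
  have "pexp C - 1 = ps (fps_exp 1 - 1) C"
    by (simp add: pexp_def ps_diff[OF C] ps_1[OF C])
  then show ?thesis
    by (simp add: ps_compose[OF C, symmetric] fps_ln_compose_exp ps_X[OF C])
qed

text \<open>e^(A - B) - 1 = (e^A - e^B) e^(-B), and taking the logarithm does not lower the
  order.\<close>

lemma pexp_diff_imp:
  assumes A: "A \<in> xy_power 1" and B: "B \<in> xy_power 1"
    and E: "pexp A - pexp B \<in> xy_power k" and k: "k \<ge> 1"
  shows "A - B \<in> xy_power k"
proof -
  have C: "A - B \<in> xy_power 1" and B': "- B \<in> xy_power 1"
    using A B by (auto intro: xy_power_diff xy_power_uminus)
  have "pexp (A - B) = pexp A * pexp (- B)" using pexp_add[OF A B'] by simp
  then have "pexp (A - B) - 1 = (pexp A - pexp B) * pexp (- B)"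
    using pexp_minus[OF B] by (simp add: algebra_simps)
  then have "pexp (A - B) - 1 \<in> xy_power k" using E by (simp add: xy_power_mult_right)
  then have "ps (fps_ln 1) (pexp (A - B) - 1) \<in> xy_power (k * 1)"
    by (rule ps_in_xy_power[OF _ k]) simp
  then show ?thesis by (simp add: ln_pexp[OF C])
qed

lemma ps_diff_in_xy_power:
  assumes f: "f \<in> xy_power 1" and g: "g \<in> xy_power 1" and fg: "f - g \<in> xy_power k"
  shows "ps s f - ps s g \<in> xy_power k"
proof -
  have "f ^ i - g ^ i \<in> xy_power k" for i
    using xy_power_mult_right[OF fg] by (simp add: power_diff_sumr2)
  then have "(\<Sum>i\<le>k. bc (fps_nth s i) * f ^ i) - (\<Sum>i\<le>k. bc (fps_nth s i) * g ^ i) \<in> xy_power k"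
    by (auto simp flip: sum_subtractf right_diff_distrib intro!: xy_power_sum xy_power_cmult)
  moreover have "(ps s f - (\<Sum>i\<le>k. bc (fps_nth s i) * f ^ i)) - (ps s g - (\<Sum>i\<le>k. bc (fps_nth s i) * g ^ i)) \<in> xy_power k"
    by (rule xy_power_diff[OF xy_power_mono[OF ps_partial_sum[OF f]] xy_power_mono[OF ps_partial_sum[OF g]]]) simp_all
  ultimately have "((\<Sum>i\<le>k. bc (fps_nth s i) * f ^ i) - (\<Sum>i\<le>k. bc (fps_nth s i) * g ^ i)) +
    ((ps s f - (\<Sum>i\<le>k. bc (fps_nth s i) * f ^ i)) - (ps s g - (\<Sum>i\<le>k. bc (fps_nth s i) * g ^ i))) \<in> xy_power k"
    by (rule xy_power_add)
  then show ?thesis by simp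
qed

text \<open>This is log(1 - t), so that \<open>Ln\<close> of a signed monomial is the logarithm of
  the bracket in \<open>T_powr\<close>; accordingly t d/dt of the dilogarithm series below is -
  log(1 - t).\<close>

definition ln_series :: "rat fps" where "ln_series = Abs_fps (\<lambda>n. if n = 0 then 0 else - 1 / of_nat n)"
definition li2_series :: "rat fps" where "li2_series = Abs_fps (\<lambda>n. if n = 0 then 0 else 1 / of_nat n ^ 2)"

definition Ln :: "bps \<Rightarrow> bps" where "Ln g = ps ln_series g"
definition Li2 :: "bps \<Rightarrow> bps" where "Li2 g = ps li2_series g"

text \<open>Both sides solve f' = r f / (1 + t) with constant term 1.\<close>

lemma fps_exp_compose_ln: "fps_exp r oo fps_ln 1 = fps_binomial (r :: rat)"
proof -
  have "fps_deriv (fps_exp r oo fps_ln 1) = (fps_const r * fps_exp r oo fps_ln 1) * fps_deriv (fps_ln 1)"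
    by (simp add: fps_compose_deriv)
  also have "\<dots> = fps_const r * (fps_exp r oo fps_ln 1) * inverse (1 + fps_X)"
    unfolding fps_ln_deriv by (simp add: fps_compose_mult_distrib)
  also have "\<dots> = fps_const r * (fps_exp r oo fps_ln 1) / (1 + fps_X)"
    by (subst fps_divide_unit) simp_all
  finally have "fps_deriv (fps_exp r oo fps_ln 1) = fps_const r * (fps_exp r oo fps_ln 1) / (1 + fps_X)" .
  then show ?thesis using fps_binomial_ODE_unique'[of "fps_exp r oo fps_ln 1" r] by simp
qed

lemma Ln_eq:
  assumes g: "g \<in> xy_power 1"
  shows "Ln g = ps (fps_ln 1) (- g)"
proof -
  have "ln_series = fps_ln 1 oo (- fps_X)"
  proof (rule fps_ext)
    fix n show "fps_nth ln_series n = fps_nth (fps_ln 1 oo (- fps_X)) n"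
      unfolding fps_compose_uminus'
      by (cases n) (simp_all add: ln_series_def fps_ln_nth flip: power_add mult_2 power_mult_distrib)
  qed
  then have "Ln g = ps (fps_ln 1 oo (- fps_X)) g" by (simp add: Ln_def)
  also have "\<dots> = ps (fps_ln 1) (ps (- fps_X) g)" by (rule ps_compose[OF g]) simp
  finally show ?thesis by (simp only: ps_uminus[OF g] ps_X[OF g])
qed

lemma pexp_Ln:
  assumes g: "g \<in> xy_power 1"
  shows "pexp (bc r * Ln g) = ps (fps_binomial r) (- g)"
proof -
  have g': "- g \<in> xy_power 1" using g by (rule xy_power_uminus)
  have Ln: "Ln g \<in> xy_power 1"
    using ps_in_xy_power[OF g, of 1 ln_series] by (simp add: Ln_def ln_series_def)
  have "pexp (bc r * Ln g) = ps (fps_exp r) (ps (fps_ln 1) (- g))"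
    using pexp_cmult[OF Ln] by (simp add: Ln_eq[OF g])
  also have "\<dots> = ps (fps_exp r oo fps_ln 1) (- g)"
    by (rule ps_compose[OF g', symmetric]) simp
  finally show ?thesis by (simp add: fps_exp_compose_ln)
qed

lemma pexp_Ln1: "h \<in> xy_power 1 \<Longrightarrow> pexp (Ln h) = 1 - h"
proof -
  assume h: "h \<in> xy_power 1"
  have "fps_binomial (1 :: rat) = 1 + fps_X" using fps_binomial_1 by simp
  then have "pexp (bc 1 * Ln h) = ps (1 + fps_X) (- h)" using pexp_Ln[OF h, of 1] by simp
  then show ?thesis using xy_power_uminus[OF h] by (simp add: ps_add ps_1 ps_X)
qed

text \<open>Here w is the logarithmic derivative of g. The derivative of the dilogarithm has a
  division by t, which the factor g of D g cancels.\<close>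

lemma derivation_Li2:
  assumes D: "derivation D" and g: "g \<in> xy_power 1" and Dg: "D g = g * w"
  shows "D (Li2 g) = - Ln g * w"
proof -
  have "fps_X * fps_deriv li2_series = - ln_series"
    by (rule fps_ext) (auto simp: li2_series_def ln_series_def power2_eq_square)
  then have "ps (fps_X * fps_deriv li2_series) g = - Ln g"
    by (simp add: Ln_def ps_uminus[OF g])
  then have *: "g * ps (fps_deriv li2_series) g = - Ln g"
    by (simp add: ps_mult[OF g] ps_X[OF g])
  have "D (Li2 g) = g * ps (fps_deriv li2_series) g * w"
    by (simp add: Li2_def derivation_ps[OF D g] Dg mult_ac)
  then show ?thesis by (simp only: *)
qed

lemma Ln_in_xy_power: "g \<in> xy_power k \<Longrightarrow> k \<ge> 1 \<Longrightarrow> Ln g \<in> xy_power k"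
  using ps_in_xy_power[of g k 1 ln_series] by (simp add: Ln_def ln_series_def)

lemma Li2_in_xy_power: "g \<in> xy_power k \<Longrightarrow> k \<ge> 1 \<Longrightarrow> Li2 g \<in> xy_power k"
  using ps_in_xy_power[of g k 1 li2_series] by (simp add: Li2_def li2_series_def)

lemma Li2_approx:
  assumes "g \<in> xy_power k" "k \<ge> 1"
  shows "Li2 g - g \<in> xy_power (2 * k)"
proof -
  have g: "g \<in> xy_power 1" using assms xy_power_mono by blast
  have "ps (li2_series - fps_X) g \<in> xy_power (k * 2)"
    by (rule ps_in_xy_power[OF assms]) (auto simp: li2_series_def less_2_cases_iff)
  then show ?thesis by (simp add: Li2_def ps_diff[OF g] ps_X[OF g] mult.commute)
qed

section \<open>Integrality at a prime\<close>

definition pint :: "nat \<Rightarrow> rat set" where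
  "pint p = {of_int a / of_int b | a b. \<not> int p dvd b}"

lemma pintI: "\<not> int p dvd b \<Longrightarrow> of_int a / of_int b \<in> pint p"
  by (auto simp: pint_def)

lemma pint_of_int: "prime p \<Longrightarrow> of_int a \<in> pint p"
  using pintI[of p 1 a] by (auto dest: prime_gt_1_nat)

lemma pint_simps [simp]:
  assumes "prime p"
  shows "of_nat n \<in> pint p" "0 \<in> pint p" "1 \<in> pint p" "numeral w \<in> pint p"
  using pint_of_int[OF assms, of "int n"] pint_of_int[OF assms, of 0] pint_of_int[OF assms, of 1]
    pint_of_int[OF assms, of "numeral w"] by simp_all

lemma pint_add: "prime p \<Longrightarrow> x \<in> pint p \<Longrightarrow> y \<in> pint p \<Longrightarrow> x + y \<in> pint p"
proof -
  assume p: "prime p" and "x \<in> pint p" "y \<in> pint p"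
  then obtain a b c d where *: "x = of_int a / of_int b" "y = of_int c / of_int d" "\<not> int p dvd b" "\<not> int p dvd d"
    by (auto simp: pint_def)
  then have "b \<noteq> 0" "d \<noteq> 0" by auto
  then have "x + y = of_int (a * d + c * b) / of_int (b * d)" using * by (simp add: field_simps)
  moreover have "\<not> int p dvd b * d" using * p by (simp add: prime_dvd_mult_iff)
  ultimately show ?thesis using pintI by metis
qed

lemma pint_mult: "prime p \<Longrightarrow> x \<in> pint p \<Longrightarrow> y \<in> pint p \<Longrightarrow> x * y \<in> pint p"
proof -
  assume p: "prime p" and "x \<in> pint p" "y \<in> pint p"
  then obtain a b c d where *: "x = of_int a / of_int b" "y = of_int c / of_int d" "\<not> int p dvd b" "\<not> int p dvd d"
    by (auto simp: pint_def)
  then have "x * y = of_int (a * c) / of_int (b * d)" by auto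
  moreover have "\<not> int p dvd b * d" using * p by (simp add: prime_dvd_mult_iff)
  ultimately show ?thesis using pintI by metis
qed

lemma pint_uminus: "prime p \<Longrightarrow> x \<in> pint p \<Longrightarrow> - x \<in> pint p"
  using pint_mult[of p "of_int (- 1)" x] pint_of_int[of p "- 1"] by simp

lemma pint_diff: "prime p \<Longrightarrow> x \<in> pint p \<Longrightarrow> y \<in> pint p \<Longrightarrow> x - y \<in> pint p"
  using pint_add[of p x "- y"] pint_uminus[of p y] by simp

lemma pint_power: "prime p \<Longrightarrow> x \<in> pint p \<Longrightarrow> x ^ n \<in> pint p"
  by (induction n) (auto intro: pint_mult)

lemma pint_sum: "prime p \<Longrightarrow> (\<And>a. a \<in> A \<Longrightarrow> f a \<in> pint p) \<Longrightarrow> sum f A \<in> pint p"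
  by (induction A rule: infinite_finite_induct) (auto intro: pint_add)

lemma pint_inverse_nat: "\<not> p dvd n \<Longrightarrow> 1 / of_nat n \<in> pint p"
  using pintI[of p "int n" 1] by simp

lemma pint_all_Ints:
  assumes "\<And>p. prime p \<Longrightarrow> x \<in> pint p"
  shows "x \<in> \<int>"
proof -
  obtain n d where nd: "quotient_of x = (n, d)" by fastforce
  then have d: "d > 0" "coprime n d" "x = of_int n / of_int d"
    using quotient_of_denom_pos quotient_of_coprime quotient_of_div by blast+
  have "d = 1"
  proof (rule ccontr)
    assume "d \<noteq> 1"
    then have "nat d \<noteq> 1" using d by auto
    then obtain p where p: "prime p" "p dvd nat d" using prime_factor_nat by blast
    then have pd: "int p dvd d" using d by (metis int_dvd_int_iff int_nat_eq less_le_not_le linear)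
    obtain a b where ab: "x = of_int a / of_int b" "\<not> int p dvd b"
      using assms[OF p(1)] by (auto simp: pint_def)
    then have "b \<noteq> 0" by auto
    then have "of_int (n * b) = (of_int (a * d) :: rat)" using ab d by (simp add: field_simps)
    then have "n * b = a * d" by (simp only: of_int_eq_iff)
    then have "int p dvd n * b" using pd by simp
    then have "int p dvd n" using ab p by (simp add: prime_dvd_mult_iff)
    then show False using pd d p by (meson coprime_common_divisor not_prime_unit prime_nat_int_transfer)
  qed
  then show ?thesis using d by simp
qed

text \<open>Legendre's formula as a recursion: among the first p k + r numbers only the multiples of
  p count, and these are p times 1, ..., k.\<close>

lemma multiplicity_fact_mult:
  assumes p: "prime (p::nat)"
  shows "r < p \<Longrightarrow> multiplicity p (fact (p * k + r) :: nat) = multiplicity p (fact (p * k) :: nat)"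
    and "multiplicity p (fact (p * k) :: nat) = k + multiplicity p (fact k :: nat)"
proof -
  have pe: "prime_elem p" using p by simp
  have 1: "r < p \<Longrightarrow> multiplicity p (fact (p * k + r) :: nat) = multiplicity p (fact (p * k) :: nat)" for k r
  proof (induction r)
    case (Suc r)
    then have "\<not> p dvd Suc (p * k + r)"
      using dvd_add_right_iff[of p "p * k" "Suc r"] by (auto dest: dvd_imp_le)
    then have "multiplicity p (Suc (p * k + r)) = 0" by (rule not_dvd_imp_multiplicity_0)
    moreover have "multiplicity p (fact (Suc (p * k + r)) :: nat) =
        multiplicity p (Suc (p * k + r)) + multiplicity p (fact (p * k + r) :: nat)"
      unfolding fact_Suc of_nat_id by (rule prime_elem_multiplicity_mult_distrib[OF pe]) auto
    ultimately show ?case using Suc by simp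
  qed simp
  then show "r < p \<Longrightarrow> multiplicity p (fact (p * k + r) :: nat) = multiplicity p (fact (p * k) :: nat)" .
  show "multiplicity p (fact (p * k) :: nat) = k + multiplicity p (fact k :: nat)"
  proof (induction k)
    case (Suc k)
    have p0: "p > 0" using p by (rule prime_gt_0_nat)
    have eq: "p * Suc k = Suc (p * k + (p - 1))" using p0 by simp
    have "multiplicity p (fact (p * Suc k) :: nat) =
        multiplicity p (p * Suc k) + multiplicity p (fact (p * k + (p - 1)) :: nat)"
      unfolding eq fact_Suc of_nat_id by (rule prime_elem_multiplicity_mult_distrib[OF pe]) auto
    also have "multiplicity p (p * Suc k) = 1 + multiplicity p (Suc k)"
      using p0 by (subst prime_elem_multiplicity_mult_distrib[OF pe]) (auto simp: multiplicity_self p not_prime_unit)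
    also have "multiplicity p (fact (p * k + (p - 1)) :: nat) = k + multiplicity p (fact k :: nat)"
      using 1[of "p - 1" k] Suc.IH p0 by simp
    also have "1 + multiplicity p (Suc k) + (k + multiplicity p (fact k :: nat)) =
        Suc k + multiplicity p (fact (Suc k) :: nat)"
      unfolding fact_Suc of_nat_id by (subst prime_elem_multiplicity_mult_distrib[OF pe]) auto
    finally show ?case .
  qed simp
qed

text \<open>By Legendre the exponent of p in n! is (n - s) / (p - 1) with s > 0 the digit sum of n
  in base p. The strict bound follows from the recursion without introducing digits.\<close>

lemma multiplicity_fact_bound:
  assumes p: "prime (p::nat)"
  shows "n > 0 \<Longrightarrow> (p - 1) * multiplicity p (fact n :: nat) < n"
proof (induction n rule: less_induct)
  case (less n)
  have p2: "p \<ge> 2" using p by (rule prime_ge_2_nat)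
  define k where "k = n div p"
  have n: "n = p * k + n mod p" by (simp add: k_def)
  have "n mod p < p" using p2 by simp
  then have V: "multiplicity p (fact n :: nat) = k + multiplicity p (fact k :: nat)"
    using multiplicity_fact_mult(1)[OF p, of "n mod p" k] multiplicity_fact_mult(2)[OF p, of k] n by simp
  show ?case
  proof (cases "k = 0")
    case False
    have "k < n" using less.prems p2 by (simp add: k_def)
    then have "(p - 1) * multiplicity p (fact k :: nat) < k" using less.IH False by simp
    then have "(p - 1) * multiplicity p (fact n :: nat) < (p - 1) * k + k"
      by (simp add: V ring_distribs)
    also have "\<dots> = p * k" using p2 by (simp add: algebra_simps diff_mult_distrib)
    also have "\<dots> \<le> n" using n by linarith
    finally show ?thesis .
  qed (use V less.prems in simp)
qed

lemma pint_of_multiplicity: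
  assumes p: "prime p" and n: "n > 0" and k: "multiplicity p n \<le> k"
  shows "of_nat p ^ k / of_nat n \<in> pint p"
proof -
  obtain r where r: "n = p ^ multiplicity p n * r" "\<not> p dvd r"
    using multiplicity_decompose'[of n p] n p by (metis not_prime_unit neq0_conv)
  have p0: "p > 0" using p by (rule prime_gt_0_nat)
  have "(of_nat p :: rat) ^ k = of_nat p ^ multiplicity p n * of_nat p ^ (k - multiplicity p n)"
    using k by (simp flip: power_add)
  moreover have "(of_nat n :: rat) = of_nat p ^ multiplicity p n * of_nat r"
    by (subst r(1)) simp
  ultimately have "(of_nat p ^ k / of_nat n :: rat) = of_nat p ^ (k - multiplicity p n) * (1 / of_nat r)"
    using p0 by simp
  then show ?thesis
    using pint_mult[OF p pint_power[OF p pint_simps(1)[OF p]] pint_inverse_nat[OF r(2)]] by simp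
qed

text \<open>The choice k = n - 1 is always admissible. The dilogarithm calls for k = n - 2, which is
  admissible for p >= 3 and n >= 2 but never for p = 2.\<close>

lemma pint_power_fact:
  assumes p: "prime p" and n: "n > 0" and k: "n \<le> (p - 1) * Suc k"
  shows "of_nat p ^ k / fact n \<in> pint p"
proof -
  have "(p - 1) * multiplicity p (fact n :: nat) < (p - 1) * Suc k"
    using multiplicity_fact_bound[OF p n] k by linarith
  then have "multiplicity p (fact n :: nat) < Suc k" by (metis mult_less_cancel1)
  then have "multiplicity p (fact n :: nat) \<le> k" by simp
  from pint_of_multiplicity[OF p _ this] show ?thesis by simp
qed

section \<open>The Frobenius lift and p-integral series\<close>

definition frob :: "nat \<Rightarrow> bps \<Rightarrow> bps" where "frob p = subst_xy (bX ^ p) (bY ^ p)"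

definition pser :: "nat \<Rightarrow> bps set" where
  "pser p = {f. \<forall>i j. bcoeff f i j \<in> pint p}"

context
  fixes p :: nat assumes p: "prime p"
begin

lemma pser_add: "f \<in> pser p \<Longrightarrow> g \<in> pser p \<Longrightarrow> f + g \<in> pser p"
  and pser_diff: "f \<in> pser p \<Longrightarrow> g \<in> pser p \<Longrightarrow> f - g \<in> pser p"
  and pser_uminus: "f \<in> pser p \<Longrightarrow> - f \<in> pser p"
  and pser_mult: "f \<in> pser p \<Longrightarrow> g \<in> pser p \<Longrightarrow> f * g \<in> pser p"
  and pser_0: "0 \<in> pser p"
  and pser_1: "1 \<in> pser p"
  and pser_bc: "c \<in> pint p \<Longrightarrow> bc c \<in> pser p"
  and pser_monom: "bX ^ a * bY ^ b \<in> pser p"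
proof -
  show "f \<in> pser p \<Longrightarrow> g \<in> pser p \<Longrightarrow> f * g \<in> pser p"
    by (auto simp: pser_def bcoeff_mult intro!: pint_sum[OF p] pint_mult[OF p])
qed (auto simp: pser_def bcoeff_1 bcoeff_bc bcoeff_monom pint_add pint_diff pint_uminus p)

lemma pser_power: "f \<in> pser p \<Longrightarrow> f ^ n \<in> pser p"
  by (induction n) (auto intro: pser_mult pser_1)

lemma pser_sum: "(\<And>a. a \<in> A \<Longrightarrow> f a \<in> pser p) \<Longrightarrow> sum f A \<in> pser p"
  by (induction A rule: infinite_finite_induct) (auto intro: pser_add pser_0)

lemma pser_of_int: "of_int n \<in> pser p"
  using pser_bc[OF pint_of_int[OF p]] by (simp add: bc_of_int)

lemma pser_of_nat: "of_nat n \<in> pser p" and pser_numeral: "numeral w \<in> pser p"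
  using pser_of_int[of "int n"] pser_of_int[of "numeral w"] by simp_all

lemmas pser_intros = pser_add pser_diff pser_uminus pser_mult pser_0 pser_1 pser_bc pser_monom
  pser_power pser_of_int pser_of_nat pser_numeral

lemma pser_approx:
  assumes "\<And>k. \<exists>h\<in>pser p. f - h \<in> xy_power k"
  shows "f \<in> pser p"
  unfolding pser_def
proof (clarify)
  fix i j
  obtain h where "h \<in> pser p" "f - h \<in> xy_power (Suc (i + j))" using assms by blast
  then show "bcoeff f i j \<in> pint p" by (simp add: pser_def xy_power_def)
qed

lemma pser_ps:
  assumes "g \<in> xy_power 1" "g \<in> pser p" "\<And>n. fps_nth s n \<in> pint p"
  shows "ps s g \<in> pser p"
proof (rule pser_approx)
  fix k
  have "ps s g - (\<Sum>i\<le>k. bc (fps_nth s i) * g ^ i) \<in> xy_power k"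
    by (rule xy_power_mono[OF ps_partial_sum]) (use assms in simp_all)
  then show "\<exists>h\<in>pser p. ps s g - h \<in> xy_power k"
    using assms by (blast intro: pser_sum pser_intros)
qed

lemma bXY_power: "bX ^ p \<in> xy_power 1" "bY ^ p \<in> xy_power 1"
  using xy_power_mono[OF monom_in_xy_power[of p 0], of 1] xy_power_mono[OF monom_in_xy_power[of 0 p], of 1]
    prime_ge_1_nat[OF p] by simp_all

lemma cont_hom_frob: "cont_hom (frob p)"
  unfolding frob_def by (rule cont_hom_subst[OF bXY_power])

lemmas frob_linear = cont_linearD[OF cont_homD(1)[OF cont_hom_frob]]
lemmas frob_hom = cont_homD(2-5)[OF cont_hom_frob]

lemma frob_monom: "frob p (bX ^ a * bY ^ b) = bX ^ (p * a) * bY ^ (p * b)"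
  unfolding frob_def by (simp add: subst_xy_monom[OF bXY_power] power_mult)

lemma frob_xy_power:
  assumes f: "f \<in> xy_power k"
  shows "frob p f \<in> xy_power (p * k)"
proof -
  let ?t = "truncate_xy (p * k) f"
  have "f - ?t \<in> xy_power (p * k)" by (rule xy_power_mono[OF truncate_xy]) simp
  then have 1: "frob p f - frob p ?t \<in> xy_power (p * k)" by (metis frob_linear(3,6))
  have "bc (bcoeff f i j) * frob p (bX ^ i * bY ^ j) \<in> xy_power (p * k)" for i j
  proof (cases "i + j < k")
    case False
    then have "frob p (bX ^ i * bY ^ j) \<in> xy_power (p * k)"
      unfolding frob_monom by (intro xy_power_mono[OF monom_in_xy_power]) (simp flip: distrib_left)
    then show ?thesis by (rule xy_power_cmult)
  qed (use f in \<open>simp add: xy_power_def\<close>)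
  then have "frob p ?t \<in> xy_power (p * k)"
    by (auto simp: truncate_xy_def frob_linear(2,7) intro!: xy_power_sum)
  from xy_power_add[OF 1 this] show ?thesis by simp
qed

lemma frob_ps: "g \<in> xy_power 1 \<Longrightarrow> frob p (ps s g) = ps s (frob p g)"
  by (rule hom_ps[OF _ cont_hom_frob])

end

text \<open>
  Since the \<open>k\<close>-th remainder lies in \<open>(x,y)\<^sup>k\<^sup>+\<^sup>1\<close>, integrality can be checked termwise.
\<close>

definition sums_to :: "(nat \<Rightarrow> bps) \<Rightarrow> bps \<Rightarrow> bool" where
  "sums_to T R \<longleftrightarrow> (\<forall>k. R - (\<Sum>n\<le>k. T n) \<in> xy_power (Suc k))"

lemma sums_to_ps: "g \<in> xy_power 1 \<Longrightarrow> sums_to (\<lambda>n. bc (fps_nth s n) * g ^ n) (ps s g)"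
  unfolding sums_to_def using ps_partial_sum by blast

lemma sums_to_add:
  assumes "sums_to T R" "sums_to U Q"
  shows "sums_to (\<lambda>n. T n + U n) (R + Q)"
proof -
  have "(R + Q) - (\<Sum>n\<le>k. T n + U n) = (R - (\<Sum>n\<le>k. T n)) + (Q - (\<Sum>n\<le>k. U n))" for k
    by (simp add: sum.distrib)
  then show ?thesis using assms xy_power_add unfolding sums_to_def by presburger
qed

lemma sums_to_mult:
  assumes "sums_to T R"
  shows "sums_to (\<lambda>n. h * T n) (h * R)"
  using assms xy_power_mult_left unfolding sums_to_def
  by (simp flip: sum_distrib_left right_diff_distrib)

lemma sums_to_pser:
  assumes "prime p" "sums_to T R" "\<And>n. T n \<in> pser p"
  shows "R \<in> pser p"
proof (rule pser_approx[OF assms(1)])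
  fix k
  have "R - (\<Sum>n\<le>k. T n) \<in> xy_power k"
    using assms(2) xy_power_mono[of _ "Suc k" k] by (simp add: sums_to_def)
  then show "\<exists>h\<in>pser p. R - h \<in> xy_power k"
    using pser_sum[OF assms(1), of "{..k}" T] assms(3) by blast
qed

text \<open>The j-th term is placed at index p j, where it will meet g^(p j), with zeros in between.
  That f has order at least p makes the remainders as small as \<open>sums_to\<close>
  demands.\<close>

lemma sums_to_ps_sparse:
  assumes f: "f \<in> xy_power p" and p: "p > 0"
  shows "sums_to (\<lambda>n. if p dvd n then bc (fps_nth s (n div p)) * f ^ (n div p) else 0) (ps s f)"
  unfolding sums_to_def
proof
  fix k
  have f1: "f \<in> xy_power 1" using xy_power_mono[OF f, of 1] p by simp
  let ?J = "k div p"
  have "(\<Sum>n\<le>k. if p dvd n then bc (fps_nth s (n div p)) * f ^ (n div p) else 0) =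
    (\<Sum>n\<in>{n. n \<le> k \<and> p dvd n}. bc (fps_nth s (n div p)) * f ^ (n div p))"
    by (simp add: sum.If_cases Int_def flip: sum.inter_filter)
  also have "\<dots> = (\<Sum>j\<le>?J. bc (fps_nth s j) * f ^ j)"
    by (rule sum.reindex_bij_witness[of _ "\<lambda>j. p * j" "\<lambda>n. n div p"])
      (use p in \<open>auto simp: div_le_mono less_eq_div_iff_mult_less_eq mult.commute\<close>)
  finally have sum: "(\<Sum>n\<le>k. if p dvd n then bc (fps_nth s (n div p)) * f ^ (n div p) else 0) =
    (\<Sum>j\<le>?J. bc (fps_nth s j) * f ^ j)" .
  let ?s = "\<Sum>j\<le>?J. fps_const (fps_nth s j) * fps_X ^ j"
  have "ps ?s f = (\<Sum>j\<le>?J. bc (fps_nth s j) * f ^ j)"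
  proof -
    have "ps (\<Sum>j\<in>A. fps_const (fps_nth s j) * fps_X ^ j) f = (\<Sum>j\<in>A. bc (fps_nth s j) * f ^ j)"
      if "finite A" for A
      using that
    proof (induction A)
      case empty then show ?case using ps_const[OF f1, of 0] by simp
    qed (simp add: ps_add[OF f1] ps_cmult[OF f1] ps_power[OF f1] ps_X[OF f1])
    then show ?thesis by simp
  qed
  moreover have "ps (s - ?s) f \<in> xy_power (p * Suc ?J)"
    using p by (intro ps_in_xy_power[OF f]) (auto simp: fps_sum_nth fps_X_power_iff if_distrib[of "(*) _"] cong: if_cong)
  ultimately have "ps s f - (\<Sum>j\<le>?J. bc (fps_nth s j) * f ^ j) \<in> xy_power (p * Suc ?J)"
    by (simp add: ps_diff[OF f1])
  moreover have "Suc k \<le> p * Suc ?J"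
    using p by (simp add: Suc_leI dividend_less_times_div)
  ultimately show "ps s f - (\<Sum>n\<le>k. if p dvd n then bc (fps_nth s (n div p)) * f ^ (n div p) else 0) \<in> xy_power (Suc k)"
    unfolding sum by (rule xy_power_mono)
qed

section \<open>Dwork congruences for the logarithm and the dilogarithm\<close>

lemma bc_cancel: "q \<noteq> 0 \<Longrightarrow> bc q * x = y \<Longrightarrow> x = bc (1 / q) * y"
  by (auto simp flip: mult.assoc bc_mult)

text \<open>(1 - e^(-q t)) / q, the quotient left over, with q = p j, when F(g)^j is subtracted from
  g^(p j) in the logarithm.\<close>

definition exp_diff_series :: "rat \<Rightarrow> rat fps" where
  "exp_diff_series q = Abs_fps (\<lambda>n. if n = 0 then 0 else - ((- q) ^ n) / (q * fact n))"

text \<open>(1 - e^(-q t) (1 + q t)) / q^2. The factor 1 + q t cancels the linear term of the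
  exponential, which after division by q^2 would leave t / q.\<close>

definition dilog_series :: "rat \<Rightarrow> rat fps" where
  "dilog_series q = Abs_fps (\<lambda>n. if n = 0 then 0 else (of_nat n - 1) * (- q) ^ n / (q\<^sup>2 * fact n))"

lemma pexp_uminus_cmult: "l \<in> xy_power 1 \<Longrightarrow> pexp (- (bc q * l)) = ps (fps_exp (- q)) l"
  using pexp_cmult[of l "- q"] by (simp add: bc_uminus)

lemma ps_exp_diff_series:
  assumes l: "l \<in> xy_power 1" and q: "q \<noteq> 0"
  shows "bc q * ps (exp_diff_series q) l = 1 - pexp (- (bc q * l))"
proof -
  have "fps_const q * exp_diff_series q = 1 - fps_exp (- q)"
    by (rule fps_ext) (use q in \<open>auto simp: exp_diff_series_def\<close>)
  then have "ps (fps_const q * exp_diff_series q) l = ps (1 - fps_exp (- q)) l" by simp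
  then show ?thesis
    by (simp add: ps_cmult[OF l] ps_diff[OF l] ps_1[OF l] pexp_uminus_cmult[OF l])
qed

lemma ps_dilog_series:
  assumes l: "l \<in> xy_power 1" and q: "q \<noteq> 0"
  shows "bc (q\<^sup>2) * ps (dilog_series q) l = 1 - pexp (- (bc q * l)) * (1 + bc q * l)"
proof -
  have "fps_const (q\<^sup>2) * dilog_series q = 1 - (fps_exp (- q) + fps_const q * (fps_X * fps_exp (- q)))"
  proof (rule fps_ext)
    fix n show "fps_nth (fps_const (q\<^sup>2) * dilog_series q) n =
      fps_nth (1 - (fps_exp (- q) + fps_const q * (fps_X * fps_exp (- q)))) n"
    proof (cases n)
      case (Suc k)
      have gen: "q\<^sup>2 * (K * (- q * A) / (q\<^sup>2 * ((1 + K) * f))) = 0 - (- q * A / ((1 + K) * f) + q * (A / f))"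
        if "1 + K \<noteq> 0" "f \<noteq> 0" for K A f :: rat
        using q that by (simp add: divide_simps) (simp add: algebra_simps)
      have "(1 + of_nat k :: rat) \<noteq> 0" by (metis of_nat_Suc of_nat_neq_0)
      moreover have fs: "fact (Suc k) = ((1 + of_nat k) * fact k :: rat)" by simp
      ultimately show ?thesis using gen[of "of_nat k" "fact k" "(- q) ^ k"]
        unfolding Suc dilog_series_def
        by (simp add: fs del: fact_Suc times_divide_eq_right times_divide_eq_left)
    qed (use q in \<open>simp add: dilog_series_def\<close>)
  qed
  then have "ps (fps_const (q\<^sup>2) * dilog_series q) l =
    ps (1 - (fps_exp (- q) + fps_const q * (fps_X * fps_exp (- q)))) l" by simp
  then show ?thesis
    unfolding ps_cmult[OF l] ps_diff[OF l] ps_add[OF l] ps_mult[OF l] ps_X[OF l] ps_1[OF l]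
      ps_const[OF l] pexp_uminus_cmult[OF l, symmetric]
    by (simp add: algebra_simps)
qed

lemma dilog_series_nth:
  assumes "q \<noteq> 0"
  shows "fps_nth (dilog_series q) n =
    (if n < 2 then 0 else (-1) ^ n * of_nat (n - 1) * (q ^ (n - 2) / fact n))"
proof -
  consider "n = 0" | "n = 1" | k where "n = Suc (Suc k)" by (metis One_nat_def not0_implies_Suc)
  then show ?thesis
    by cases (use assms in \<open>auto simp: dilog_series_def power_minus[of q] power2_eq_square\<close>)
qed

text \<open>
  The last summand absorbs the failure of \<open>g\<close> to satisfy \<open>F(g) = \<plusminus>g\<^sup>p\<close>, which is measured by \<open>l\<close>.
\<close>

definition dilog_defect :: "nat \<Rightarrow> bps \<Rightarrow> bps \<Rightarrow> bps" where
  "dilog_defect p g l =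
     Li2 g - bc (1 / of_nat p ^ 2) * frob p (Li2 g) + bc (1 / of_nat p) * l * frob p (Ln g)"

text \<open>g^n and the power n/p of F(g) share an index because, for n divisible by p, only their
  combination has a chance to be p-integral.\<close>

definition dilog_term :: "nat \<Rightarrow> bps \<Rightarrow> bps \<Rightarrow> nat \<Rightarrow> bps" where
  "dilog_term p g l n = bc (fps_nth li2_series n) * g ^ n
     + bc (- 1 / of_nat p ^ 2) *
        (if p dvd n then bc (fps_nth li2_series (n div p)) * frob p g ^ (n div p) else 0)
     + (bc (1 / of_nat p) * l) *
        (if p dvd n then bc (fps_nth ln_series (n div p)) * frob p g ^ (n div p) else 0)"

text \<open>
  The series \<open>(e\<^sup>2\<^sup>B - 1) / 2\<close>, which is 2-integral if \<open>B\<close> is.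
\<close>

definition half_exp :: "bps \<Rightarrow> bps" where
  "half_exp B = ps (Abs_fps (\<lambda>n. if n = 0 then 0 else 2 ^ (n - 1) / fact n)) B"

lemma half_exp:
  assumes B: "B \<in> xy_power 1"
  shows "1 + 2 * half_exp B = pexp (2 * B)"
proof -
  let ?h = "Abs_fps (\<lambda>n. if n = 0 then 0 else 2 ^ (n - 1) / fact n) :: rat fps"
  have "1 + fps_const 2 * ?h = fps_exp 2"
    by (rule fps_ext) (auto simp: power_eq_if)
  then have "ps (1 + fps_const 2 * ?h) B = pexp (bc 2 * B)" by (simp add: pexp_cmult[OF B])
  then show ?thesis
    by (simp add: half_exp_def ps_add[OF B] ps_1[OF B] ps_cmult[OF B] bc_numeral)
qed

lemma half_exp_in_xy_power: "B \<in> xy_power k \<Longrightarrow> k \<ge> 1 \<Longrightarrow> half_exp B \<in> xy_power k"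
  unfolding half_exp_def using ps_in_xy_power[of B k 1] by simp

lemma half_exp_diff_in_xy_power:
  "A \<in> xy_power 1 \<Longrightarrow> B \<in> xy_power 1 \<Longrightarrow> A - B \<in> xy_power k \<Longrightarrow> half_exp A - half_exp B \<in> xy_power k"
  unfolding half_exp_def by (rule ps_diff_in_xy_power)

lemma dilog_term_0: "dilog_term p g l 0 = 0"
  by (simp add: dilog_term_def li2_series_def ln_series_def)

context
  fixes p :: nat assumes p: "prime p"
begin

lemma p_gt_1: "p > 1" using p by (rule prime_gt_1_nat)

lemma pint_sign: "(- 1) ^ n \<in> pint p"
  using pint_of_int[OF p, of "(- 1) ^ n"] by simp

lemma exp_diff_series_pint:
  assumes j: "j > 0"
  shows "fps_nth (exp_diff_series (of_nat (p * j))) n \<in> pint p"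
proof (cases n)
  case (Suc k)
  have "fps_nth (exp_diff_series (of_nat (p * j))) n =
      (- 1) ^ k * of_nat (j ^ k) * (of_nat p ^ k / fact n)"
    using j p_gt_1 Suc by (simp add: exp_diff_series_def power_minus[of "_ * _"] power_mult_distrib)
  moreover have "of_nat p ^ k / fact n \<in> pint p"
    using mult_le_mono1[of 1 "p - 1" n] p_gt_1 Suc by (intro pint_power_fact[OF p]) auto
  ultimately show ?thesis by (simp only: pint_mult pint_simps(1) pint_sign p)
qed (simp add: exp_diff_series_def p)

text \<open>For p = 2 this fails already at n = 2, where the coefficient is 1/2; hence the separate
  treatment of that prime.\<close>

lemma dilog_series_pint:
  assumes j: "j > 0" and p2: "p \<noteq> 2"
  shows "fps_nth (dilog_series (of_nat (p * j))) n \<in> pint p"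
proof (cases "n < 2")
  case False
  have "p \<ge> 3" using p_gt_1 p2 by linarith
  then have "2 * (n - 1) \<le> (p - 1) * (n - 1)" by (intro mult_le_mono1) simp
  moreover have "n \<le> 2 * (n - 1)" using False by simp
  ultimately have "n \<le> (p - 1) * (n - 1)" by (rule order.trans[rotated])
  moreover have "Suc (n - 2) = n - 1" using False by simp
  ultimately have "n \<le> (p - 1) * Suc (n - 2)" by (simp only:)
  then have "of_nat p ^ (n - 2) / fact n \<in> pint p"
    by (rule pint_power_fact[OF p, rotated]) (use False in auto)
  then have "((- 1) ^ n * of_nat (n - 1)) * of_nat (j ^ (n - 2)) * (of_nat p ^ (n - 2) / fact n) \<in> pint p"
    by (simp only: pint_mult pint_simps(1) pint_sign p)
  then show ?thesis using False j p_gt_1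
    by (simp add: dilog_series_nth power_mult_distrib mult_ac)
qed (use j p_gt_1 in \<open>simp add: dilog_series_nth p\<close>)

lemma frob_in_xy_power:
  assumes "g \<in> xy_power 1"
  shows "frob p g \<in> xy_power p" "frob p g \<in> xy_power 1"
  using frob_xy_power[OF p assms] xy_power_mono p_gt_1 by auto

lemma dilog_sums_to:
  assumes g1: "g \<in> xy_power 1"
  shows "sums_to (dilog_term p g l) (dilog_defect p g l)"
proof -
  have F: "frob p (Ln g) = ps ln_series (frob p g)" "frob p (Li2 g) = ps li2_series (frob p g)"
    by (simp_all add: Ln_def Li2_def frob_ps[OF p g1])
  have p0: "p > 0" using p_gt_1 by simp
  have "sums_to (dilog_term p g l) (ps li2_series g + bc (- 1 / of_nat p ^ 2) * frob p (Li2 g)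
      + (bc (1 / of_nat p) * l) * frob p (Ln g))"
    unfolding F dilog_term_def
    by (intro sums_to_add sums_to_mult sums_to_ps g1 sums_to_ps_sparse frob_in_xy_power[OF g1] p0)
  then show ?thesis by (simp add: dilog_defect_def bc_uminus Li2_def flip: minus_divide_left)
qed

lemma dilog_term_nondvd:
  assumes gp: "g \<in> pser p" and n: "\<not> p dvd n"
  shows "dilog_term p g l n \<in> pser p"
proof -
  have "(1 / of_nat n) ^ 2 \<in> pint p" using pint_power[OF p pint_inverse_nat[OF n]] .
  moreover have "n \<noteq> 0" using n by (cases n) auto
  ultimately show ?thesis using n
    by (auto simp: dilog_term_def li2_series_def power_divide intro!: pser_mult pser_bc pser_power p gp)
qed

context
  fixes g l :: bps and e :: rat
  assumes g1: "g \<in> xy_power 1" and gp: "g \<in> pser p"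
    and l1: "l \<in> xy_power 1" and lp: "l \<in> pser p"
    and e: "e = 1 \<or> e = - 1 \<and> p = 2"
    and frob_g: "frob p g = bc e * g ^ p * pexp (- (of_nat p * l))"
begin

text \<open>By hypothesis F(g) is g^p up to the sign e and a factor e^(-p l) with l integral. On
  j-th powers the factor becomes e^(-q l) with q = p j, the shape met in
  \<open>exp_diff_series\<close> and \<open>dilog_series\<close>.\<close>

lemma frob_g_power: "frob p g ^ j = bc (e ^ j) * g ^ (p * j) * pexp (- (bc (of_nat (p * j)) * l))"
proof -
  have "pexp (- (of_nat p * l)) ^ j = pexp (of_nat j * (- (of_nat p * l)))"
    by (rule pexp_of_nat[symmetric]) (intro xy_power_uminus xy_power_mult_left l1)
  also have "of_nat j * (- (of_nat p * l)) = - (bc (of_nat (p * j)) * l)"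
    by (simp add: bc_mult bc_of_nat mult_ac)
  finally show ?thesis
    by (simp only: frob_g power_mult_distrib bc_power power_mult)
qed

text \<open>With q = p j the difference is g^q (1 - e^(-q l)), divisible by q. If the sign is -1,
  then p = 2 and j is odd, and the additional 2 g^q / q = g^q / j is integral too.\<close>

lemma Ln_term_pser:
  assumes j: "j > 0"
  shows "bc (1 / of_nat (p * j)) * (g ^ (p * j) - frob p g ^ j) \<in> pser p"
proof -
  let ?q = "of_nat (p * j) :: rat" and ?P = "g ^ (p * j)"
  let ?d = "ps (exp_diff_series ?q) l"
  have q: "?q \<noteq> 0" using j p_gt_1 by simp
  have d: "?d \<in> pser p" by (rule pser_ps[OF p l1 lp exp_diff_series_pint[OF j]])
  have P: "?P \<in> pser p" by (rule pser_power[OF p gp])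
  have E: "pexp (- (bc ?q * l)) = 1 - bc ?q * ?d" using ps_exp_diff_series[OF l1 q] by simp
  have c: "bc (1 / ?q) * (bc ?q * x) = x" for x using bc_cancel[OF q refl, of x] by simp
  show ?thesis
  proof (cases "e ^ j = 1")
    case True
    have "bc (1 / ?q) * (?P - frob p g ^ j) = bc (1 / ?q) * (bc ?q * (?P * ?d))"
      unfolding frob_g_power E by (simp add: True algebra_simps)
    also have "\<dots> = ?P * ?d" by (rule c)
    finally show ?thesis using pser_mult[OF p P d] by simp
  next
    case False
    then have ej: "e = - 1" "p = 2" "odd j" using e by (auto simp: minus_one_power_iff split: if_splits)
    have "bc (1 / ?q) * (?P - frob p g ^ j) = bc (1 / ?q) * (bc 2 * ?P - bc ?q * (?P * ?d))"
      unfolding frob_g_power E using ej by (simp add: bc_uminus bc_numeral algebra_simps)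
    also have "\<dots> = bc (1 / of_nat j) * ?P - ?P * ?d"
      unfolding right_diff_distrib c using ej by (simp flip: mult.assoc bc_mult)
    finally have *: "bc (1 / ?q) * (?P - frob p g ^ j) = bc (1 / of_nat j) * ?P - ?P * ?d" .
    have "\<not> p dvd j" using ej by simp
    from pint_inverse_nat[OF this] show ?thesis
      unfolding * by (intro pser_diff pser_mult pser_bc P d p)
  qed
qed

text \<open>Dwork's congruence for log(1 - g): terms of index prime to p are integral, and the term
  of index p j is paired with the j-th term of F(Ln g).\<close>

lemma Ln_pser: "Ln g - bc (1 / of_nat p) * frob p (Ln g) \<in> pser p"
proof -
  have F: "frob p (Ln g) = ps ln_series (frob p g)" by (simp add: Ln_def frob_ps[OF p g1])
  have "sums_to (\<lambda>n. bc (fps_nth ln_series n) * g ^ n + bc (- 1 / of_nat p) *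
      (if p dvd n then bc (fps_nth ln_series (n div p)) * frob p g ^ (n div p) else 0))
    (Ln g + bc (- 1 / of_nat p) * frob p (Ln g))"
    unfolding F unfolding Ln_def
    by (intro sums_to_add sums_to_mult sums_to_ps g1 sums_to_ps_sparse frob_in_xy_power[OF g1]) (use p_gt_1 in simp)
  then have "Ln g + bc (- 1 / of_nat p) * frob p (Ln g) \<in> pser p"
  proof (rule sums_to_pser[OF p])
    fix n
    show "bc (fps_nth ln_series n) * g ^ n + bc (- 1 / of_nat p) *
      (if p dvd n then bc (fps_nth ln_series (n div p)) * frob p g ^ (n div p) else 0) \<in> pser p"
    proof (cases "p dvd n")
      case False
      then have "- (1 / of_nat n) \<in> pint p" by (intro pint_uminus p pint_inverse_nat)
      moreover have "n \<noteq> 0" using False by (cases n) auto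
      ultimately show ?thesis using False by (auto simp: ln_series_def intro!: pser_mult pser_bc pser_power p gp)
    next
      case True
      then obtain j where n: "n = p * j" by auto
      show ?thesis
      proof (cases "j = 0")
        case False
        have *: "bc (- 1 / of_nat p) * (bc (- 1 / of_nat j) * x) = bc (1 / of_nat (p * j)) * x" for x
          by (simp flip: mult.assoc bc_mult)
        have "bc (- 1 / of_nat (p * j)) * g ^ (p * j) + bc (- 1 / of_nat p) * (bc (- 1 / of_nat j) * frob p g ^ j)
          = - (bc (1 / of_nat (p * j)) * (g ^ (p * j) - frob p g ^ j))"
          unfolding * by (simp add: bc_uminus algebra_simps flip: minus_divide_left)
        then show ?thesis using Ln_term_pser[of j] False p_gt_1
          by (simp add: n ln_series_def pser_uminus[OF p])
      qed (use n p in \<open>simp add: ln_series_def pser_0\<close>)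
    qed
  qed
  then show ?thesis by (simp add: bc_uminus flip: minus_divide_left)
qed

text \<open>With q = p j the three contributions add up to (g^q - F(g)^j (1 + q l)) / q^2. For the
  sign -1 the numerator is 2 g^q up to a multiple of q^2, and 2 / q^2 = 1 / (2 j^2) when p =
  2.\<close>

lemma dilog_term_mult:
  assumes j: "j > 0"
  shows "e ^ j = 1 \<Longrightarrow> dilog_term p g l (p * j) = g ^ (p * j) * ps (dilog_series (of_nat (p * j))) l"
    and "e ^ j = - 1 \<Longrightarrow> p = 2 \<Longrightarrow> dilog_term p g l (p * j) =
      g ^ (p * j) * (bc (1 / (2 * of_nat j ^ 2)) - ps (dilog_series (of_nat (p * j))) l)"
proof -
  let ?q = "of_nat (p * j) :: rat" and ?P = "g ^ (p * j)"
  let ?c = "ps (dilog_series ?q) l"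
  have q: "?q \<noteq> 0" "?q\<^sup>2 \<noteq> 0" using j p_gt_1 by simp_all
  have E: "pexp (- (bc ?q * l)) * (1 + bc ?q * l) = 1 - bc (?q\<^sup>2) * ?c"
    using ps_dilog_series[OF l1 q(1)] by simp
  have c: "bc (1 / ?q\<^sup>2) * (bc (?q\<^sup>2) * x) = x" for x using bc_cancel[OF q(2) refl, of x] by simp
  have "dilog_term p g l (p * j) = bc (1 / ?q\<^sup>2) * (?P - bc (e ^ j) * ?P * (pexp (- (bc ?q * l)) * (1 + bc ?q * l)))"
  proof -
    have 1: "bc (1 / of_nat p) * l * (bc (- 1 / of_nat j) * y) = - (bc (1 / ?q\<^sup>2) * (bc ?q * l * y))" for y
    proof -
      have "1 / ?q\<^sup>2 * ?q = 1 / of_nat p * (1 / of_nat j)" using q by (simp add: power2_eq_square)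
      then have "bc (1 / ?q\<^sup>2) * bc ?q = bc (1 / of_nat p) * bc (1 / of_nat j)" by (simp only: flip: bc_mult)
      then have "bc (1 / ?q\<^sup>2) * (bc ?q * l * y) = bc (1 / of_nat p) * bc (1 / of_nat j) * (l * y)"
        by (simp only: mult_ac)
      then show ?thesis
        unfolding minus_divide_left[symmetric] bc_uminus
        by (simp only: mult_minus_left mult_minus_right mult_ac)
    qed
    have 2: "bc (- 1 / of_nat p ^ 2) * (bc (1 / of_nat j ^ 2) * y) = - (bc (1 / ?q\<^sup>2) * y)" for y
      by (simp add: power_mult_distrib flip: mult.assoc bc_mult bc_uminus minus_divide_left)
        (simp add: bc_uminus)
    have "dilog_term p g l (p * j) = bc (1 / ?q\<^sup>2) * ?P
      + bc (- 1 / of_nat p ^ 2) * (bc (1 / of_nat j ^ 2) * frob p g ^ j)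
      + bc (1 / of_nat p) * l * (bc (- 1 / of_nat j) * frob p g ^ j)"
      using j p_gt_1 by (simp add: dilog_term_def li2_series_def ln_series_def del: of_nat_mult)
    then show ?thesis unfolding 1 2 frob_g_power by (simp add: algebra_simps)
  qed
  note this[unfolded E]
  moreover {
    assume "e ^ j = 1"
    then have "bc (1 / ?q\<^sup>2) * (?P - bc (e ^ j) * ?P * (1 - bc (?q\<^sup>2) * ?c)) =
      bc (1 / ?q\<^sup>2) * (bc (?q\<^sup>2) * (?P * ?c))" by (simp add: algebra_simps)
    also have "\<dots> = ?P * ?c" by (rule c)
    finally have "bc (1 / ?q\<^sup>2) * (?P - bc (e ^ j) * ?P * (1 - bc (?q\<^sup>2) * ?c)) = ?P * ?c" .
  }
  moreover {
    assume ej: "e ^ j = - 1" and p2: "p = 2"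
    then have "bc (1 / ?q\<^sup>2) * (?P - bc (e ^ j) * ?P * (1 - bc (?q\<^sup>2) * ?c)) =
      bc (1 / ?q\<^sup>2) * (bc 2 * ?P) - bc (1 / ?q\<^sup>2) * (bc (?q\<^sup>2) * (?P * ?c))"
      by (simp add: bc_uminus bc_numeral algebra_simps)
    also have "\<dots> = bc (1 / (2 * of_nat j ^ 2)) * ?P - ?P * ?c"
      unfolding c using p2 j by (simp add: power2_eq_square flip: mult.assoc bc_mult)
    finally have "bc (1 / ?q\<^sup>2) * (?P - bc (e ^ j) * ?P * (1 - bc (?q\<^sup>2) * ?c)) =
      ?P * (bc (1 / (2 * of_nat j ^ 2)) - ?c)" by (simp add: algebra_simps)
  }
  ultimately show "e ^ j = 1 \<Longrightarrow> dilog_term p g l (p * j) = ?P * ?c"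
    "e ^ j = - 1 \<Longrightarrow> p = 2 \<Longrightarrow> dilog_term p g l (p * j) = ?P * (bc (1 / (2 * of_nat j ^ 2)) - ?c)"
    by simp_all
qed

lemma dilog_defect_odd:
  assumes "p \<noteq> 2"
  shows "dilog_defect p g l \<in> pser p"
proof (rule sums_to_pser[OF p dilog_sums_to[OF g1]])
  fix n
  show "dilog_term p g l n \<in> pser p"
  proof (cases "p dvd n")
    case True
    then obtain j where n: "n = p * j" by auto
    show ?thesis
    proof (cases "j = 0")
      case False
      then have "dilog_term p g l n = g ^ (p * j) * ps (dilog_series (of_nat (p * j))) l"
        using dilog_term_mult(1)[of j] e assms n by simp
      then show ?thesis using False assms
        by (auto intro!: pser_mult pser_power pser_ps dilog_series_pint p gp l1 lp simp del: of_nat_mult)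
    qed (simp add: n dilog_term_0 pser_0 p)
  qed (rule dilog_term_nondvd[OF gp])
qed

end
end

section \<open>The dilogarithm at the prime 2\<close>

lemma prime_2: "prime (2::nat)" by simp

lemmas pser2 = pser_intros[OF prime_2]

lemma half_exp_pser:
  assumes "B \<in> xy_power 1" "B \<in> pser 2"
  shows "half_exp B \<in> pser 2"
  unfolding half_exp_def
proof (rule pser_ps[OF prime_2 assms])
  fix n show "fps_nth (Abs_fps (\<lambda>n. if n = 0 then 0 else 2 ^ (n - 1) / fact n)) n \<in> pint 2"
    using pint_power_fact[OF prime_2, of n "n - 1"] by (cases n) (auto simp: prime_2)
qed

text \<open>Only the difference has to be integral and even, while the operands may have
  denominators; this is why \<open>cong2_mult\<close> and \<open>cong2_power2\<close> ask for
  integrality.\<close>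

definition cong2 :: "bps \<Rightarrow> bps \<Rightarrow> bool" where
  "cong2 x y \<longleftrightarrow> (\<exists>h\<in>pser 2. x - y = 2 * h)"

lemma cong2I: "h \<in> pser 2 \<Longrightarrow> x - y = 2 * h \<Longrightarrow> cong2 x y"
  by (auto simp: cong2_def)

lemma bc_half: "bc (1 / 2) * (2 * x) = x" "2 * (bc (1 / 2) * x) = x"
  using bc_cancel[of 2 x "2 * x"] bc_cancel[of "1 / 2" x "bc (1 / 2) * x"] by (simp_all add: bc_numeral)

lemma cong2_iff: "cong2 x y \<longleftrightarrow> bc (1 / 2) * (x - y) \<in> pser 2"
  unfolding cong2_def by (metis bc_half)

lemma cong2_refl: "cong2 x x"
  by (rule cong2I[of 0]) (simp_all add: pser2)

lemma cong2_sym: "cong2 x y \<Longrightarrow> cong2 y x"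
  unfolding cong2_def by (metis minus_diff_eq mult_minus_right pser2(3))

lemma cong2_trans [trans]: "cong2 x y \<Longrightarrow> cong2 y z \<Longrightarrow> cong2 x z"
  unfolding cong2_iff using pser2(1)[of "bc (1 / 2) * (x - y)" "bc (1 / 2) * (y - z)"]
  by (simp add: algebra_simps)

lemma cong2_add: "cong2 x y \<Longrightarrow> cong2 z w \<Longrightarrow> cong2 (x + z) (y + w)"
  unfolding cong2_iff using pser2(1)[of "bc (1 / 2) * (x - y)" "bc (1 / 2) * (z - w)"]
  by (simp add: algebra_simps)

lemma cong2_diff: "cong2 x y \<Longrightarrow> cong2 z w \<Longrightarrow> cong2 (x - z) (y - w)"
  unfolding cong2_iff using pser2(2)[of "bc (1 / 2) * (x - y)" "bc (1 / 2) * (z - w)"]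
  by (simp add: algebra_simps)

lemma cong2_mult:
  assumes "cong2 x y" "cong2 z w" "x \<in> pser 2" "w \<in> pser 2"
  shows "cong2 (x * z) (y * w)"
proof -
  obtain h k where hk: "h \<in> pser 2" "k \<in> pser 2" "x - y = 2 * h" "z - w = 2 * k"
    using assms by (auto simp: cong2_def)
  have "x * z - y * w = x * (z - w) + (x - y) * w" by (simp add: algebra_simps)
  also have "\<dots> = 2 * (x * k + h * w)" unfolding hk by (simp add: algebra_simps)
  finally show ?thesis by (rule cong2I[rotated]) (intro pser2 assms hk)
qed

lemma cong2_mult_left: "cong2 z w \<Longrightarrow> x \<in> pser 2 \<Longrightarrow> cong2 (x * z) (x * w)"
  unfolding cong2_def by (metis mult.left_commute pser2(4) right_diff_distrib)

lemma cong2_power2: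
  assumes "cong2 x y" "y \<in> pser 2"
  shows "cong2 (x\<^sup>2) (y\<^sup>2)"
proof -
  obtain h where h: "h \<in> pser 2" "x - y = 2 * h" using assms by (auto simp: cong2_def)
  then have "x = y + 2 * h" by (simp add: algebra_simps)
  then have "x\<^sup>2 - y\<^sup>2 = 2 * (2 * h * y + 2 * h\<^sup>2)" by (simp add: power2_eq_square algebra_simps)
  then show ?thesis by (rule cong2I[rotated]) (intro pser2 assms h)
qed

lemma cong2_pser: "cong2 x y \<Longrightarrow> y \<in> pser 2 \<Longrightarrow> x \<in> pser 2"
  unfolding cong2_def by (metis diff_add_cancel pser2(1,4) pser2(12))

lemma cong2_of_int_even: "even n \<Longrightarrow> x \<in> pser 2 \<Longrightarrow> cong2 (of_int n * x) 0"
  by (erule evenE) (auto intro!: cong2I[of "of_int _ * x"] pser2 simp: mult_ac)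

lemma cong2_of_int:
  assumes "even (n - k)" "x \<in> pser 2"
  shows "cong2 (of_int n * x) (of_int k * x)"
  using cong2_of_int_even[OF assms] by (simp add: cong2_def algebra_simps)

context
  fixes l :: bps
  assumes l1: "l \<in> xy_power 1" and lp: "l \<in> pser 2"
begin

lemma half_exp_2: "half_exp l \<in> pser 2" "half_exp l \<in> xy_power 1"
  using half_exp_pser[OF l1 lp] half_exp_in_xy_power[OF l1] by simp_all

text \<open>With L for \<open>half_exp l\<close>, inversion gives l = log(1 + 2 L) / 2, whose
  coefficients (-1)^(n-1) 2^(n-1) / n are even from n = 3 on.\<close>

lemma half_exp_log: "cong2 l (half_exp l - half_exp l ^ 2)"
proof -
  let ?L = "half_exp l"
  define h :: "rat fps" where "h = fps_const (1 / 2) * (fps_ln 1 oo (fps_const 2 * fps_X))"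
  define k where "k = fps_const (1 / 2) * (h - (fps_X - fps_X ^ 2))"
  have L1: "?L \<in> xy_power 1" by (rule half_exp_2)
  have 2: "2 * l \<in> xy_power 1" using l1 by (rule xy_power_mult_left)
  have "2 * ?L = pexp (2 * l) - 1" using half_exp[OF l1] by (simp add: algebra_simps)
  then have "ps (fps_ln 1) (2 * ?L) = 2 * l" using ln_pexp[OF 2] by simp
  moreover have "ps (fps_ln 1 oo (fps_const 2 * fps_X)) ?L = ps (fps_ln 1) (2 * ?L)"
    by (subst ps_compose[OF L1]) (simp_all add: ps_cmult[OF L1] ps_X[OF L1] bc_numeral)
  ultimately have h: "ps h ?L = l"
    by (simp add: h_def ps_cmult[OF L1] bc_half)
  have nth: "fps_nth k n = (if n < 3 then 0 else (- 1) ^ (n - 1) * (2 ^ (n - 2) / of_nat n))" for n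
  proof -
    consider "n = 0" | "n = 1" | "n = 2" | m where "n = Suc (Suc (Suc m))"
      by (metis One_nat_def Suc_1 not0_implies_Suc)
    then show ?thesis
      by cases (auto simp: k_def h_def fps_ln_nth fps_X_power_iff)
  qed
  have "fps_nth k n \<in> pint 2" for n
  proof (cases "n < 3")
    case False
    \<comment> \<open>From 2^v <= n < 2^(n-1) the exponent v of 2 in n is at most n - 2, so half of
      the coefficient is still integral.\<close>
    have "2 ^ multiplicity 2 n \<le> n" using False by (intro dvd_imp_le multiplicity_dvd) auto
    also have "n < 2 ^ (n - 1)"
    proof -
      have "Suc (Suc (Suc i)) < 2 ^ (Suc (Suc i))" for i :: nat by (induction i) auto
      from this[of "n - 3"] False show ?thesis by (simp add: numeral_3_eq_3 Suc_diff_Suc)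
    qed
    finally have "multiplicity 2 n < n - 1" using power_less_imp_less_exp[of 2] by force
    then have "multiplicity 2 n \<le> n - 2" by linarith
    then have "of_nat 2 ^ (n - 2) / of_nat n \<in> pint 2"
      using False by (intro pint_of_multiplicity prime_2) auto
    then have "(- 1) ^ (n - 1) * (of_nat 2 ^ (n - 2) / of_nat n) \<in> pint 2"
      by (rule pint_mult[OF prime_2 pint_sign[OF prime_2]])
    then show ?thesis unfolding nth using False by simp
  qed (simp add: nth prime_2)
  then have "ps k ?L \<in> pser 2" by (rule pser_ps[OF prime_2 half_exp_2(2,1)])
  moreover have "l - (?L - ?L ^ 2) = 2 * ps k ?L"
    by (simp add: k_def ps_cmult[OF L1] bc_half ps_diff[OF L1] ps_power[OF L1] ps_X[OF L1] h)
  ultimately show ?thesis by (rule cong2I)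
qed

lemma pexp_uminus_half: "pexp (- (2 * l)) * (1 + 2 * half_exp l) = 1" "pexp (- (2 * l)) \<in> pser 2"
proof -
  have "2 * l \<in> xy_power 1" using l1 by (rule xy_power_mult_left)
  from pexp_minus[OF this] show "pexp (- (2 * l)) * (1 + 2 * half_exp l) = 1"
    unfolding half_exp[OF l1] by (simp only: mult.commute)
  have "pexp (- (bc 2 * l)) = 1 - bc 2 * ps (exp_diff_series 2) l"
    using ps_exp_diff_series[OF l1, of 2] by simp
  moreover have "ps (exp_diff_series 2) l \<in> pser 2"
    using exp_diff_series_pint[OF prime_2, of 1] by (intro pser_ps prime_2 l1 lp) simp
  ultimately show "pexp (- (2 * l)) \<in> pser 2"
    by (simp add: bc_numeral pser2)
qed

text \<open>Let E = e^(-2 l) = 1 / (1 + 2 L) and l = L - L^2 + 2 k. Then 4 times the series is E (2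
  L^2 - 4 k), and E = 1 - 2 L E isolates 2 L^2 modulo 4.\<close>

lemma dilog_series_2: "ps (dilog_series 2) l - bc (1 / 2) * half_exp l ^ 2 \<in> pser 2"
proof -
  let ?c = "ps (dilog_series 2) l" and ?L = "half_exp l" and ?E = "pexp (- (2 * l))"
  obtain k where k: "k \<in> pser 2" "l - (?L - ?L\<^sup>2) = 2 * k"
    using half_exp_log by (auto simp: cong2_def)
  then have lk: "l = ?L - ?L\<^sup>2 + 2 * k" by (simp add: algebra_simps)
  have EL: "?E * (1 + 2 * ?L) = 1" by (rule pexp_uminus_half)
  have "bc 4 * ?c = 1 - ?E * (1 + 2 * l)" using ps_dilog_series[OF l1, of 2] by (simp add: bc_numeral)
  also have "\<dots> = ?E * (1 + 2 * ?L) - ?E * (1 + 2 * l)" by (simp only: EL)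
  also have "\<dots> = ?E * (2 * ?L\<^sup>2 - 4 * k)" by (subst (2) lk) (simp add: algebra_simps)
  also have "\<dots> = 2 * ?L\<^sup>2 * (?E * (1 + 2 * ?L)) - 4 * ?L ^ 3 * ?E - 4 * k * ?E"
    by (simp add: algebra_simps power2_eq_square power3_eq_cube)
  also have "\<dots> = 2 * ?L\<^sup>2 - 4 * (?L ^ 3 * ?E + k * ?E)" unfolding EL by (simp add: algebra_simps)
  finally have "?c = bc (1 / 4) * (2 * ?L\<^sup>2 - 4 * (?L ^ 3 * ?E + k * ?E))" by (intro bc_cancel) auto
  also have "\<dots> = bc (1 / 2) * ?L\<^sup>2 - (?L ^ 3 * ?E + k * ?E)"
  proof -
    have "bc (1 / 4) * 2 = bc (1 / 2)" "bc (1 / 4) * 4 = 1"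
      by (simp_all flip: bc_numeral bc_mult)
    then show ?thesis by (simp only: right_diff_distrib mult.assoc[symmetric]) simp
  qed
  finally have "?c - bc (1 / 2) * ?L\<^sup>2 = - (?L ^ 3 * ?E + k * ?E)" by simp
  then show ?thesis by (simp add: pser2 half_exp_2 pexp_uminus_half k)
qed

text \<open>Passing from q = 2 to q = 2 j multiplies the n-th coefficient by j^(n-2). For odd j the
  number j^(n-2) - 1 is even and supplies the one factor 2 that 2^(n-2) / n! may lack.\<close>

lemma dilog_series_odd:
  assumes j: "odd j"
  shows "ps (dilog_series (of_nat (2 * j))) l - bc (1 / 2) * half_exp l ^ 2 \<in> pser 2"
proof -
  have "fps_nth (dilog_series (of_nat (2 * j)) - dilog_series 2) n \<in> pint 2" for n
  proof (cases "n < 2")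
    case False
    have "even (int j ^ (n - 2) - 1)" using j by simp
    then obtain i where i: "int j ^ (n - 2) - 1 = 2 * i" by (elim evenE)
    then have "(of_int (int j ^ (n - 2) - 1) :: rat) = of_int (2 * i)" by simp
    then have j': "(of_nat j ^ (n - 2) :: rat) = 1 + 2 * of_int i" by simp
    have "Suc (n - 2) = n - 1" using False by simp
    then have 2: "(2 :: rat) * 2 ^ (n - 2) = 2 ^ (n - 1)" by (metis power_Suc)
    have q: "(of_nat (2 * j) :: rat) \<noteq> 0" "(2 :: rat) \<noteq> 0" using odd_pos[OF j] by simp_all
    have "fps_nth (dilog_series (of_nat (2 * j)) - dilog_series 2) n =
       (-1) ^ n * of_nat (n - 1) * ((of_nat j ^ (n - 2) - 1) * 2 ^ (n - 2) / fact n)"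
      using False unfolding fps_sub_nth dilog_series_nth[OF q(1)] dilog_series_nth[OF q(2)]
      by (simp add: power_mult_distrib algebra_simps diff_divide_distrib)
    also have "(of_nat j ^ (n - 2) - 1) * 2 ^ (n - 2) / fact n = of_int i * (of_nat 2 ^ (n - 1) / (fact n :: rat))"
      unfolding j' of_nat_numeral 2[symmetric] by simp
    also have "(-1) ^ n * of_nat (n - 1) * (of_int i * (of_nat 2 ^ (n - 1) / (fact n :: rat))) \<in> pint 2"
      using pint_power_fact[OF prime_2, of n "n - 1"] False
      by (intro pint_mult prime_2 pint_sign pint_simps pint_of_int) auto
    finally show ?thesis .
  qed (use odd_pos[OF j] in \<open>simp add: dilog_series_nth prime_2\<close>)
  then have "ps (dilog_series (of_nat (2 * j)) - dilog_series 2) l \<in> pser 2"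
    by (rule pser_ps[OF prime_2 l1 lp])
  then have "(ps (dilog_series (of_nat (2 * j))) l - ps (dilog_series 2) l) +
     (ps (dilog_series 2) l - bc (1 / 2) * half_exp l ^ 2) \<in> pser 2"
    unfolding ps_diff[OF l1] by (rule pser2(1)[OF _ dilog_series_2])
  then show ?thesis by simp
qed

text \<open>Now 4 divides q, and 4^(n-2) / n! is 2-integral for n >= 3, so only l^2 / 2 survives; by
  \<open>half_exp_log\<close>, l^2 is congruent to L^2 + L^4 modulo 2.\<close>

lemma dilog_series_even:
  assumes j: "even j" "j > 0"
  shows "ps (dilog_series (of_nat (2 * j))) l - bc (1 / 2) * (half_exp l ^ 2 + half_exp l ^ 4) \<in> pser 2"
proof -
  obtain i where i: "j = 2 * i" using j by (elim evenE)
  let ?q = "of_nat (2 * j) :: rat"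
  have q: "?q \<noteq> 0" using j by simp
  have nth: "fps_nth (dilog_series ?q - fps_const (1 / 2) * fps_X ^ 2) n =
    (if n < 2 then 0 else (-1) ^ n * of_nat (n - 1) * (?q ^ (n - 2) / fact n)) - (if n = 2 then 1 / 2 else 0)" for n
    unfolding fps_sub_nth dilog_series_nth[OF q] by (simp add: fps_X_power_iff)
  have "fps_nth (dilog_series ?q - fps_const (1 / 2) * fps_X ^ 2) n \<in> pint 2" for n
  proof -
    consider "n < 2" | "n = 2" | "n \<ge> 3" by linarith
    then show ?thesis
    proof cases
      case 3
      have "fps_nth (dilog_series ?q - fps_const (1 / 2) * fps_X ^ 2) n =
        (-1) ^ n * of_nat (n - 1) * (?q ^ (n - 2) / fact n)"
        unfolding nth using 3 by simp
      also have "?q ^ (n - 2) / fact n = of_nat (i ^ (n - 2)) * (of_nat 2 ^ (2 * (n - 2)) / fact n)"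
        by (simp add: i power_mult power_mult_distrib power2_eq_square)
      also have "(-1) ^ n * of_nat (n - 1) * (of_nat (i ^ (n - 2)) * (of_nat 2 ^ (2 * (n - 2)) / (fact n :: rat))) \<in> pint 2"
        using 3 by (intro pint_mult prime_2 pint_sign pint_simps(1) pint_power_fact) auto
      finally show ?thesis .
    qed (unfold nth, simp_all add: fact_2 prime_2)
  qed
  then have "ps (dilog_series ?q - fps_const (1 / 2) * fps_X ^ 2) l \<in> pser 2"
    by (rule pser_ps[OF prime_2 l1 lp])
  then have 1: "ps (dilog_series ?q) l - bc (1 / 2) * l\<^sup>2 \<in> pser 2"
    by (simp add: ps_diff[OF l1] ps_cmult[OF l1] ps_power[OF l1] ps_X[OF l1])
  let ?L = "half_exp l"
  have "cong2 (l\<^sup>2) ((?L - ?L\<^sup>2)\<^sup>2)"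
    by (rule cong2_power2[OF half_exp_log]) (intro pser2 half_exp_2)
  also have "cong2 ((?L - ?L\<^sup>2)\<^sup>2) (?L\<^sup>2 + ?L ^ 4)"
    by (rule cong2I[of "- (?L ^ 3)"]) (auto simp: pser2 half_exp_2 power2_eq_square power3_eq_cube power4_eq_xxxx algebra_simps)
  finally have "bc (1 / 2) * (l\<^sup>2 - (?L\<^sup>2 + ?L ^ 4)) \<in> pser 2" by (simp add: cong2_iff)
  from pser2(1)[OF 1 this] show ?thesis by (simp add: algebra_simps)
qed

end

text \<open>
  Modulo 2-integral series, the dilogarithm defect at 2 is half of \<open>dilog_residue / (1 - g\<^sup>4)\<close>: the terms
  \<open>g\<^sup>2\<^sup>j\<close> contribute \<open>half_exp(l)\<^sup>2\<close> for odd \<open>j\<close> and \<open>half_exp(l)\<^sup>2 + half_exp(l)\<^sup>4\<close> for even \<open>j\<close>.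
\<close>

definition dilog_residue :: "bps \<Rightarrow> bps \<Rightarrow> rat \<Rightarrow> bps" where
  "dilog_residue g l e =
     g\<^sup>2 * (half_exp l)\<^sup>2 + g ^ 4 * ((half_exp l)\<^sup>2 + half_exp l ^ 4) + (if e = 1 then 0 else g\<^sup>2)"

text \<open>1 / (1 - g^4). Multiplied by g^2 it sums g^(2 j) over odd j, multiplied by g^4 over even
  j > 0.\<close>

definition geo4 :: "bps \<Rightarrow> bps" where "geo4 g = ps (Abs_fps (\<lambda>n. if 4 dvd n then 1 else 0)) g"

lemma geo4:
  assumes g1: "g \<in> xy_power 1" and gp: "g \<in> pser 2"
  shows "geo4 g \<in> pser 2" "(1 - g ^ 4) * geo4 g = 1"
  "g ^ 2 * geo4 g = ps (Abs_fps (\<lambda>n. if n mod 4 = 2 then 1 else 0)) g"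
  "g ^ 4 * geo4 g = ps (Abs_fps (\<lambda>n. if 4 dvd n \<and> n > 0 then 1 else 0)) g"
proof -
  let ?R = "Abs_fps (\<lambda>n. if 4 dvd n then 1 else 0) :: rat fps"
  show "geo4 g \<in> pser 2" unfolding geo4_def by (rule pser_ps[OF prime_2 g1 gp]) (simp add: prime_2)
  have 2: "fps_X ^ 2 * ?R = Abs_fps (\<lambda>n. if n mod 4 = 2 then 1 else 0)"
    by (rule fps_ext) (simp add: fps_X_power_mult_nth, presburger)
  have 4: "fps_X ^ 4 * ?R = Abs_fps (\<lambda>n. if 4 dvd n \<and> n > 0 then 1 else 0)"
    by (rule fps_ext) (simp add: fps_X_power_mult_nth, presburger)
  show "g ^ 2 * geo4 g = ps (Abs_fps (\<lambda>n. if n mod 4 = 2 then 1 else 0)) g"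
    by (simp add: geo4_def ps_mult[OF g1] ps_power[OF g1] ps_X[OF g1] flip: 2)
  show *: "g ^ 4 * geo4 g = ps (Abs_fps (\<lambda>n. if 4 dvd n \<and> n > 0 then 1 else 0)) g"
    by (simp add: geo4_def ps_mult[OF g1] ps_power[OF g1] ps_X[OF g1] flip: 4)
  have "?R - Abs_fps (\<lambda>n. if 4 dvd n \<and> n > 0 then 1 else 0) = 1"
    by (rule fps_ext) auto
  then have "ps (?R - Abs_fps (\<lambda>n. if 4 dvd n \<and> n > 0 then 1 else 0)) g = 1" by (simp add: ps_1[OF g1])
  then show "(1 - g ^ 4) * geo4 g = 1"
    by (simp add: ps_diff[OF g1] left_diff_distrib *) (simp add: geo4_def)
qed

context
  fixes g l :: bps and e :: rat
  assumes g1: "g \<in> xy_power 1" and gp: "g \<in> pser 2"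
    and l1: "l \<in> xy_power 1" and lp: "l \<in> pser 2"
    and e: "e = 1 \<or> e = - 1"
    and frob_g: "frob 2 g = bc e * g ^ 2 * pexp (- (2 * l))"
begin

lemma dilog_defect_even: "dilog_defect 2 g l - bc (1 / 2) * (dilog_residue g l e * geo4 g) \<in> pser 2"
proof -
  have e': "e = 1 \<or> e = - 1 \<and> (2::nat) = 2" using e by simp
  have fg: "frob 2 g = bc e * g ^ 2 * pexp (- (of_nat 2 * l))" using frob_g by simp
  note facts = prime_2 g1 gp l1 lp e' fg
  let ?L = "half_exp l"
  let ?r1 = "Abs_fps (\<lambda>n. if n mod 4 = 2 then 1 else 0) :: rat fps"
  let ?r2 = "Abs_fps (\<lambda>n. if 4 dvd n \<and> n > 0 then 1 else 0) :: rat fps"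
  \<comment> \<open>The expected half-integral parts are removed index by index: \<open>c1\<close>
    acts on the indices 2 j with j odd, \<open>c2\<close> on those with j even. The 1 in
    \<open>c1\<close> matches 1 / (2 j^2), which occurs when e = -1 and differs from 1 / 2 by an
    integral number.\<close>
  define c1 where "c1 = bc (- 1 / 2) * (?L\<^sup>2 + (if e = 1 then 0 else 1))"
  define c2 where "c2 = bc (- 1 / 2) * (?L\<^sup>2 + ?L ^ 4)"
  let ?T = "\<lambda>n. dilog_term 2 g l n + c1 * (bc (fps_nth ?r1 n) * g ^ n) + c2 * (bc (fps_nth ?r2 n) * g ^ n)"
  have "sums_to ?T (dilog_defect 2 g l + c1 * ps ?r1 g + c2 * ps ?r2 g)"
    by (intro sums_to_add sums_to_mult sums_to_ps g1 dilog_sums_to[OF prime_2 g1])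
  then have "dilog_defect 2 g l + c1 * ps ?r1 g + c2 * ps ?r2 g \<in> pser 2"
  proof (rule sums_to_pser[OF prime_2])
    fix n
    show "?T n \<in> pser 2"
    proof (cases "even n")
      case False
      then have "n mod 4 \<noteq> 2" "\<not> 4 dvd n" by presburger+
      then show ?thesis using dilog_term_nondvd[OF prime_2 gp, of n] False by simp
    next
      case True
      then obtain j where n: "n = 2 * j" by (elim evenE)
      show ?thesis
      proof (cases "j = 0")
        case True
        then show ?thesis using dilog_term_0 by (simp add: n pser2)
      next
        case False
        then have j: "j > 0" by simp
        let ?c = "ps (dilog_series (of_nat (2 * j))) l"
        note L = half_exp_2(1)[OF l1 lp]
        show ?thesis
        proof (cases "even j")
          case True
          then have "e ^ j = 1" using e by auto
          from dilog_term_mult(1)[OF facts j this] have dt: "dilog_term 2 g l n = g ^ n * ?c" by (simp only: n)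
          have "n mod 4 \<noteq> 2" "4 dvd n" "n > 0" using True n j by presburger+
          then have r: "fps_nth ?r1 n = 0" "fps_nth ?r2 n = 1" by simp_all
          have "?T n = g ^ n * (?c - bc (1 / 2) * (?L\<^sup>2 + ?L ^ 4))"
            unfolding r dt c2_def by (simp add: bc_uminus algebra_simps flip: minus_divide_left)
          then show ?thesis using dilog_series_even[OF l1 lp True j] by (simp only: pser2 gp)
        next
          case odd: False
          have "n mod 4 = 2" "\<not> 4 dvd n" using odd n by presburger+
          then have r: "fps_nth ?r1 n = 1" "fps_nth ?r2 n = 0" by simp_all
          show ?thesis
          proof (cases "e = 1")
            case True
            then have "e ^ j = 1" by simp
            from dilog_term_mult(1)[OF facts j this] have dt: "dilog_term 2 g l n = g ^ n * ?c" by (simp only: n)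
            have "?T n = g ^ n * (?c - bc (1 / 2) * ?L\<^sup>2)"
              unfolding r dt c1_def using True by (simp add: bc_uminus algebra_simps flip: minus_divide_left)
            then show ?thesis using dilog_series_odd[OF l1 lp odd] by (simp only: pser2 gp)
          next
            case False
            then have "e ^ j = - 1" using e odd by auto
            from dilog_term_mult(2)[OF facts j this refl]
            have dt: "dilog_term 2 g l n = g ^ n * (bc (1 / (2 * of_nat j ^ 2)) - ?c)" by (simp only: n)
            \<comment> \<open>\<open>?c\<close> enters with a minus sign here, so the two halves of
              L^2 add up instead of cancelling; the resulting L^2 is integral.\<close>
            have "?T n = g ^ n * (bc (1 / (2 * of_nat j ^ 2)) - bc (1 / 2) - (?c - bc (1 / 2) * ?L\<^sup>2) - ?L\<^sup>2)"
            proof -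
              have "bc (1 / 2) * ?L\<^sup>2 + bc (1 / 2) * ?L\<^sup>2 = ?L\<^sup>2"
                using bc_half(2)[of "?L\<^sup>2"] by (simp only: mult_2)
              then have *: "bc (1 / 2) * ?L\<^sup>2 - ?L\<^sup>2 = - (bc (1 / 2) * ?L\<^sup>2)" by (simp add: algebra_simps)
              have "?T n = g ^ n * (bc (1 / (2 * of_nat j ^ 2)) - ?c + (- (bc (1 / 2) * ?L\<^sup>2)) - bc (1 / 2))"
                unfolding r dt c1_def using False by (simp add: bc_uminus algebra_simps flip: minus_divide_left)
              then show ?thesis unfolding *[symmetric] by (simp add: algebra_simps)
            qed
            moreover have "bc (1 / (2 * of_nat j ^ 2)) - bc (1 / 2) \<in> pser 2"
            proof -
              have "even (1 - int j ^ 2)" using odd by simp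
              then obtain i where i: "1 - int j ^ 2 = 2 * i" by (elim evenE)
              then have "(of_int (1 - int j ^ 2) :: rat) = of_int (2 * i)" by simp
              then have i': "1 - (of_nat j ^ 2 :: rat) = 2 * of_int i" by simp
              have "1 / (2 * of_nat j ^ 2) - 1 / 2 = (1 - of_nat j ^ 2) / (2 * of_nat j ^ 2 :: rat)"
                using j by (simp add: field_simps)
              also have "\<dots> = of_int i * (1 / of_nat j)\<^sup>2" unfolding i' by (simp add: power_divide)
              also have "\<dots> \<in> pint 2"
                using odd by (intro pint_mult pint_power pint_inverse_nat pint_of_int prime_2) auto
              finally show ?thesis using pser2(7) by (simp flip: bc_diff)
            qed
            ultimately show ?thesis using dilog_series_odd[OF l1 lp odd]
              by (simp only: pser2 gp L)
          qed
        qed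
      qed
    qed
  qed
  moreover have "c1 * ps ?r1 g + c2 * ps ?r2 g = - (bc (1 / 2) * (dilog_residue g l e * geo4 g))"
    unfolding geo4(3,4)[OF g1 gp, symmetric] c1_def c2_def dilog_residue_def
    by (simp add: bc_uminus algebra_simps flip: minus_divide_left)
  ultimately show ?thesis by (simp add: add.assoc)
qed

end

text \<open>If A is the logarithm of a p-integral series with constant term 1, this is p-integral by
  Dwork's lemma, although A itself need not be. It is additive, so a step changes it by an integer
  multiple of an integral series.\<close>

definition ell :: "nat \<Rightarrow> bps \<Rightarrow> bps" where
  "ell p A = A - bc (1 / of_nat p) * frob p A"

lemma ell_linear:
  assumes p: "prime p"
  shows "ell p (A + B) = ell p A + ell p B" "ell p (A - B) = ell p A - ell p B"
    "ell p (bc c * A) = bc c * ell p A" "ell p (of_nat n * A) = of_nat n * ell p A"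
    "A \<in> xy_power k \<Longrightarrow> ell p A \<in> xy_power k"
proof -
  show 1: "ell p (bc c * A) = bc c * ell p A" for c
    by (simp add: ell_def frob_linear[OF p] right_diff_distrib mult.left_commute)
  show "ell p (of_nat n * A) = of_nat n * ell p A" using 1[of "of_nat n"] by (simp add: bc_of_nat)
  show "A \<in> xy_power k \<Longrightarrow> ell p A \<in> xy_power k"
    unfolding ell_def by (rule xy_power_diff[OF _ xy_power_cmult]) (auto intro: frob_linear(3)[OF p])
qed (simp_all add: ell_def frob_linear[OF p] algebra_simps)

section \<open>Additivity of \<open>half_exp\<close> modulo 2\<close>

lemma mult_2_cancel: "2 * x = 2 * y \<Longrightarrow> x = (y :: bps)"
  by (metis bc_half(1))

lemma half_exp_add:
  assumes A: "A \<in> xy_power 1" and B: "B \<in> xy_power 1"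
  shows "half_exp (A + B) = half_exp A + half_exp B + 2 * half_exp A * half_exp B"
proof -
  have "A + B \<in> xy_power 1" "2 * A \<in> xy_power 1" "2 * B \<in> xy_power 1"
    using A B by (auto intro: xy_power_add xy_power_mult_left)
  then have "1 + 2 * half_exp (A + B) = (1 + 2 * half_exp A) * (1 + 2 * half_exp B)"
    unfolding half_exp[OF A] half_exp[OF B] by (simp add: half_exp pexp_add distrib_left del: One_nat_def)
  then show ?thesis by - (rule mult_2_cancel, simp add: algebra_simps)
qed

lemma half_exp_0: "half_exp 0 = 0"
  using half_exp[of 0] by simp

lemma half_exp_add_cong2:
  assumes "A \<in> xy_power 1" "A \<in> pser 2" "B \<in> xy_power 1" "B \<in> pser 2"
  shows "cong2 (half_exp (A + B)) (half_exp A + half_exp B)"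
  using half_exp_add[OF assms(1,3)] half_exp_2(1)[OF assms(1,2)] half_exp_2(1)[OF assms(3,4)]
  by (intro cong2I[of "half_exp A * half_exp B"] pser2) (auto simp: algebra_simps)

lemma half_exp_of_int_cong2:
  assumes A: "A \<in> xy_power 1" "A \<in> pser 2"
  shows "cong2 (half_exp (of_int n * A)) (of_int n * half_exp A)"
proof -
  have nat: "cong2 (half_exp (of_nat k * A)) (of_nat k * half_exp A)" for k
  proof (induction k)
    case 0
    show ?case by (simp add: half_exp_0 cong2_refl)
  next
    case (Suc k)
    have "cong2 (half_exp (A + of_nat k * A)) (half_exp A + half_exp (of_nat k * A))"
      by (intro half_exp_add_cong2 A xy_power_mult_left pser2)
    also have "cong2 (half_exp A + half_exp (of_nat k * A)) (half_exp A + of_nat k * half_exp A)"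
      by (intro cong2_add cong2_refl Suc.IH)
    finally show ?case by (simp add: algebra_simps)
  qed
  show ?thesis
  proof (cases "n \<ge> 0")
    case True
    then show ?thesis using nat[of "nat n"] by (simp add: of_nat_nat)
  next
    case False
    define k where "k = nat (- n)"
    have n: "n = - int k" using False by (simp add: k_def)
    have k: "of_nat k * A \<in> xy_power 1" "of_nat k * A \<in> pser 2" "- (of_nat k * A) \<in> xy_power 1" "- (of_nat k * A) \<in> pser 2"
      using A by (auto intro: xy_power_mult_left xy_power_uminus pser2)
    from half_exp_add_cong2[OF this] have "cong2 0 (half_exp (of_nat k * A) + half_exp (- (of_nat k * A)))" by (simp add: half_exp_0)
    then have "cong2 (half_exp (of_nat k * A) + half_exp (- (of_nat k * A))) 0" by (rule cong2_sym)
    from cong2_diff[OF this nat[of k]]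
    have "cong2 (half_exp (- (of_nat k * A))) (- (of_nat k * half_exp A))" by simp
    then show ?thesis by (simp add: n)
  qed
qed

context
  fixes g l :: bps and e :: rat
  assumes g1: "g \<in> xy_power 1" and gp: "g \<in> pser 2"
    and l1: "l \<in> xy_power 1" and lp: "l \<in> pser 2"
    and e: "e = 1 \<or> e = - 1"
    and frob_g: "frob 2 g = bc e * g ^ 2 * pexp (- (2 * l))"
begin

lemma ell_Ln: "ell 2 (Ln g) \<in> pser 2" "ell 2 (Ln g) \<in> xy_power 1"
  using Ln_pser[OF prime_2 g1 gp l1 lp, of e] e frob_g ell_linear(5)[OF prime_2 Ln_in_xy_power[OF g1]]
  by (auto simp: ell_def)

text \<open>With K for the \<open>half_exp\<close> on the left and L for \<open>half_exp l\<close>,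
  exponentiating 2 log(1 - g) - log(1 - F(g)) gives (1 + 2 K) (1 - F(g)) = (1 - g)^2. Multiplying by
  1 + 2 L turns F(g) into e g^2, and then a factor 2 cancels.\<close>

lemma half_exp_ell_Ln:
  "half_exp (ell 2 (Ln g)) * (1 + 2 * half_exp l - bc e * g\<^sup>2) =
    (if e = 1 then g\<^sup>2 else 0) - g + g\<^sup>2 * half_exp l - 2 * g * half_exp l"
proof -
  let ?K = "half_exp (ell 2 (Ln g))" and ?L = "half_exp l"
  have f1: "frob 2 g \<in> xy_power 1" by (rule frob_linear(3)[OF prime_2 g1])
  have Ln1: "Ln g \<in> xy_power 1" "Ln (frob 2 g) \<in> xy_power 1"
    using Ln_in_xy_power g1 f1 by auto
  have fLn: "frob 2 (Ln g) = Ln (frob 2 g)" by (simp add: Ln_def frob_ps[OF prime_2 g1])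
  have "2 * ell 2 (Ln g) + Ln (frob 2 g) = Ln g + Ln g"
    by (simp add: ell_def fLn bc_half right_diff_distrib)
  moreover have "pexp (2 * ell 2 (Ln g) + Ln (frob 2 g)) = (1 + 2 * ?K) * (1 - frob 2 g)"
    by (subst pexp_add) (simp_all add: half_exp pexp_Ln1 f1 Ln1 ell_Ln xy_power_mult_left del: One_nat_def)
  moreover have "pexp (Ln g + Ln g) = (1 - g)\<^sup>2"
    by (subst pexp_add) (simp_all add: pexp_Ln1 g1 Ln1 power2_eq_square del: One_nat_def)
  ultimately have "(1 + 2 * ?K) * (1 - frob 2 g) = (1 - g)\<^sup>2" by simp
  then have "(1 + 2 * ?K) * (1 - frob 2 g) * (1 + 2 * ?L) = (1 - g)\<^sup>2 * (1 + 2 * ?L)" by simp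
  moreover have "(1 - frob 2 g) * (1 + 2 * ?L) = 1 + 2 * ?L - bc e * g\<^sup>2"
  proof -
    have "frob 2 g * (1 + 2 * ?L) = bc e * g\<^sup>2 * (pexp (- (2 * l)) * (1 + 2 * ?L))"
      unfolding frob_g by (simp only: mult.assoc)
    also have "\<dots> = bc e * g\<^sup>2" using pexp_uminus_half(1)[OF l1 lp] by simp
    finally show ?thesis by (simp add: left_diff_distrib)
  qed
  ultimately have *: "(1 + 2 * ?K) * (1 + 2 * ?L - bc e * g\<^sup>2) = (1 - g)\<^sup>2 * (1 + 2 * ?L)"
    by (simp only: mult.assoc)
  show ?thesis
  proof (cases "e = 1")
    case True
    show ?thesis by (rule mult_2_cancel) (use * True in \<open>simp add: algebra_simps power2_eq_square\<close>)
  next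
    case False
    then have "e = - 1" using e by simp
    then show ?thesis by - (rule mult_2_cancel, use * in \<open>simp add: bc_uminus algebra_simps power2_eq_square\<close>)
  qed
qed

text \<open>The purpose is to eliminate g in favour of \<open>half_exp\<close> values, which are
  additive modulo 2. The factor d multiplying K in \<open>half_exp_ell_Ln\<close> satisfies d^2 = 1
  - g^4 modulo 2, so \<open>geo4 g\<close> acts as division by d^2, while K d is congruent to a
  polynomial D in g and L.\<close>

lemma dilog_residue_cong2:
  fixes K defines "K \<equiv> half_exp (ell 2 (Ln g))"
  shows "cong2 (dilog_residue g l e * geo4 g) ((half_exp l)\<^sup>2 * K\<^sup>2 + (if e = 1 then 0 else K\<^sup>2))"
proof -
  define L where "L = half_exp l"
  have Kp: "K \<in> pser 2" unfolding K_def by (rule half_exp_2[OF ell_Ln(2,1)])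
  have Lp: "L \<in> pser 2" unfolding L_def by (rule half_exp_2[OF l1 lp])
  note P = pser2 Kp Lp gp geo4(1)[OF g1 gp]
  define T where "T = L\<^sup>2 + (if e = 1 then 0 else 1)"
  have Tp: "T \<in> pser 2" by (simp add: T_def P)
  define d where "d = 1 + 2 * L - bc e * g\<^sup>2"
  define D where "D = (if e = 1 then g\<^sup>2 else 0) + g + g\<^sup>2 * L"
  have ep: "bc e \<in> pser 2" using e by (auto simp: bc_uminus P)
  have dp: "d \<in> pser 2" "D \<in> pser 2" by (simp_all add: d_def D_def P ep)
  have "K * d - D = 2 * (- g - g * L)"
    using half_exp_ell_Ln by (simp add: K_def d_def D_def L_def algebra_simps)
  then have Kd: "cong2 (K * d) D" by (rule cong2I[rotated]) (intro P)
  have "cong2 (1 - g ^ 4) (d\<^sup>2)"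
    using e by (intro cong2I[of "- (g ^ 4) + bc e * g\<^sup>2 - 2 * L + 2 * L * bc e * g\<^sup>2 - 2 * L\<^sup>2"])
      (auto simp: P d_def bc_uminus power2_eq_square power4_eq_xxxx algebra_simps)
  then have "cong2 ((1 - g ^ 4) * (K\<^sup>2 * T)) (d\<^sup>2 * (K\<^sup>2 * T))"
    by (intro cong2_mult cong2_refl) (auto simp: P Tp)
  also have "d\<^sup>2 * (K\<^sup>2 * T) = (K * d)\<^sup>2 * T" by (simp add: power_mult_distrib mult_ac)
  also have "cong2 ((K * d)\<^sup>2 * T) (D\<^sup>2 * T)"
    by (intro cong2_mult cong2_refl cong2_power2 Kd) (auto simp: P Tp dp)
  also have "cong2 (D\<^sup>2 * T) (dilog_residue g l e)"
  proof (cases "e = 1")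
    case True
    have "D\<^sup>2 * T - dilog_residue g l e = 2 * ((g ^ 3 + g ^ 4 * L + g ^ 3 * L) * L\<^sup>2)"
      using True by (simp add: D_def T_def dilog_residue_def power2_eq_square power3_eq_cube power4_eq_xxxx algebra_simps flip: L_def)
    then show ?thesis by (rule cong2I[rotated]) (intro P)
  next
    case False
    have "D\<^sup>2 * T - dilog_residue g l e = 2 * (g ^ 3 * L * (L\<^sup>2 + 1))"
      using False by (simp add: D_def T_def dilog_residue_def power2_eq_square power3_eq_cube power4_eq_xxxx algebra_simps flip: L_def)
    then show ?thesis by (rule cong2I[rotated]) (intro P)
  qed
  finally have "cong2 ((1 - g ^ 4) * (K\<^sup>2 * T)) (dilog_residue g l e)" .
  then have "cong2 (geo4 g * ((1 - g ^ 4) * (K\<^sup>2 * T))) (geo4 g * dilog_residue g l e)"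
    by (rule cong2_mult_left) (intro P)
  also have "geo4 g * ((1 - g ^ 4) * (K\<^sup>2 * T)) = ((1 - g ^ 4) * geo4 g) * (K\<^sup>2 * T)" by (simp only: mult_ac)
  also have "\<dots> = L\<^sup>2 * K\<^sup>2 + (if e = 1 then 0 else K\<^sup>2)"
    unfolding geo4(2)[OF g1 gp] by (simp add: T_def algebra_simps)
  finally show ?thesis unfolding L_def mult.commute[of "geo4 g"] by (rule cong2_sym)
qed

end

text \<open>z Y / 2 and - m a b z^2 lG^2 / 2 are the half-integral contributions of one step to
  \<open>frob_defect\<close>, and m ((U' V')^2 - (U V)^2) / 2 is the change of
  \<open>frob_correction\<close>; they have to cancel. Modulo 2 signs disappear, and the integers z,
  m and m a b may be replaced by their squares.\<close>

lemma correction_cong2: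
  fixes A B lG Y :: bps and m a b :: nat and z :: int
  assumes A: "A \<in> xy_power 1" "A \<in> pser 2" and B: "B \<in> xy_power 1" "B \<in> pser 2"
    and G: "lG \<in> xy_power 1" "lG \<in> pser 2"
  defines "K \<equiv> half_exp lG" and "La \<equiv> half_exp (of_nat (m * a) * A + of_nat (m * b) * B)"
    and "U \<equiv> half_exp A" and "V \<equiv> half_exp B"
    and "U' \<equiv> half_exp (A - of_int (int b * z) * lG)" and "V' \<equiv> half_exp (B + of_int (int a * z) * lG)"
  assumes Y: "cong2 Y (La\<^sup>2 * K\<^sup>2 + of_nat (m * a * b) * K\<^sup>2)"
  shows "cong2 (of_int z * Y - of_int (int (m * a * b) * z\<^sup>2) * lG\<^sup>2 - of_nat m * ((U' * V')\<^sup>2 - (U * V)\<^sup>2)) 0"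
proof -
  define C where "C = (of_int z :: bps)"
  define M where "M = (of_nat m :: bps)" 
  define a' where "a' = (of_nat a :: bps)"
  define b' where "b' = (of_nat b :: bps)"
  have Kp: "K \<in> pser 2" and Up: "U \<in> pser 2" and Vp: "V \<in> pser 2"
    unfolding K_def U_def V_def by (intro half_exp_2 A B G)+
  have zp: "C \<in> pser 2" "M \<in> pser 2" "a' \<in> pser 2" "b' \<in> pser 2"
    unfolding C_def M_def a'_def b'_def by (intro pser2)+
  note P = pser2 Kp Up Vp zp
  have CC: "cong2 (C\<^sup>2 * x) (C * x)" if "x \<in> pser 2" for x
    using cong2_of_int[of "z\<^sup>2" z x] that by (simp add: C_def)
  have MM: "cong2 (M * x) (M\<^sup>2 * x)" if "x \<in> pser 2" for x
    using cong2_of_int[of "int m" "(int m)\<^sup>2" x] that by (simp add: M_def)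
  have NN: "cong2 ((M * a' * b')\<^sup>2 * x) (M * a' * b' * x)" if "x \<in> pser 2" for x
    using cong2_of_int[of "(int (m * a * b))\<^sup>2" "int (m * a * b)" x] that by (simp add: M_def a'_def b'_def)
  have U': "cong2 U' (U - b' * C * K)"
  proof -
    have "cong2 (half_exp (A + of_int (- (int b * z)) * lG)) (half_exp A + half_exp (of_int (- (int b * z)) * lG))"
      by (intro half_exp_add_cong2 A G xy_power_mult_left pser2)
    also have "cong2 \<dots> (half_exp A + of_int (- (int b * z)) * half_exp lG)"
      by (intro cong2_add cong2_refl half_exp_of_int_cong2 G)
    finally show ?thesis by (simp add: U'_def U_def K_def b'_def C_def)
  qed
  have V': "cong2 V' (V + a' * C * K)"
  proof -
    have "cong2 (half_exp (B + of_int (int a * z) * lG)) (half_exp B + half_exp (of_int (int a * z) * lG))"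
      by (intro half_exp_add_cong2 B G xy_power_mult_left pser2)
    also have "cong2 \<dots> (half_exp B + of_int (int a * z) * half_exp lG)"
      by (intro cong2_add cong2_refl half_exp_of_int_cong2 G)
    finally show ?thesis by (simp add: V'_def V_def K_def a'_def C_def)
  qed
  have La: "cong2 La (M * a' * U + M * b' * V)"
  proof -
    have "cong2 (half_exp (of_int (int (m * a)) * A + of_int (int (m * b)) * B))
      (half_exp (of_int (int (m * a)) * A) + half_exp (of_int (int (m * b)) * B))"
      by (intro half_exp_add_cong2 A B xy_power_mult_left pser2)
    also have "cong2 \<dots> (of_int (int (m * a)) * half_exp A + of_int (int (m * b)) * half_exp B)"
      by (intro cong2_add half_exp_of_int_cong2 A B)
    finally show ?thesis by (simp add: La_def U_def V_def M_def a'_def b'_def)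
  qed
  have Lap: "La \<in> pser 2" by (rule cong2_pser[OF La]) (intro P)
  \<comment> \<open>The change of U V under the step, modulo 2. Squaring is additive modulo 2, so
    d^2 is the change of (U V)^2; replacing M by M^2 makes it enough to know M d.\<close>
  define d where "d = (U - b' * C * K) * (V + a' * C * K) - U * V"
  have dp: "d \<in> pser 2" unfolding d_def by (intro P)
  have Md: "cong2 (M * d) (C * (K * La) + M * a' * b' * C\<^sup>2 * K\<^sup>2)"
  proof -
    have "M * d - (C * (K * (M * a' * U + M * b' * V)) + M * a' * b' * C\<^sup>2 * K\<^sup>2) =
      2 * (- (C * K * M * b' * V) - M * a' * b' * C\<^sup>2 * K\<^sup>2)"
      by (simp add: d_def algebra_simps power2_eq_square)
    then have "cong2 (M * d) (C * (K * (M * a' * U + M * b' * V)) + M * a' * b' * C\<^sup>2 * K\<^sup>2)"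
      by (rule cong2I[rotated]) (intro P)
    also have "cong2 \<dots> (C * (K * La) + M * a' * b' * C\<^sup>2 * K\<^sup>2)"
      by (intro cong2_add cong2_refl cong2_mult_left cong2_sym[OF La] P)
    finally show ?thesis .
  qed
  have 1: "cong2 (M * ((U' * V')\<^sup>2 - (U * V)\<^sup>2)) (C * (K\<^sup>2 * La\<^sup>2) + M * a' * b' * C * K ^ 4)"
  proof -
    have "cong2 (U' * V') ((U - b' * C * K) * (V + a' * C * K))"
      by (intro cong2_mult U' V') (auto intro!: P cong2_pser[OF U'])
    then have "cong2 (M * ((U' * V')\<^sup>2 - (U * V)\<^sup>2)) (M * (((U - b' * C * K) * (V + a' * C * K))\<^sup>2 - (U * V)\<^sup>2))"
      by (intro cong2_mult_left cong2_diff cong2_refl cong2_power2 P)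
    also have "cong2 (M * (((U - b' * C * K) * (V + a' * C * K))\<^sup>2 - (U * V)\<^sup>2)) (M * d\<^sup>2)"
    proof (rule cong2I)
      have "((U - b' * C * K) * (V + a' * C * K)) = U * V + d" by (simp add: d_def)
      then show "M * (((U - b' * C * K) * (V + a' * C * K))\<^sup>2 - (U * V)\<^sup>2) - M * d\<^sup>2 = 2 * (M * (U * V) * d)"
        by (simp add: power2_eq_square algebra_simps)
    qed (intro P dp)
    also have "cong2 (M * d\<^sup>2) (M\<^sup>2 * d\<^sup>2)" by (rule MM) (intro P dp)
    also have "M\<^sup>2 * d\<^sup>2 = (M * d)\<^sup>2" by (simp add: power_mult_distrib)
    also have "cong2 ((M * d)\<^sup>2) ((C * (K * La) + M * a' * b' * C\<^sup>2 * K\<^sup>2)\<^sup>2)"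
      by (intro cong2_power2 Md P Lap)
    also have "cong2 \<dots> (C\<^sup>2 * (K\<^sup>2 * La\<^sup>2) + (M * a' * b')\<^sup>2 * (C\<^sup>2 * (C\<^sup>2 * K ^ 4)))"
      by (rule cong2I[of "C * (K * La) * (M * a' * b' * C\<^sup>2 * K\<^sup>2)"])
        (auto intro!: P Lap simp: power2_eq_square power4_eq_xxxx algebra_simps)
    also have "cong2 \<dots> (C * (K\<^sup>2 * La\<^sup>2) + M * a' * b' * (C\<^sup>2 * (C\<^sup>2 * K ^ 4)))"
      by (intro cong2_add CC NN P Lap)
    also have "cong2 \<dots> (C * (K\<^sup>2 * La\<^sup>2) + M * a' * b' * (C\<^sup>2 * (C * K ^ 4)))"
      by (intro cong2_add cong2_refl cong2_mult_left CC P)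
    also have "\<dots> = C * (K\<^sup>2 * La\<^sup>2) + M * a' * b' * (C * (C\<^sup>2 * K ^ 4))"
      by (simp only: mult_ac)
    also have "cong2 \<dots> (C * (K\<^sup>2 * La\<^sup>2) + M * a' * b' * (C * (C * K ^ 4)))"
      by (intro cong2_add cong2_refl cong2_mult_left CC P)
    also have "\<dots> = C * (K\<^sup>2 * La\<^sup>2) + M * a' * b' * (C\<^sup>2 * K ^ 4)"
      by (simp only: mult_ac power2_eq_square)
    also have "cong2 \<dots> (C * (K\<^sup>2 * La\<^sup>2) + M * a' * b' * (C * K ^ 4))"
      by (intro cong2_add cong2_refl cong2_mult_left CC P)
    finally show ?thesis by (simp only: mult.assoc)
  qed
  have 2: "cong2 (of_int (int (m * a * b) * z\<^sup>2) * lG\<^sup>2) (M * a' * b' * C * (K\<^sup>2 + K ^ 4))"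
  proof -
    have "of_int (int (m * a * b) * z\<^sup>2) * lG\<^sup>2 = M * a' * b' * (C\<^sup>2 * lG\<^sup>2)"
      by (simp add: M_def a'_def b'_def C_def)
    also have "cong2 \<dots> (M * a' * b' * (C * lG\<^sup>2))"
      by (intro cong2_mult_left CC P G)
    also have "cong2 \<dots> (M * a' * b' * (C * ((K - K\<^sup>2)\<^sup>2)))"
      unfolding K_def by (intro cong2_mult_left cong2_power2 half_exp_log G P half_exp_2)
    also have "cong2 \<dots> (M * a' * b' * (C * (K\<^sup>2 + K ^ 4)))"
      by (intro cong2_mult_left P cong2I[of "- (K ^ 3)"])
        (simp add: power2_eq_square power3_eq_cube power4_eq_xxxx algebra_simps)
    finally show ?thesis by (simp only: mult.assoc)
  qed
  have "cong2 (of_int z * Y - of_int (int (m * a * b) * z\<^sup>2) * lG\<^sup>2 - of_nat m * ((U' * V')\<^sup>2 - (U * V)\<^sup>2))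
    (C * (La\<^sup>2 * K\<^sup>2 + of_nat (m * a * b) * K\<^sup>2) - M * a' * b' * C * (K\<^sup>2 + K ^ 4) - (C * (K\<^sup>2 * La\<^sup>2) + M * a' * b' * C * K ^ 4))"
    using cong2_mult_left[OF Y zp(1)] 1 2 unfolding C_def[symmetric] M_def[symmetric]
    by (intro cong2_diff) auto
  \<comment> \<open>Everything cancels except two equal terms in \<open>K ^ 4\<close>, with total
    coefficient -2.\<close>
  also have "cong2 \<dots> 0"
    by (rule cong2I[of "- (M * a' * b' * C * K ^ 4)"]) (auto intro!: P simp: M_def a'_def b'_def algebra_simps)
  finally show ?thesis .
qed

section \<open>Integrality of products of cluster automorphisms\<close>

definition cluster :: "nat \<Rightarrow> bps \<Rightarrow> bps \<Rightarrow> nat \<Rightarrow> nat \<Rightarrow> bps" where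
  "cluster m L M a b =
     bc ((- 1) ^ (m * a * b)) * (bX ^ a * bY ^ b) * pexp (of_nat (m * a) * L + of_nat (m * b) * M)"

text \<open>
  A triple \<open>(L, M, S)\<close> stands for the automorphism \<open>x \<mapsto> x e\<^sup>m\<^sup>L\<close>, \<open>y \<mapsto> y e\<^sup>m\<^sup>M\<close> together with its generating
  function; a step composes it on the right with \<open>T\<^sub>a\<^sub>,\<^sub>b\<^sup>c\<close>, and \<open>cluster\<close> is the image of \<open>(-1)\<^sup>m\<^sup>a\<^sup>b x\<^sup>a y\<^sup>b\<close> under it.
\<close>

fun step :: "nat \<Rightarrow> nat \<times> nat \<times> rat \<Rightarrow> bps \<times> bps \<times> bps \<Rightarrow> bps \<times> bps \<times> bps" where
  "step m (a, b, c) (L, M, S) =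
     (let g = cluster m L M a b; G = Ln g in
       (L - bc (of_nat b * c) * G, M + bc (of_nat a * c) * G,
        S + bc c * Li2 g - bc (of_nat (m * a * b) * c\<^sup>2 / 2) * G\<^sup>2 + bc (of_nat (m * a) * c) * L * G))"

definition frob_defect :: "nat \<Rightarrow> nat \<Rightarrow> bps \<Rightarrow> bps \<Rightarrow> bps \<Rightarrow> bps" where
  "frob_defect p m L M S =
     S - bc (1 / of_nat p ^ 2) * frob p S - bc (of_nat m / of_nat p) * frob p L * ell p M"

text \<open>
  At \<open>p = 2\<close> the defect of a product of integral powers is only half-integral; this term, found by
  computing modulo 2, restores integrality. It does not affect leading terms.
\<close>

definition frob_correction :: "nat \<Rightarrow> nat \<Rightarrow> bps \<Rightarrow> bps \<Rightarrow> bps" where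
  "frob_correction p m L M =
     (if p = 2 then bc (of_nat m / 2) * (half_exp (ell 2 L) * half_exp (ell 2 M))\<^sup>2 else 0)"

text \<open>The invariant of the induction over the factors. L and M are logarithms and may have
  denominators; integrality is required of their exponentials and of their images under
  \<open>ell p\<close>.\<close>

definition integral_state :: "nat \<Rightarrow> nat \<Rightarrow> bps \<times> bps \<times> bps \<Rightarrow> bool" where
  "integral_state p m = (\<lambda>(L, M, S). L \<in> xy_power 1 \<and> M \<in> xy_power 1 \<and>
     pexp L \<in> pser p \<and> pexp (- L) \<in> pser p \<and> pexp M \<in> pser p \<and> pexp (- M) \<in> pser p \<and>
     ell p L \<in> pser p \<and> ell p M \<in> pser p \<and>
     frob_defect p m L M S - frob_correction p m L M \<in> pser p)"

lemma gbinomial_of_int_Ints: "(of_int z gchoose n :: rat) \<in> \<int>"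
proof (cases "z \<ge> 0")
  case True
  then have "(of_int z gchoose n :: rat) = of_nat (nat z choose n)" by (simp add: binomial_gbinomial)
  then show ?thesis by simp
next
  case False
  define k where "k = nat (- z)"
  have z: "z = - int k" "k > 0" using False by (simp_all add: k_def)
  have "(of_int z gchoose n :: rat) = (- 1) ^ n * ((of_nat k + of_nat n - 1) gchoose n)"
    using gbinomial_minus[of "of_nat k :: rat" n] z by simp
  also have "(of_nat k + of_nat n - 1 :: rat) = of_nat (k + n - 1)" using z by (simp add: of_nat_diff)
  finally show ?thesis by (simp flip: binomial_gbinomial)
qed

lemma pexp_Ln_pser:
  assumes p: "prime p" and g: "g \<in> xy_power 1" "g \<in> pser p"
  shows "pexp (bc (of_int z) * Ln g) \<in> pser p"
  unfolding pexp_Ln[OF g(1)]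
proof (rule pser_ps[OF p])
  fix n
  have "(of_int z gchoose n :: rat) \<in> \<int>" by (rule gbinomial_of_int_Ints)
  then show "fps_nth (fps_binomial (of_int z)) n \<in> pint p"
    using pint_of_int[OF p] by (auto elim!: Ints_cases)
qed (use g p in \<open>auto intro: xy_power_uminus pser_uminus\<close>)

lemma cluster_xy_power:
  "cluster m L M a b \<in> xy_power (a + b)"
  unfolding cluster_def by (intro xy_power_mult_right xy_power_cmult monom_in_xy_power)

lemma cluster_pser:
  assumes p: "prime p" and L1: "L \<in> xy_power 1" and M1: "M \<in> xy_power 1"
    and eL: "pexp L \<in> pser p" and eM: "pexp M \<in> pser p"
  shows "cluster m L M a b \<in> pser p"
proof -
  have "pexp (of_nat (m * a) * L + of_nat (m * b) * M) = pexp L ^ (m * a) * pexp M ^ (m * b)"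
    by (subst pexp_add) (simp_all only: pexp_of_nat[OF L1] pexp_of_nat[OF M1] xy_power_mult_left L1 M1)
  then show ?thesis
    unfolding cluster_def by (simp only: pser_intros[OF p] pint_sign[OF p] eL eM)
qed

text \<open>F maps e^t to e^(F(t)), and F(t) = p t - p \<open>ell p t\<close>. The sign is fixed by
  F but raised to the power p on the right: no change for odd p, while for p = 2 it is lost and has
  to be restored by e.\<close>

lemma frob_cluster:
  fixes e :: rat and m a b :: nat
  assumes p: "prime p" and L1: "L \<in> xy_power 1" and M1: "M \<in> xy_power 1"
  defines "e \<equiv> (if p = 2 then (- 1) ^ (m * a * b) else 1)"
  shows "frob p (cluster m L M a b) = bc e * cluster m L M a b ^ p *
    pexp (- (of_nat p * (of_nat (m * a) * ell p L + of_nat (m * b) * ell p M)))"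
proof -
  let ?t = "of_nat (m * a) * L + of_nat (m * b) * M"
  let ?l = "of_nat (m * a) * ell p L + of_nat (m * b) * ell p M"
  let ?s = "(- 1) ^ (m * a * b) :: rat"
  have p0: "(of_nat p :: rat) \<noteq> 0" using prime_gt_0_nat[OF p] by simp
  have l: "?l = ell p ?t" by (simp only: ell_linear[OF p])
  have t1: "?t \<in> xy_power 1" by (intro xy_power_add xy_power_mult_left L1 M1)
  have l1: "?l \<in> xy_power 1" unfolding l by (rule ell_linear(5)[OF p t1])
  have "of_nat p * ?t + (- (of_nat p * ?l)) = bc (of_nat p) * (bc (1 / of_nat p) * frob p ?t)"
    unfolding l by (simp only: ell_def right_diff_distrib bc_of_nat) simp
  also have "\<dots> = frob p ?t" using p0 by (simp flip: mult.assoc bc_mult)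
  finally have t: "of_nat p * ?t + (- (of_nat p * ?l)) = frob p ?t" .
  have "pexp ?t ^ p * pexp (- (of_nat p * ?l)) = pexp (frob p ?t)"
    by (subst t[symmetric], subst pexp_add)
      (simp_all only: pexp_of_nat[OF t1] xy_power_mult_left t1 l1 xy_power_uminus)
  also have "\<dots> = frob p (pexp ?t)" by (simp only: pexp_def frob_ps[OF p t1])
  finally have f: "frob p (pexp ?t) = pexp ?t ^ p * pexp (- (of_nat p * ?l))" by simp
  have "e * ?s ^ p = ?s"
  proof (cases "p = 2")
    case True
    then show ?thesis by (simp add: e_def power2_eq_square flip: power_add)
  next
    case False
    then have "odd p" using p prime_odd_nat[of p] prime_gt_1_nat[of p] by linarith
    then have "?s ^ p = ?s" by (cases "even (m * a * b)") simp_all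
    then show ?thesis using False by (simp add: e_def)
  qed
  then have s: "bc ?s = bc e * bc ?s ^ p" by (metis bc_mult bc_power)
  have "(bX ^ a * bY ^ b) ^ p = frob p (bX ^ a * bY ^ b)"
    unfolding frob_monom[OF p] by (simp add: power_mult_distrib mult.commute[of p] flip: power_mult)
  then have "frob p (cluster m L M a b) = bc ?s * ((bX ^ a * bY ^ b) ^ p * frob p (pexp ?t))"
    unfolding cluster_def mult.assoc[of "bc _"] frob_linear(2)[OF p]
    by (simp only: frob_hom(1)[OF p, of "bX ^ a * bY ^ b"])
  also have "\<dots> = bc e * cluster m L M a b ^ p * pexp (- (of_nat p * ?l))"
    unfolding f by (subst s) (simp add: cluster_def power_mult_distrib mult_ac)
  finally show ?thesis .
qed

text \<open>Substitute G = lG + F(G) / p. The cross term in L G leaves one in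
  \<open>ell p L * lG\<close> and one in F(G) \<open>ell p L\<close> / p; the latter joins a term in
  F(G) \<open>ell p M\<close> / p from the subtracted product to form F(G) l / p, the last summand
  of \<open>dilog_defect\<close>.\<close>

lemma frob_defect_step:
  fixes L M S g l :: bps and m a b :: nat
  assumes p: "prime p"
  defines "lG \<equiv> ell p (Ln g)" and "G \<equiv> Ln g" and "l \<equiv> of_nat (m * a) * ell p L + of_nat (m * b) * ell p M"
  shows "frob_defect p m (L - bc (of_nat b * c) * G) (M + bc (of_nat a * c) * G)
      (S + bc c * Li2 g - bc (of_nat (m * a * b) * c\<^sup>2 / 2) * G\<^sup>2 + bc (of_nat (m * a) * c) * L * G) =
    frob_defect p m L M S + bc c * dilog_defect p g l + bc (of_nat (m * a) * c) * ell p L * lG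
      - bc (of_nat (m * a * b) * c\<^sup>2 / 2) * lG\<^sup>2"
proof -
  define i where "i = bc (1 / of_nat p)"
  define h where "h = bc (1 / 2)"
  define C where "C = bc c"
  define M' where "M' = (of_nat m :: bps)" 
  define a' where "a' = (of_nat a :: bps)"
  define b' where "b' = (of_nat b :: bps)"
  have h2: "2 * h = 1" using bc_half(2)[of 1] by (simp add: h_def)
  have c: "bc (of_nat b * c) = b' * C" "bc (of_nat a * c) = a' * C" "bc (of_nat (m * a) * c) = M' * a' * C"
    "bc (1 / of_nat p ^ 2) = i * i" "bc (of_nat m / of_nat p) = M' * i"
    "bc (of_nat (m * a * b) * c\<^sup>2 / 2) = M' * a' * b' * C * C * h"
    by (simp_all add: b'_def a'_def C_def M'_def i_def h_def power2_eq_square mult.assoc flip: bc_mult bc_of_nat)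
  have n: "of_nat (m * a) = M' * a'" "of_nat (m * b) = M' * b'"
    by (simp_all add: M'_def a'_def b'_def)
  note fr = frob_linear[OF p] frob_hom[OF p]
  have fb: "frob p a' = a'" "frob p b' = b'" "frob p C = C" "frob p M' = M'" "frob p h = h"
    using frob_hom(4)[OF p] by (auto simp: a'_def b'_def M'_def C_def h_def simp flip: bc_of_nat)
  show ?thesis
    unfolding frob_defect_def dilog_defect_def lG_def l_def ell_def c n i_def[symmetric] C_def[symmetric]
      fr(1) fr(6) frob_hom(1,3)[OF p] fb G_def
    using h2 by algebra
qed

lemma integral_step:
  assumes p: "prime p" and st: "integral_state p m (L, M, S)" and ab: "a + b \<ge> 1" and c: "c \<in> \<int>"
  shows "integral_state p m (step m (a, b, c) (L, M, S))"
proof -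
  obtain z where z: "c = of_int z" using c by (elim Ints_cases)
  from st have L1: "L \<in> xy_power 1" and M1: "M \<in> xy_power 1"
    and eL: "pexp L \<in> pser p" "pexp (- L) \<in> pser p" and eM: "pexp M \<in> pser p" "pexp (- M) \<in> pser p"
    and lL: "ell p L \<in> pser p" and lM: "ell p M \<in> pser p"
    and D: "frob_defect p m L M S - frob_correction p m L M \<in> pser p"
    by (auto simp: integral_state_def)
  define g where "g = cluster m L M a b"
  define G where "G = Ln g"
  define lG where "lG = ell p G"
  define l where "l = of_nat (m * a) * ell p L + of_nat (m * b) * ell p M"
  define e :: rat where "e = (if p = 2 then (- 1) ^ (m * a * b) else 1)"
  have g1: "g \<in> xy_power 1" unfolding g_def by (rule xy_power_mono[OF cluster_xy_power ab])
  have gp: "g \<in> pser p" unfolding g_def by (rule cluster_pser[OF p L1 M1 eL(1) eM(1)])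
  have l1: "l \<in> xy_power 1" unfolding l_def by (intro xy_power_add xy_power_mult_left ell_linear(5)[OF p] L1 M1)
  have lp: "l \<in> pser p" unfolding l_def by (intro pser_intros[OF p] lL lM)
  have e1: "e = 1 \<or> e = - 1 \<and> p = 2" by (cases "even (m * a * b)") (simp_all add: e_def)
  have fg: "frob p g = bc e * g ^ p * pexp (- (of_nat p * l))"
    unfolding g_def l_def e_def by (rule frob_cluster[OF p L1 M1])
  have G1: "G \<in> xy_power 1" unfolding G_def by (rule Ln_in_xy_power[OF g1]) simp
  have lGp: "lG \<in> pser p"
    using Ln_pser[OF p g1 gp l1 lp e1 fg] by (simp add: lG_def G_def ell_def)
  have lG1: "lG \<in> xy_power 1" unfolding lG_def by (rule ell_linear(5)[OF p G1])
  define L' where "L' = L - bc (of_nat b * c) * G"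
  define M' where "M' = M + bc (of_nat a * c) * G"
  define S' where "S' = S + bc c * Li2 g - bc (of_nat (m * a * b) * c\<^sup>2 / 2) * G\<^sup>2 + bc (of_nat (m * a) * c) * L * G"
  have step: "step m (a, b, c) (L, M, S) = (L', M', S')"
    by (simp add: L'_def M'_def S'_def g_def G_def Let_def)
  have L'1: "L' \<in> xy_power 1" "M' \<in> xy_power 1"
    unfolding L'_def M'_def by (rule xy_power_diff xy_power_add, (rule L1 M1), rule xy_power_cmult[OF G1])+
  \<comment> \<open>e^(k G) = (1 - g)^k, which has integral coefficients for every integer
    k.\<close>
  have ex: "pexp (A + bc (of_int k) * G) \<in> pser p" if "A \<in> xy_power 1" "pexp A \<in> pser p" for A k
    using pexp_Ln_pser[OF p g1 gp, of k] pexp_add[OF that(1) xy_power_cmult[OF G1], of "of_int k"]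
      pser_mult[OF p that(2)] by (simp add: G_def)
  have L'e: "pexp L' \<in> pser p" "pexp (- L') \<in> pser p"
    using ex[OF L1 eL(1), of "- (int b * z)"] ex[OF xy_power_uminus[OF L1] eL(2), of "int b * z"]
    by (simp_all add: L'_def z bc_uminus algebra_simps)
  have M'e: "pexp M' \<in> pser p" "pexp (- M') \<in> pser p"
    using ex[OF M1 eM(1), of "int a * z"] ex[OF xy_power_uminus[OF M1] eM(2), of "- (int a * z)"]
    by (simp_all add: M'_def z bc_uminus algebra_simps)
  have ellL': "ell p L' = ell p L - of_int (int b * z) * lG" "ell p M' = ell p M + of_int (int a * z) * lG"
    unfolding L'_def M'_def ell_linear[OF p] lG_def z by (simp_all flip: bc_of_int)
  have ell'p: "ell p L' \<in> pser p" "ell p M' \<in> pser p"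
    unfolding ellL' by (intro pser_intros[OF p] lL lM lGp)+
  define W where "W = dilog_defect p g l"
  have D': "frob_defect p m L' M' S' = frob_defect p m L M S + bc c * W
      + bc (of_nat (m * a) * c) * ell p L * lG - bc (of_nat (m * a * b) * c\<^sup>2 / 2) * lG\<^sup>2"
    unfolding L'_def M'_def S'_def lG_def G_def W_def l_def by (rule frob_defect_step[OF p])
  have I: "bc (of_nat (m * a) * c) * ell p L * lG \<in> pser p"
    unfolding z by (intro pser_intros[OF p] lL lGp pint_mult pint_of_int pint_simps(1) p)
  have cp: "bc c \<in> pser p" unfolding z by (intro pser_intros[OF p] pint_of_int p)
  have "frob_defect p m L' M' S' - frob_correction p m L' M' \<in> pser p"
  proof (cases "p = 2")
    case False
    have "W \<in> pser p" unfolding W_def by (rule dilog_defect_odd[OF p g1 gp l1 lp e1 fg False])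
    \<comment> \<open>For odd p the denominator 2 of the quadratic term is a unit.\<close>
    moreover have "bc (of_nat (m * a * b) * c\<^sup>2 / 2) \<in> pser p"
    proof -
      have "\<not> p dvd 2" using False p primes_dvd_imp_eq[of p 2] by auto
      from pint_inverse_nat[OF this] have "of_nat (m * a * b) * c\<^sup>2 * (1 / of_nat 2) \<in> pint p"
        unfolding z by (intro pint_mult pint_power pint_of_int pint_simps(1) p)
      then show ?thesis by (simp add: pser_bc[OF p])
    qed
    moreover have "frob_defect p m L M S \<in> pser p" using D False by (simp add: frob_correction_def)
    ultimately have "frob_defect p m L' M' S' \<in> pser p"
      unfolding D' by (intro pser_intros(1,2,4,9)[OF p] I cp lGp)
    then show ?thesis using False by (simp add: frob_correction_def)
  next
    case True
    note [simp] = True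
    have e2: "e = 1 \<or> e = - 1" using e1 by auto
    have fg2: "frob 2 g = bc e * g\<^sup>2 * pexp (- (2 * l))" using fg by simp
    note F2 = g1 gp[unfolded True] l1 lp[unfolded True] e2 fg2
    define Y where "Y = dilog_residue g l e * geo4 g"
    define K where "K = half_exp lG"
    have W: "W - bc (1 / 2) * Y \<in> pser 2"
      using dilog_defect_even[OF F2] by (simp add: W_def Y_def)
    have Kp: "K \<in> pser 2" unfolding K_def using lG1 lGp True by (intro half_exp_2) auto
    have "cong2 Y ((half_exp l)\<^sup>2 * K\<^sup>2 + (if e = 1 then 0 else K\<^sup>2))"
      unfolding Y_def K_def lG_def G_def True by (rule dilog_residue_cong2[OF F2])
    also have "cong2 \<dots> ((half_exp l)\<^sup>2 * K\<^sup>2 + of_nat (m * a * b) * K\<^sup>2)"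
    proof (rule cong2_add[OF cong2_refl])
      have "K\<^sup>2 \<in> pser 2" by (intro pser2 Kp)
      then have "cong2 (of_int (int (m * a * b)) * K\<^sup>2) (of_int (if e = 1 then 0 else 1) * K\<^sup>2)"
        by (rule cong2_of_int[rotated]) (auto simp: e_def minus_one_power_iff)
      then show "cong2 (if e = 1 then 0 else K\<^sup>2) (of_nat (m * a * b) * K\<^sup>2)"
        by - (rule cong2_sym, simp split: if_splits)
    qed
    finally have Y: "cong2 Y ((half_exp l)\<^sup>2 * K\<^sup>2 + of_nat (m * a * b) * K\<^sup>2)" .
    define Q where "Q = (half_exp (ell 2 L) * half_exp (ell 2 M))\<^sup>2"
    define Q' where "Q' = (half_exp (ell 2 L') * half_exp (ell 2 M'))\<^sup>2"
    have "cong2 (of_int z * Y - of_int (int (m * a * b) * z\<^sup>2) * lG\<^sup>2 - of_nat m * (Q' - Q)) 0"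
      unfolding Q_def Q'_def ellL'[unfolded True]
      by (rule correction_cong2) (use Y L1 M1 lL lM lG1 lGp ell_linear(5)[OF prime_2] in \<open>auto simp: K_def l_def\<close>)
    then have R: "bc (1 / 2) * (of_int z * Y - of_int (int (m * a * b) * z\<^sup>2) * lG\<^sup>2 - of_nat m * (Q' - Q)) \<in> pser 2"
      by (simp add: cong2_iff)
    \<comment> \<open>The half-integral parts of the dilogarithm and of the quadratic term are
      collected with the change of the correction into the expression of
      \<open>correction_cong2\<close>.\<close>
    have "frob_defect p m L' M' S' - frob_correction p m L' M' =
      (frob_defect p m L M S - frob_correction p m L M) + bc c * (W - bc (1 / 2) * Y)
      + bc (of_nat (m * a) * c) * ell p L * lG
      + bc (1 / 2) * (of_int z * Y - of_int (int (m * a * b) * z\<^sup>2) * lG\<^sup>2 - of_nat m * (Q' - Q))"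
    proof -
      have 1: "bc (of_nat (m * a * b) * c\<^sup>2 / 2) = bc (1 / 2) * of_int (int (m * a * b) * z\<^sup>2)"
        unfolding z by (simp flip: bc_of_int bc_mult)
      have 2: "frob_correction p m L' M' = bc (1 / 2) * of_nat m * Q'" "frob_correction p m L M = bc (1 / 2) * of_nat m * Q"
        by (simp_all add: frob_correction_def Q_def Q'_def flip: bc_of_nat bc_mult)
      have 3: "bc c = of_int z" by (simp add: z bc_of_int)
      show ?thesis unfolding D' 1 2 3 by (simp add: algebra_simps)
    qed
    also have "\<dots> \<in> pser p"
      using D W R I cp unfolding True by (metis pser2(1,4))
    finally show ?thesis .
  qed
  then show ?thesis
    unfolding step integral_state_def using L'1 L'e M'e ell'p by simp
qed

section \<open>Generating functions of products\<close>

definition states :: "nat \<Rightarrow> (nat \<times> nat \<times> rat) list \<Rightarrow> bps \<times> bps \<times> bps" where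
  "states m xs = fold (step m) xs (0, 0, 0)"

definition valid :: "nat \<times> nat \<times> rat \<Rightarrow> bool" where
  "valid = (\<lambda>(a, b, c). a + b \<ge> 1)"

lemma states_Nil: "states m [] = (0, 0, 0)"
  and states_snoc: "states m (xs @ [x]) = step m x (states m xs)"
  by (simp_all add: states_def)

lemma states_xy_power:
  assumes "\<forall>x\<in>set xs. valid x" "states m xs = (L, M, S)"
  shows "L \<in> xy_power 1 \<and> M \<in> xy_power 1 \<and> S \<in> xy_power 1"
  using assms
proof (induction xs arbitrary: L M S rule: rev_induct)
  case Nil
  then show ?case by (simp add: states_Nil)
next
  case (snoc x xs)
  obtain L0 M0 S0 where st: "states m xs = (L0, M0, S0)" by (metis prod_cases3)
  obtain a b c where x: "x = (a, b, c)" by (metis prod_cases3)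
  have ab: "a + b \<ge> 1" using snoc.prems x by (simp add: valid_def)
  have 0: "L0 \<in> xy_power 1" "M0 \<in> xy_power 1" "S0 \<in> xy_power 1" using snoc.IH[OF _ st] snoc.prems by auto
  let ?g = "cluster m L0 M0 a b"
  have g: "?g \<in> xy_power 1" by (rule xy_power_mono[OF cluster_xy_power ab])
  have G: "Ln ?g \<in> xy_power 1" "Li2 ?g \<in> xy_power 1" using Ln_in_xy_power[OF g] Li2_in_xy_power[OF g] by auto
  have "(L, M, S) = step m (a, b, c) (L0, M0, S0)" using snoc.prems st x by (simp add: states_snoc)
  then have LMS: "L = L0 - bc (of_nat b * c) * Ln ?g" "M = M0 + bc (of_nat a * c) * Ln ?g"
    "S = S0 + bc c * Li2 ?g - bc (of_nat (m * a * b) * c\<^sup>2 / 2) * (Ln ?g)\<^sup>2 + bc (of_nat (m * a) * c) * L0 * Ln ?g"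
    by (simp_all add: Let_def)
  have "(Ln ?g)\<^sup>2 \<in> xy_power 1" unfolding power2_eq_square by (rule xy_power_mult_left[OF G(1)])
  then have "S \<in> xy_power 1" unfolding LMS(3)
    by (intro xy_power_add[OF xy_power_diff[OF xy_power_add]] xy_power_cmult 0 G xy_power_mult_left[OF G(1)])
  then show ?case unfolding LMS(1,2)
    by (intro conjI xy_power_diff[OF _ xy_power_cmult] xy_power_add[OF _ xy_power_cmult] 0 G)
qed

lemma integral_states:
  assumes p: "prime p" and "\<forall>(a, b, c)\<in>set xs. a + b \<ge> 1 \<and> c \<in> \<int>"
  shows "integral_state p m (states m xs)"
  using assms(2)
proof (induction xs rule: rev_induct)
  case Nil
  have "pexp 0 = 1" by simp
  then show ?case
    by (simp add: states_Nil integral_state_def frob_defect_def frob_correction_def ell_def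
        frob_linear(4)[OF p] frob_linear(4)[OF prime_2] half_exp_0 pser_intros[OF p] pser_0[OF prime_2])
next
  case (snoc x xs)
  obtain L M S where st: "states m xs = (L, M, S)" by (metis prod_cases3)
  obtain a b c where x: "x = (a, b, c)" by (metis prod_cases3)
  have "integral_state p m (L, M, S)" using snoc by (simp add: st)
  from integral_step[OF p this, of a b c] snoc.prems show ?case by (simp add: states_snoc st x)
qed

text \<open>
  The equation \<open>dS = L dy/y - M dx/x + m L dM\<close>, contracted with \<open>D = r x \<partial>/\<partial>x + s y \<partial>/\<partial>y\<close>.
\<close>

lemma derivation_states:
  assumes D: "derivation D"
    and mon: "\<And>a b. D (bX ^ a * bY ^ b) = (of_nat a * r + of_nat b * s) * (bX ^ a * bY ^ b)"
    and "\<forall>x\<in>set xs. valid x" "states m xs = (L, M, S)"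
  shows "D S = s * L - r * M + of_nat m * L * D M"
  using assms(3,4)
proof (induction xs arbitrary: L M S rule: rev_induct)
  case Nil
  then show ?case using cont_linearD(4)[OF derivationD(1)[OF D]] by (simp add: states_Nil)
next
  case (snoc x xs)
  obtain L0 M0 S0 where st: "states m xs = (L0, M0, S0)" by (metis prod_cases3)
  obtain a b c where x: "x = (a, b, c)" by (metis prod_cases3)
  have ab: "a + b \<ge> 1" using snoc.prems x by (simp add: valid_def)
  have IH: "D S0 = s * L0 - r * M0 + of_nat m * L0 * D M0" using snoc.IH[OF _ st] snoc.prems by auto
  have 0: "L0 \<in> xy_power 1" "M0 \<in> xy_power 1" using states_xy_power[OF _ st] snoc.prems by auto
  note lin = cont_linearD[OF derivationD(1)[OF D]] and der = derivationD[OF D]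
  define g where "g = cluster m L0 M0 a b"
  define G where "G = Ln g"
  have g1: "g \<in> xy_power 1" unfolding g_def by (rule xy_power_mono[OF cluster_xy_power ab])
  have t1: "of_nat (m * a) * L0 + of_nat (m * b) * M0 \<in> xy_power 1" by (intro xy_power_add xy_power_mult_left 0)
  have nat: "D (of_nat n * f) = of_nat n * D f" for n f using lin(2)[of "of_nat n" f] by (simp add: bc_of_nat)
  \<comment> \<open>The logarithmic derivative of g. Its part in \<open>D L0\<close> produces a term
    in \<open>G * D L0\<close> that the derivative of the summand in \<open>L0 * G\<close> cancels,
    which is why that summand belongs to S.\<close>
  define w where "w = of_nat a * r + of_nat b * s + of_nat (m * a) * D L0 + of_nat (m * b) * D M0"
  have Dg: "D g = g * w"
    unfolding g_def cluster_def w_def mult.assoc[of "bc _"] lin(2) der(2)[of "bX ^ a * bY ^ b"] mon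
      derivation_pexp[OF D t1] lin(1) nat
    by (simp only: algebra_simps)
  have DLi: "D (Li2 g) = - G * w" unfolding G_def by (rule derivation_Li2[OF D g1 Dg])
  have "(L, M, S) = step m (a, b, c) (L0, M0, S0)" using snoc.prems st x by (simp add: states_snoc)
  then have LMS: "L = L0 - bc (of_nat b * c) * G" "M = M0 + bc (of_nat a * c) * G"
    "S = S0 + bc c * Li2 g - bc (of_nat (m * a * b) * c\<^sup>2 / 2) * G\<^sup>2 + bc (of_nat (m * a) * c) * (L0 * G)"
    by (simp_all add: Let_def g_def G_def mult.assoc)
  have DG2: "D (G\<^sup>2) = 2 * (G * D G)" by (simp add: power2_eq_square der(2))
  define C where "C = bc c"
  define h where "h = bc (1 / 2)"
  have h2: "2 * h = 1" using bc_half(2)[of 1] by (simp add: h_def)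
  have c: "bc (of_nat b * c) = of_nat b * C" "bc (of_nat a * c) = of_nat a * C" "bc (of_nat (m * a) * c) = of_nat m * of_nat a * C"
    "bc (of_nat (m * a * b) * c\<^sup>2 / 2) = of_nat m * of_nat a * of_nat b * C * C * h"
    by (simp_all add: C_def h_def power2_eq_square mult.assoc flip: bc_mult bc_of_nat)
  have "D S = D S0 + C * (- G * w) - of_nat m * of_nat a * of_nat b * C * C * h * (2 * (G * D G))
      + of_nat m * of_nat a * C * (D L0 * G + L0 * D G)"
    unfolding LMS lin(1,6) lin(2) DLi DG2 der(2)[of L0 G] unfolding c C_def[symmetric] ..
  moreover have "D M = D M0 + of_nat a * C * D G"
    unfolding LMS lin(1) lin(2) unfolding c ..
  moreover have "L = L0 - of_nat b * C * G" "M = M0 + of_nat a * C * G" by (simp_all add: LMS c)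
  ultimately show ?case
    unfolding IH w_def of_nat_mult using h2 by algebra
qed

text \<open>The differential equation determines S from L and M up to a constant, and the constant
  term vanishes. Thus S can be compared for two different factorisations of nearly the same
  automorphism.\<close>

lemma states_diff_S:
  assumes xs: "\<forall>x\<in>set xs. valid x" "states m xs = (L, M, S)"
    and ys: "\<forall>x\<in>set ys. valid x" "states m ys = (L', M', S')"
    and L: "L - L' \<in> xy_power k" and M: "M - M' \<in> xy_power k"
  shows "S - S' \<in> xy_power k"
proof -
  have D: "D S - D S' \<in> xy_power k"
    if D: "derivation D" and mon: "\<And>a b. D (bX ^ a * bY ^ b) = (of_nat a * r + of_nat b * s) * (bX ^ a * bY ^ b)"
    for D r s
  proof -
    have "D S - D S' = s * (L - L') - r * (M - M') + of_nat m * ((L - L') * D M + L' * D (M - M'))"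
      unfolding derivation_states[OF D mon xs] derivation_states[OF D mon ys] cont_linearD(6)[OF derivationD(1)[OF D]]
      by (simp add: algebra_simps)
    also have "\<dots> \<in> xy_power k"
      by (rule xy_power_add[OF xy_power_diff xy_power_mult_left[OF xy_power_add]])
        (intro xy_power_mult_left xy_power_mult_right L M cont_linearD(3)[OF derivationD(1)[OF D]])+
    finally show ?thesis .
  qed
  have x: "theta_x S - theta_x S' \<in> xy_power k"
    by (rule D[of _ 1 0]) (simp_all add: derivation_theta theta_monom)
  have y: "theta_y S - theta_y S' \<in> xy_power k"
    by (rule D[of _ 0 1]) (simp_all add: derivation_theta theta_monom)
  have S: "S \<in> xy_power 1" "S' \<in> xy_power 1" using states_xy_power[OF xs] states_xy_power[OF ys] by auto
  show ?thesis unfolding xy_power_def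
  proof (clarify)
    fix i j assume ij: "i + j < k"
    have "of_nat i * bcoeff (S - S') i j = 0" "of_nat j * bcoeff (S - S') i j = 0"
      using x y ij by (simp_all add: xy_power_def theta_x_def theta_y_def algebra_simps)
    then show "bcoeff (S - S') i j = 0" using S by (cases "i = 0 \<and> j = 0") (auto simp: xy_power_def)
  qed
qed

section \<open>From states to automorphisms\<close>

definition subst_state :: "nat \<Rightarrow> bps \<Rightarrow> bps \<Rightarrow> bps \<Rightarrow> bps" where
  "subst_state m L M = subst_xy (bX * pexp (of_nat m * L)) (bY * pexp (of_nat m * M))"

lemma subst_state:
  "cont_hom (subst_state m L M)" "subst_state m L M bX = bX * pexp (of_nat m * L)"
  "subst_state m L M bY = bY * pexp (of_nat m * M)"
proof -
  have *: "bX * pexp (of_nat m * L) \<in> xy_power 1" "bY * pexp (of_nat m * M) \<in> xy_power 1"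
    by (intro xy_power_mult_right bX_in_xy_power bY_in_xy_power)+
  show "cont_hom (subst_state m L M)" unfolding subst_state_def by (rule cont_hom_subst[OF *])
  show "subst_state m L M bX = bX * pexp (of_nat m * L)" "subst_state m L M bY = bY * pexp (of_nat m * M)"
    unfolding subst_state_def by (rule subst_xy_bX[OF *] subst_xy_bY[OF *])+
qed

lemma T_powr_eq:
  fixes m a b :: nat
  assumes ab: "a + b \<ge> 1"
  defines "G \<equiv> Ln (cluster m 0 0 a b)"
  shows "T_powr m a b c = subst_state m (- (bc (of_nat b * c) * G)) (bc (of_nat a * c) * G)"
proof -
  have g: "cluster m 0 0 a b \<in> xy_power 1" by (rule xy_power_mono[OF cluster_xy_power ab])
  have u: "- ((- 1) ^ (m * a * b) * bX ^ a * bY ^ b) = - cluster m 0 0 a b"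
    by (simp add: cluster_def bc_power bc_uminus mult.assoc)
  have pw: "one_plus_powr (- ((- 1) ^ (m * a * b) * bX ^ a * bY ^ b)) r = pexp (bc r * G)" for r
    unfolding u G_def pexp_Ln[OF g] by (rule one_plus_powr_eq[OF xy_power_uminus[OF g]])
  have eq: "bc (- (of_nat m * of_nat b * c)) * G = of_nat m * (- (bc (of_nat b * c) * G))"
    "bc (of_nat m * of_nat a * c) * G = of_nat m * (bc (of_nat a * c) * G)"
    by (simp_all add: bc_uminus mult.assoc bc_mult flip: bc_of_nat)
  show ?thesis unfolding T_powr_def Let_def pw subst_state_def eq ..
qed

lemma subst_state_cluster:
  assumes "L \<in> xy_power 1" "M \<in> xy_power 1"
  shows "subst_state m L M (cluster m 0 0 a b) = cluster m L M a b"
proof -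
  have mL: "of_nat m * L \<in> xy_power 1" "of_nat m * M \<in> xy_power 1" by (intro xy_power_mult_left assms)+
  have "pexp (of_nat (m * a) * L + of_nat (m * b) * M) =
      pexp (of_nat a * (of_nat m * L) + of_nat b * (of_nat m * M))"
    by (simp add: mult_ac)
  also have "\<dots> = pexp (of_nat m * L) ^ a * pexp (of_nat m * M) ^ b"
    by (subst pexp_add) (simp_all only: pexp_of_nat[OF mL(1)] pexp_of_nat[OF mL(2)] xy_power_mult_left mL)
  finally have e: "pexp (of_nat (m * a) * L + of_nat (m * b) * M) = pexp (of_nat m * L) ^ a * pexp (of_nat m * M) ^ b" .
  show ?thesis
    unfolding cluster_def e
    by (simp add: cont_linearD(2)[OF cont_homD(1)[OF subst_state(1)]] cont_homD(2-5)[OF subst_state(1)]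
        subst_state(2,3) power_mult_distrib mult_ac)
qed

text \<open>The homomorphism on the left sends x e^(m A) to x e^(m L) times the exponential of the
  image of m A, and it carries the logarithm at the signed monomial to the logarithm at
  \<open>cluster m L M a b\<close>.\<close>

lemma subst_state_step:
  assumes L: "L \<in> xy_power 1" and M: "M \<in> xy_power 1" and ab: "a + b \<ge> 1"
    and st: "step m (a, b, c) (L, M, S) = (L', M', S')"
  shows "subst_state m L M (T_powr m a b c f) = subst_state m L' M' f"
proof -
  let ?g = "cluster m 0 0 a b" and ?\<phi> = "subst_state m L M"
  have g: "?g \<in> xy_power 1" by (rule xy_power_mono[OF cluster_xy_power ab])
  have G: "Ln ?g \<in> xy_power 1" "Ln (cluster m L M a b) \<in> xy_power 1"
    using Ln_in_xy_power[OF g] Ln_in_xy_power[OF xy_power_mono[OF cluster_xy_power ab]] by auto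
  have \<phi>G: "?\<phi> (Ln ?g) = Ln (cluster m L M a b)"
    unfolding Ln_def hom_ps[OF g subst_state(1)] subst_state_cluster[OF L M] ..
  have \<phi>e: "?\<phi> (pexp (bc r * Ln ?g)) = pexp (bc r * Ln (cluster m L M a b))" for r
    unfolding pexp_def hom_ps[OF xy_power_cmult[OF G(1)] subst_state(1)]
    by (simp add: cont_linearD(2)[OF cont_homD(1)[OF subst_state(1)]] \<phi>G)
  have L': "L' = L - bc (of_nat b * c) * Ln (cluster m L M a b)" "M' = M + bc (of_nat a * c) * Ln (cluster m L M a b)"
    using st by (simp_all add: Let_def)
  have eq: "of_nat m * (- (bc (of_nat b * c) * x)) = bc (of_nat m * (- (of_nat b * c))) * x"
    "of_nat m * (bc (of_nat a * c) * x) = bc (of_nat m * (of_nat a * c)) * x" for x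
    by (simp_all only: bc_mult bc_of_nat bc_uminus mult.assoc mult_minus_left mult_minus_right)
  have 1: "of_nat m * L' = of_nat m * L + bc (of_nat m * (- (of_nat b * c))) * Ln (cluster m L M a b)"
    "of_nat m * M' = of_nat m * M + bc (of_nat m * (of_nat a * c)) * Ln (cluster m L M a b)"
    unfolding L' eq[symmetric] by (simp_all add: right_diff_distrib distrib_left)
  have 2: "pexp (of_nat m * L') = pexp (of_nat m * L) * pexp (bc (of_nat m * (- (of_nat b * c))) * Ln (cluster m L M a b))"
    "pexp (of_nat m * M') = pexp (of_nat m * M) * pexp (bc (of_nat m * (of_nat a * c)) * Ln (cluster m L M a b))"
    unfolding 1 by (intro pexp_add xy_power_mult_left L M G)+
  show ?thesis unfolding T_powr_eq[OF ab]
  proof (rule cont_hom_eqI[OF cont_hom_comp[OF subst_state(1) subst_state(1)] subst_state(1)])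
    show "?\<phi> (subst_state m (- (bc (of_nat b * c) * Ln ?g)) (bc (of_nat a * c) * Ln ?g) bX) = subst_state m L' M' bX"
      unfolding subst_state(2) cont_homD(2)[OF subst_state(1)] eq \<phi>e 2 by (simp only: mult.assoc)
    show "?\<phi> (subst_state m (- (bc (of_nat b * c) * Ln ?g)) (bc (of_nat a * c) * Ln ?g) bY) = subst_state m L' M' bY"
      unfolding subst_state(3) cont_homD(2)[OF subst_state(1)] eq \<phi>e 2 by (simp only: mult.assoc)
  qed
qed

definition factor_product :: "nat \<Rightarrow> (nat \<times> nat \<times> rat) list \<Rightarrow> bps \<Rightarrow> bps" where
  "factor_product m xs = foldr (\<lambda>(a, b, c) \<phi>. T_powr m a b c \<circ> \<phi>) xs id"

lemma factor_product_eq: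
  assumes "\<forall>x\<in>set xs. valid x" "states m xs = (L, M, S)"
  shows "factor_product m xs f = subst_state m L M f"
  using assms
proof (induction xs arbitrary: L M S f rule: rev_induct)
  case Nil
  have "subst_state m 0 0 f = id f"
    by (rule cont_hom_eqI[OF subst_state(1) cont_hom_id(2)]) (simp_all add: subst_state)
  then show ?case using Nil by (simp add: states_Nil factor_product_def)
next
  case (snoc x xs)
  obtain L0 M0 S0 where st: "states m xs = (L0, M0, S0)" by (metis prod_cases3)
  obtain a b c where x: "x = (a, b, c)" by (metis prod_cases3)
  have ab: "a + b \<ge> 1" using snoc.prems x by (simp add: valid_def)
  have 0: "L0 \<in> xy_power 1" "M0 \<in> xy_power 1" using states_xy_power[OF _ st] snoc.prems by auto
  have fold: "foldr (\<lambda>(a, b, c) \<phi>. T_powr m a b c \<circ> \<phi>) ys \<psi> =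
    foldr (\<lambda>(a, b, c) \<phi>. T_powr m a b c \<circ> \<phi>) ys id \<circ> \<psi>" for ys \<psi>
    by (induction ys) (auto simp: fun_eq_iff)
  have "factor_product m (xs @ [x]) f = factor_product m xs (T_powr m a b c f)"
    unfolding factor_product_def by (simp add: x, subst fold, simp)
  also have "\<dots> = subst_state m L0 M0 (T_powr m a b c f)" using snoc st by auto
  also have "\<dots> = subst_state m L M f"
    by (rule subst_state_step[OF 0 ab]) (use snoc.prems st x in \<open>simp add: states_snoc\<close>)
  finally show ?case .
qed

section \<open>Truncation and conclusion\<close>

definition main_term :: "nat \<Rightarrow> nat \<times> nat \<times> rat \<Rightarrow> bps" where
  "main_term m = (\<lambda>(a, b, c). bc (c * (- 1) ^ (m * a * b)) * (bX ^ a * bY ^ b))"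

abbreviation deg :: "nat \<times> nat \<times> rat \<Rightarrow> nat" where
  "deg x \<equiv> fst x + fst (snd x)"

text \<open>The monomial in front gains a + b degrees. Since a + b >= 1 in all uses, a change of L
  and M in degree k reaches later factors only in degree k + 1.\<close>

lemma cluster_diff_xy_power:
  assumes L: "L \<in> xy_power 1" "L' \<in> xy_power 1" and M: "M \<in> xy_power 1" "M' \<in> xy_power 1"
    and d: "L - L' \<in> xy_power k" "M - M' \<in> xy_power k"
  shows "cluster m L M a b - cluster m L' M' a b \<in> xy_power (a + b + k)"
proof -
  let ?t = "of_nat (m * a) * L + of_nat (m * b) * M" and ?t' = "of_nat (m * a) * L' + of_nat (m * b) * M'"
  have "?t - ?t' = of_nat (m * a) * (L - L') + of_nat (m * b) * (M - M')" by (simp add: algebra_simps)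
  then have "?t - ?t' \<in> xy_power k" by (simp only: xy_power_add xy_power_mult_left d)
  then have "pexp ?t - pexp ?t' \<in> xy_power k"
    by (rule pexp_diff[rotated 2]) (intro xy_power_add xy_power_mult_left L M)+
  then have "bc ((- 1) ^ (m * a * b)) * ((bX ^ a * bY ^ b) * (pexp ?t - pexp ?t')) \<in> xy_power (a + b + k)"
    by (intro xy_power_cmult xy_power_mult monom_in_xy_power)
  then show ?thesis by (simp add: cluster_def algebra_simps)
qed

lemma xy_power_diff_mult:
  assumes "f \<in> xy_power 1" "g' \<in> xy_power 1" "f - f' \<in> xy_power k" "g - g' \<in> xy_power k"
  shows "f * g - f' * g' \<in> xy_power (Suc k)"
proof -
  have "f * g - f' * g' = f * (g - g') + (f - f') * g'" by (simp add: algebra_simps)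
  then show ?thesis
    using xy_power_add[OF xy_power_mult[OF assms(1,4)] ] xy_power_mult[OF assms(3,2)] by simp
qed

text \<open>Factors of degree at least N leave L and M alone below degree N, and by
  \<open>cluster_diff_xy_power\<close> they influence the other factors only from degree N + 1 on.
  In degree N of S each factor of that degree contributes just the linear term of its
  dilogarithm.\<close>

lemma states_filter:
  assumes "\<forall>x\<in>set xs. valid x" "states m xs = (L, M, S)" "N \<ge> 1"
    and "states m (filter (\<lambda>x. deg x < N) xs) = (L', M', S')"
  shows "L - L' \<in> xy_power N \<and> M - M' \<in> xy_power N \<and>
    S - S' - sum_list (map (main_term m) (filter (\<lambda>x. deg x = N) xs)) \<in> xy_power (Suc N)"
  using assms
proof (induction xs arbitrary: L M S L' M' S' rule: rev_induct)
  case Nil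
  then show ?case by (simp add: states_Nil)
next
  case (snoc x xs)
  let ?Q = "filter (\<lambda>x. deg x < N) xs" and ?R = "sum_list (map (main_term m) (filter (\<lambda>x. deg x = N) xs))"
  obtain L0 M0 S0 where st: "states m xs = (L0, M0, S0)" by (metis prod_cases3)
  obtain L1 M1 S1 where st1: "states m ?Q = (L1, M1, S1)" by (metis prod_cases3)
  obtain a b c where x: "x = (a, b, c)" by (metis prod_cases3)
  have ab: "a + b \<ge> 1" using snoc.prems x by (simp add: valid_def)
  have IH: "L0 - L1 \<in> xy_power N" "M0 - M1 \<in> xy_power N" "S0 - S1 - ?R \<in> xy_power (Suc N)"
    using snoc.IH[OF _ st _ st1] snoc.prems by auto
  have 0: "L0 \<in> xy_power 1" "M0 \<in> xy_power 1" using states_xy_power[OF _ st] snoc.prems by auto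
  have 1: "L1 \<in> xy_power 1" "M1 \<in> xy_power 1" using states_xy_power[OF _ st1] snoc.prems by auto
  define g where "g = cluster m L0 M0 a b"
  have g: "g \<in> xy_power (a + b)" "g \<in> xy_power 1"
    unfolding g_def using cluster_xy_power xy_power_mono[OF cluster_xy_power ab] by auto
  have G: "Ln g \<in> xy_power (a + b)" "Ln g \<in> xy_power 1"
    using Ln_in_xy_power[OF g(1) ab] Ln_in_xy_power[OF g(2)] by auto
  have "(L, M, S) = step m (a, b, c) (L0, M0, S0)" using snoc.prems st x by (simp add: states_snoc)
  then have LMS: "L = L0 - bc (of_nat b * c) * Ln g" "M = M0 + bc (of_nat a * c) * Ln g"
    "S = S0 + bc c * Li2 g - bc (of_nat (m * a * b) * c\<^sup>2 / 2) * (Ln g * Ln g) + bc (of_nat (m * a) * c) * (L0 * Ln g)"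
    by (simp_all add: Let_def g_def mult.assoc power2_eq_square)
  show ?case
  proof (cases "a + b < N")
    case True
    define g' where "g' = cluster m L1 M1 a b"
    have g': "g' \<in> xy_power 1" unfolding g'_def by (rule xy_power_mono[OF cluster_xy_power ab])
    have G': "Ln g' \<in> xy_power 1" using Ln_in_xy_power[OF g'] by simp
    have "(L', M', S') = step m (a, b, c) (L1, M1, S1)" using snoc.prems st1 x True by (simp add: states_snoc)
    then have LMS': "L' = L1 - bc (of_nat b * c) * Ln g'" "M' = M1 + bc (of_nat a * c) * Ln g'"
      "S' = S1 + bc c * Li2 g' - bc (of_nat (m * a * b) * c\<^sup>2 / 2) * (Ln g' * Ln g') + bc (of_nat (m * a) * c) * (L1 * Ln g')"
      by (simp_all add: Let_def g'_def mult.assoc power2_eq_square)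
    have "g - g' \<in> xy_power (a + b + N)"
      unfolding g_def g'_def by (rule cluster_diff_xy_power[OF 0(1) 1(1) 0(2) 1(2) IH(1,2)])
    then have gg: "g - g' \<in> xy_power (Suc N)" by (rule xy_power_mono) (use ab in simp)
    have GG: "Ln g - Ln g' \<in> xy_power (Suc N)" "Li2 g - Li2 g' \<in> xy_power (Suc N)"
      unfolding Ln_def Li2_def by (rule ps_diff_in_xy_power[OF g(2) g' gg])+
    have GN: "Ln g - Ln g' \<in> xy_power N" by (rule xy_power_mono[OF GG(1)]) simp
    have "L - L' = (L0 - L1) - bc (of_nat b * c) * (Ln g - Ln g')"
      "M - M' = (M0 - M1) + bc (of_nat a * c) * (Ln g - Ln g')"
      unfolding LMS LMS' by (simp_all add: algebra_simps)
    moreover have "(L0 - L1) - bc (of_nat b * c) * (Ln g - Ln g') \<in> xy_power N"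
      by (rule xy_power_diff[OF IH(1) xy_power_cmult[OF GN]])
    moreover have "(M0 - M1) + bc (of_nat a * c) * (Ln g - Ln g') \<in> xy_power N"
      by (rule xy_power_add[OF IH(2) xy_power_cmult[OF GN]])
    moreover have "S - S' - ?R = (S0 - S1 - ?R) + bc c * (Li2 g - Li2 g')
        - bc (of_nat (m * a * b) * c\<^sup>2 / 2) * (Ln g * Ln g - Ln g' * Ln g')
        + bc (of_nat (m * a) * c) * (L0 * Ln g - L1 * Ln g')"
      unfolding LMS LMS' by (simp add: algebra_simps)
    moreover have "\<dots> \<in> xy_power (Suc N)"
      by (rule xy_power_add[OF xy_power_diff[OF xy_power_add[OF IH(3) xy_power_cmult[OF GG(2)]]
          xy_power_cmult[OF xy_power_diff_mult[OF G(2) G' GN GN]]]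
          xy_power_cmult[OF xy_power_diff_mult[OF 0(1) G' IH(1) GN]]])
    moreover have "filter (\<lambda>x. deg x = N) (xs @ [x]) = filter (\<lambda>x. deg x = N) xs" using True by (simp add: x)
    ultimately show ?thesis by (simp only:)
  next
    case False
    then have Q: "filter (\<lambda>x. deg x < N) (xs @ [x]) = ?Q" by (simp add: x)
    have LMS': "L' = L1" "M' = M1" "S' = S1" using snoc.prems st1 unfolding Q by simp_all
    have GN: "Ln g \<in> xy_power N" using xy_power_mono[OF G(1)] False by simp
    have "L - L' = (L0 - L1) - bc (of_nat b * c) * Ln g" "M - M' = (M0 - M1) + bc (of_nat a * c) * Ln g"
      unfolding LMS LMS' by (simp_all add: algebra_simps)
    moreover have "(L0 - L1) - bc (of_nat b * c) * Ln g \<in> xy_power N"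
      by (rule xy_power_diff[OF IH(1) xy_power_cmult[OF GN]])
    moreover have "(M0 - M1) + bc (of_nat a * c) * Ln g \<in> xy_power N"
      by (rule xy_power_add[OF IH(2) xy_power_cmult[OF GN]])
    moreover have "S - S' - sum_list (map (main_term m) (filter (\<lambda>x. deg x = N) (xs @ [x]))) \<in> xy_power (Suc N)"
    proof -
      define r where "r = (if a + b = N then main_term m x else 0)"
      have gg: "g - cluster m 0 0 a b \<in> xy_power (Suc (a + b))"
        unfolding g_def using cluster_diff_xy_power[of L0 0 M0 0 1 m a b] 0 by simp
      have "bc c * cluster m 0 0 a b = main_term m x"
        by (simp add: cluster_def main_term_def x bc_mult mult.assoc)
      then have "bc c * g - main_term m x = bc c * (g - cluster m 0 0 a b)" by (simp add: algebra_simps)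
      then have gr: "bc c * g - r \<in> xy_power (Suc N)"
      proof (cases "a + b = N")
        case True
        then show ?thesis using xy_power_cmult[OF gg, of c] \<open>bc c * g - main_term m x = _\<close> by (simp add: r_def)
      next
        case neq: False
        then have "Suc N \<le> a + b" using False by simp
        from xy_power_cmult[OF xy_power_mono[OF g(1) this]] show ?thesis using neq by (simp add: r_def)
      qed
      have "N \<le> a + b" using False by simp
      then have "Suc N \<le> 2 * (a + b)" using ab by presburger
      with Li2_approx[OF g(1) ab] have Li: "Li2 g - g \<in> xy_power (Suc N)" by (rule xy_power_mono)
      have GGL: "Ln g * Ln g \<in> xy_power (Suc N)" "L0 * Ln g \<in> xy_power (Suc N)"
        using xy_power_mult[OF G(2) GN] xy_power_mult[OF 0(1) GN] by simp_all
      have "sum_list (map (main_term m) (filter (\<lambda>x. deg x = N) (xs @ [x]))) = ?R + r"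
        by (simp add: r_def x)
      then have "S - S' - sum_list (map (main_term m) (filter (\<lambda>x. deg x = N) (xs @ [x]))) =
        (S0 - S1 - ?R) + bc c * (Li2 g - g) + (bc c * g - r)
        - bc (of_nat (m * a * b) * c\<^sup>2 / 2) * (Ln g * Ln g) + bc (of_nat (m * a) * c) * (L0 * Ln g)"
        unfolding LMS LMS' by (simp add: algebra_simps)
      also have "\<dots> \<in> xy_power (Suc N)"
        by (rule xy_power_add[OF xy_power_diff[OF xy_power_add[OF xy_power_add[OF IH(3) xy_power_cmult[OF Li]] gr]
          xy_power_cmult[OF GGL(1)]] xy_power_cmult[OF GGL(2)]])
      finally show ?thesis .
    qed
    ultimately show ?thesis by simp
  qed
qed

section \<open>Comparing two products\<close>

lemma xy_power_bX_mult:
  assumes "bX * f \<in> xy_power (Suc k)"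
  shows "f \<in> xy_power k"
  unfolding xy_power_def
proof (clarify)
  fix i j assume "i + j < k"
  then have "bcoeff (bX * f) (Suc i) j = 0" using assms by (simp add: xy_power_def)
  then show "bcoeff f i j = 0" by (simp add: bcoeff_def bX_def)
qed

lemma xy_power_bY_mult:
  assumes "bY * f \<in> xy_power (Suc k)"
  shows "f \<in> xy_power k"
  unfolding xy_power_def
proof (clarify)
  fix i j assume "i + j < k"
  then have "bcoeff (bY * f) i (Suc j) = 0" using assms by (simp add: xy_power_def)
  then show "bcoeff f i j = 0" by (simp add: bcoeff_def bY_def)
qed

text \<open>Cancelling the factor x or y costs one degree; then the logarithm is taken and m divided
  out.\<close>

lemma subst_state_eq_imp:
  assumes m: "m \<ge> 1" and L: "L \<in> xy_power 1" "L' \<in> xy_power 1" and M: "M \<in> xy_power 1" "M' \<in> xy_power 1"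
    and X: "subst_state m L M bX - subst_state m L' M' bX \<in> xy_power (Suc k)"
    and Y: "subst_state m L M bY - subst_state m L' M' bY \<in> xy_power (Suc k)"
    and k: "k \<ge> 1"
  shows "L - L' \<in> xy_power k" "M - M' \<in> xy_power k"
proof -
  have *: "A - B \<in> xy_power k"
    if "pexp (of_nat m * A) - pexp (of_nat m * B) \<in> xy_power k" "A \<in> xy_power 1" "B \<in> xy_power 1" for A B
  proof -
    have "of_nat m * A - of_nat m * B \<in> xy_power k"
      by (rule pexp_diff_imp[OF _ _ that(1) k]) (intro xy_power_mult_left that)+
    then have "bc (1 / of_nat m) * (bc (of_nat m) * (A - B)) \<in> xy_power k"
      by - (rule xy_power_cmult, simp add: right_diff_distrib bc_of_nat)
    moreover have "bc (1 / of_nat m) * (bc (of_nat m) * (A - B)) = A - B"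
      using m by (simp flip: mult.assoc bc_mult)
    ultimately show ?thesis by (simp only:)
  qed
  have "bX * (pexp (of_nat m * L) - pexp (of_nat m * L')) \<in> xy_power (Suc k)"
    using X unfolding subst_state by (simp add: right_diff_distrib)
  from *[OF xy_power_bX_mult[OF this] L] show "L - L' \<in> xy_power k" .
  have "bY * (pexp (of_nat m * M) - pexp (of_nat m * M')) \<in> xy_power (Suc k)"
    using Y unfolding subst_state by (simp add: right_diff_distrib)
  from *[OF xy_power_bY_mult[OF this] M] show "M - M' \<in> xy_power k" .
qed

text \<open>F multiplies degrees by p >= 2, and a product of two series without constant term
  changes one degree later than its factors; so in degree N only S is felt.\<close>

lemma frob_defect_diff:
  assumes p: "prime p" and N: "N \<ge> 1"
    and L: "L \<in> xy_power 1" "L' \<in> xy_power 1" and M: "M \<in> xy_power 1" "M' \<in> xy_power 1"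
    and dL: "L - L' \<in> xy_power N" and dM: "M - M' \<in> xy_power N" and dS: "S - S' \<in> xy_power N"
  shows "(frob_defect p m L M S - frob_correction p m L M)
     - (frob_defect p m L' M' S' - frob_correction p m L' M') - (S - S') \<in> xy_power (Suc N)"
proof -
  have "2 * N \<le> p * N" using prime_ge_2_nat[OF p] by simp
  then have pN: "Suc N \<le> p * N" using N by linarith
  have fS: "frob p (S - S') \<in> xy_power (Suc N)" by (rule xy_power_mono[OF frob_xy_power[OF p dS] pN])
  have fL: "frob p L \<in> xy_power 1" "frob p L - frob p L' \<in> xy_power N"
    using frob_linear(3)[OF p L(1)] frob_linear(3)[OF p dL] by (simp_all add: frob_linear(6)[OF p])
  have lM: "ell p M' \<in> xy_power 1" "ell p M - ell p M' \<in> xy_power N"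
    using ell_linear(5)[OF p M(2)] ell_linear(5)[OF p dM] by (simp_all add: ell_linear(2)[OF p])
  have 1: "frob p L * ell p M - frob p L' * ell p M' \<in> xy_power (Suc N)"
    by (rule xy_power_diff_mult[OF fL(1) lM(1) fL(2) lM(2)])
  have 2: "frob_correction p m L M - frob_correction p m L' M' \<in> xy_power (Suc N)"
  proof (cases "p = 2")
    case True
    have l: "ell 2 A \<in> xy_power 1" if "A \<in> xy_power 1" for A by (rule ell_linear(5)[OF prime_2 that])
    have h: "half_exp (ell 2 A) - half_exp (ell 2 B) \<in> xy_power N"
      if "A \<in> xy_power 1" "B \<in> xy_power 1" "A - B \<in> xy_power N" for A B
      using half_exp_diff_in_xy_power[OF l[OF that(1)] l[OF that(2)]] ell_linear(5)[OF prime_2 that(3)]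
      by (simp add: ell_linear(2)[OF prime_2])
    let ?u = "half_exp (ell 2 L) * half_exp (ell 2 M)" and ?u' = "half_exp (ell 2 L') * half_exp (ell 2 M')"
    have "?u - ?u' \<in> xy_power (Suc N)"
      by (rule xy_power_diff_mult[OF half_exp_in_xy_power half_exp_in_xy_power h h]) (intro l L M dL dM order.refl)+
    then have "bc (of_nat m / 2) * ((?u + ?u') * (?u - ?u')) \<in> xy_power (Suc N)"
      by (intro xy_power_cmult xy_power_mult_left)
    then show ?thesis using True by (simp add: frob_correction_def power2_eq_square algebra_simps)
  qed (simp add: frob_correction_def)
  have "(frob_defect p m L M S - frob_correction p m L M)
     - (frob_defect p m L' M' S' - frob_correction p m L' M') - (S - S') =
    - (bc (1 / of_nat p ^ 2) * frob p (S - S')) - bc (of_nat m / of_nat p) * (frob p L * ell p M - frob p L' * ell p M')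
     - (frob_correction p m L M - frob_correction p m L' M')"
    by (simp add: frob_defect_def frob_linear(6)[OF p] algebra_simps)
  also have "\<dots> \<in> xy_power (Suc N)"
    by (rule xy_power_diff[OF xy_power_diff[OF xy_power_uminus[OF xy_power_cmult[OF fS]] xy_power_cmult[OF 1]] 2])
  finally show ?thesis .
qed

text \<open>\<open>xs\<close> is not known to be integral and serves as a bridge: it agrees with the
  integral product \<open>ys\<close> up to degree N, and below degree N with its own truncation,
  which is integral by \<open>small\<close>. The invariant is applied to these two.\<close>

lemma exponent_pint:
  assumes p: "prime p" and m: "m \<ge> 1" and N: "N \<ge> 1"
    and xs: "\<forall>x\<in>set xs. valid x" and small: "\<forall>(a, b, c)\<in>set xs. a + b < N \<longrightarrow> c \<in> \<int>"
    and ys: "\<forall>(a, b, c)\<in>set ys. a + b \<ge> 1 \<and> c \<in> \<int>"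
    and X: "factor_product m xs bX - factor_product m ys bX \<in> xy_power (Suc (Suc N))"
    and Y: "factor_product m xs bY - factor_product m ys bY \<in> xy_power (Suc (Suc N))"
    and dist: "distinct (map (\<lambda>(a, b, c). (a, b)) xs)" and abc: "(a, b, c) \<in> set xs" "a + b = N"
  shows "c \<in> pint p"
proof -
  let ?Q = "filter (\<lambda>x. deg x < N) xs"
  have ys': "\<forall>x\<in>set ys. valid x" using ys by (auto simp: valid_def)
  have Q: "\<forall>x\<in>set ?Q. valid x" using xs by auto
  obtain L M S where s: "states m xs = (L, M, S)" by (metis prod_cases3)
  obtain L1 M1 S1 where s1: "states m ys = (L1, M1, S1)" by (metis prod_cases3)
  obtain L2 M2 S2 where s2: "states m ?Q = (L2, M2, S2)" by (metis prod_cases3)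
  note w = states_xy_power[OF xs s] states_xy_power[OF ys' s1] states_xy_power[OF Q s2]
  have d1: "L - L1 \<in> xy_power (Suc N)" "M - M1 \<in> xy_power (Suc N)"
    using subst_state_eq_imp[OF m, of L L1 M M1 "Suc N"] X Y w
    by (simp_all add: factor_product_eq[OF xs s] factor_product_eq[OF ys' s1])
  have dS1: "S - S1 \<in> xy_power (Suc N)" by (rule states_diff_S[OF xs s ys' s1 d1])
  let ?R = "sum_list (map (main_term m) (filter (\<lambda>x. deg x = N) xs))"
  have d2: "L - L2 \<in> xy_power N" "M - M2 \<in> xy_power N" "S - S2 - ?R \<in> xy_power (Suc N)"
    using states_filter[OF xs s N s2] by auto
  have d1': "L - L1 \<in> xy_power N" "M - M1 \<in> xy_power N" 
    by (rule xy_power_mono[OF d1(1)], simp) (rule xy_power_mono[OF d1(2)], simp)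
  have d: "L1 - L2 \<in> xy_power N" "M1 - M2 \<in> xy_power N"
    using xy_power_diff[OF d2(1) d1'(1)] xy_power_diff[OF d2(2) d1'(2)] by simp_all
  have dS: "S1 - S2 \<in> xy_power N" by (rule states_diff_S[OF ys' s1 Q s2 d])
  have R: "S1 - S2 - ?R \<in> xy_power (Suc N)" using xy_power_diff[OF d2(3) dS1] by (simp add: algebra_simps)
  have "integral_state p m (L1, M1, S1)" using integral_states[OF p ys, of m] by (simp only: s1)
  then have I1: "frob_defect p m L1 M1 S1 - frob_correction p m L1 M1 \<in> pser p" by (simp add: integral_state_def)
  have "integral_state p m (states m ?Q)"
    by (rule integral_states[OF p]) (use xs small in \<open>auto simp: valid_def\<close>)
  then have I2: "frob_defect p m L2 M2 S2 - frob_correction p m L2 M2 \<in> pser p" by (simp add: integral_state_def s2)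
  define H where "H = (frob_defect p m L1 M1 S1 - frob_correction p m L1 M1)
     - (frob_defect p m L2 M2 S2 - frob_correction p m L2 M2)"
  have H: "H \<in> pser p" unfolding H_def by (rule pser_diff[OF p I1 I2])
  have "H - (S1 - S2) \<in> xy_power (Suc N)"
    unfolding H_def using w by (intro frob_defect_diff[OF p N _ _ _ _ d dS]) auto
  from xy_power_add[OF this R] have "bcoeff H a b = bcoeff ?R a b" using abc by (simp add: xy_power_def)
  also have "bcoeff ?R a b = c * (- 1) ^ (m * a * b)"
  proof -
    have dxs: "distinct xs" and inj: "inj_on (\<lambda>(a, b, c). (a, b)) (set xs)" using dist by (simp_all add: distinct_map)
    from dxs have "?R = (\<Sum>x\<in>{x\<in>set xs. deg x = N}. main_term m x)"
      by (subst sum_list_distinct_conv_sum_set) auto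
    then have "bcoeff ?R a b = (\<Sum>x\<in>{x\<in>set xs. deg x = N}. bcoeff (main_term m x) a b)" by simp
    also have "\<dots> = (\<Sum>x\<in>{x\<in>set xs. deg x = N}. if x = (a, b, c) then c * (- 1) ^ (m * a * b) else 0)"
    proof (rule sum.cong[OF refl])
      fix x assume x: "x \<in> {x \<in> set xs. deg x = N}"
      obtain a' b' c' where x': "x = (a', b', c')" by (metis prod_cases3)
      have "c' = c" if "a' = a" "b' = b"
        using inj_onD[OF inj, of "(a, b, c')" "(a, b, c)"] abc(1) x that by (simp add: x')
      then show "bcoeff (main_term m x) a b = (if x = (a, b, c) then c * (- 1) ^ (m * a * b) else 0)"
        by (auto simp: x' main_term_def bcoeff_monom)
    qed
    also have "\<dots> = c * (- 1) ^ (m * a * b)" using abc by simp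
    finally show ?thesis .
  qed
  finally have eq: "bcoeff H a b = c * (- 1) ^ (m * a * b)" .
  have "c * (- 1) ^ (m * a * b) \<in> pint p" unfolding eq[symmetric] using H by (simp add: pser_def)
  then have "c * (- 1) ^ (m * a * b) * (- 1) ^ (m * a * b) \<in> pint p" by (rule pint_mult[OF p _ pint_sign[OF p]])
  moreover have "(- 1 :: rat) ^ (m * a * b) * (- 1) ^ (m * a * b) = 1" by (simp flip: power_mult_distrib)
  ultimately show ?thesis by (simp only: mult.assoc mult_1_right)
qed

section \<open>Ordered products as lists of factors\<close>

lemma slope_decreasing_list:
  assumes "finite S"
  shows "distinct (slope_decreasing_list S)" "set (slope_decreasing_list S) = S"
proof -
  obtain xs where xs: "set xs = S" "distinct xs" using finite_distinct_list[OF assms] by blast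
  \<comment> \<open>\<open>sort_key\<close> sorts upwards, so the slope is negated. Exhibiting one
    such list validates the choice operator.\<close>
  let ?L = "sort_key (\<lambda>p. - slope p) xs"
  have "sorted (map (\<lambda>p. - slope p) ?L)" by (rule sorted_sort_key)
  then have "sorted_wrt (\<lambda>p q. slope p \<ge> slope q) ?L" by (simp add: sorted_map)
  then have "\<exists>L. distinct L \<and> set L = S \<and> sorted_wrt (\<lambda>p q. slope p \<ge> slope q) L"
    using xs by (intro exI[of _ ?L]) auto
  from someI_ex[OF this] show "distinct (slope_decreasing_list S)" "set (slope_decreasing_list S) = S"
    unfolding slope_decreasing_list_def by auto
qed

lemma finite_ordered_product_eq:
  "finite_ordered_product m d S = factor_product m (map (\<lambda>(a, b). (a, b, d a b)) (slope_decreasing_list S))"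
proof -
  have "foldr (\<lambda>(a, b) \<phi>. T_powr m a b (d a b) \<otimes>\<^bsub>Poisson_Aut m\<^esub> \<phi>) xs id =
    foldr (\<lambda>(a, b, c) \<phi>. T_powr m a b c \<circ> \<phi>) (map (\<lambda>(a, b). (a, b, d a b)) xs) id" for xs
    by (induction xs) (auto simp: Poisson_Aut_def)
  then show ?thesis by (simp add: finite_ordered_product_def factor_product_def Poisson_Aut_def)
qed

theorem theorem6p3:
  fixes m :: nat and d :: "nat \<Rightarrow> nat \<Rightarrow> rat"
  assumes "m \<ge> 1"
    and "is_ordered_product m d (T_aut m 1 0 \<otimes>\<^bsub>Poisson_Aut m\<^esub> T_aut m 0 1)"
  shows "\<forall>a b. a + b \<ge> 1 \<longrightarrow> d a b \<in> \<int>"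
proof -
  let ?ys = "[(1, 0, 1), (0, 1, 1)] :: (nat \<times> nat \<times> rat) list"
  let ?A = "{(a, b). a + b \<ge> (1::nat)}"
  have P: "T_aut m 1 0 \<otimes>\<^bsub>Poisson_Aut m\<^esub> T_aut m 0 1 = factor_product m ?ys"
    by (simp add: factor_product_def Poisson_Aut_def T_aut_def)
  have "1 \<le> a + b \<Longrightarrow> d a b \<in> \<int>" if "a + b = N" for N a b
    using that
  proof (induction N arbitrary: a b rule: less_induct)
    case (less N)
    \<comment> \<open>The precision N + 2 leaves degree N of L and M visible after one degree is
      lost in dividing by x or y.\<close>
    have ev: "\<forall>\<^sub>F S in finite_subsets_at_top ?A. finite_ordered_product m d S f - factor_product m ?ys f \<in> xy_power (Suc (Suc N))" for f
      using assms(2) unfolding P is_ordered_product_def xy_adic_limit_def by (elim allE)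
    have "\<forall>\<^sub>F S in finite_subsets_at_top ?A.
      finite_ordered_product m d S bX - factor_product m ?ys bX \<in> xy_power (Suc (Suc N)) \<and>
      finite_ordered_product m d S bY - factor_product m ?ys bY \<in> xy_power (Suc (Suc N))"
      by (intro eventually_conj ev)
    then obtain S0 where S0: "finite S0 \<and> S0 \<subseteq> ?A \<and> (\<forall>S. finite S \<and> S0 \<subseteq> S \<and> S \<subseteq> ?A \<longrightarrow>
      finite_ordered_product m d S bX - factor_product m ?ys bX \<in> xy_power (Suc (Suc N)) \<and>
      finite_ordered_product m d S bY - factor_product m ?ys bY \<in> xy_power (Suc (Suc N)))"
      unfolding eventually_finite_subsets_at_top ..
    \<comment> \<open>Enlarging the finite set keeps the approximation and makes the exponent under
      consideration occur among the factors.\<close>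
    define S1 where "S1 = insert (a, b) S0"
    have S1: "finite S1" "S0 \<subseteq> S1" "S1 \<subseteq> ?A" "(a, b) \<in> S1" using S0 less.prems by (auto simp: S1_def)
    define xs where "xs = map (\<lambda>(a, b). (a, b, d a b)) (slope_decreasing_list S1)"
    have set: "set xs = (\<lambda>(a, b). (a, b, d a b)) ` S1"
      by (simp add: xs_def slope_decreasing_list[OF S1(1)])
    have "map (\<lambda>(a, b, c). (a, b)) xs = slope_decreasing_list S1"
      by (simp add: xs_def o_def case_prod_unfold)
    then have dist: "distinct (map (\<lambda>(a, b, c). (a, b)) xs)" by (simp add: slope_decreasing_list[OF S1(1)])
    have prod: "factor_product m xs bX - factor_product m ?ys bX \<in> xy_power (Suc (Suc N))"
      "factor_product m xs bY - factor_product m ?ys bY \<in> xy_power (Suc (Suc N))"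
      using S0 S1(1-3) unfolding finite_ordered_product_eq xs_def by simp_all
    have v: "\<forall>x\<in>set xs. valid x" using S1(3) by (auto simp: set valid_def)
    have small: "\<forall>(a, b, c)\<in>set xs. a + b < N \<longrightarrow> c \<in> \<int>"
      using less.IH S1(3) by (auto simp: set)
    have "d a b \<in> pint p" if p: "prime p" for p
      by (rule exponent_pint[OF p assms(1) _ v small _ prod dist]) (use less.prems S1(4) in \<open>auto simp: set\<close>)
    then show ?case by (rule pint_all_Ints)
  qed
  then show ?thesis by blast
qed

end
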